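(* Let $k\in\mathbb N$ and let $f=\lambda z+\mathrm{h.o.t.}\in\mathcal L_k$ with $0<\lambda<1$. Write $$f=\lambda z+\sum_{\mathbf 0_k<\boldsymbol m\le \mathbf 1_k} a_{\boldsymbol m}\, z\,\boldsymbol\ell_1^{m_1}\cdots\boldsymbol\ell_k^{m_k}+\mathrm{h.o.t.},\qquad \boldsymbol m=(m_1,\dots,m_k)\in\mathbb Z^k,$$ and set $$f_0:=\lambda z+\sum_{\mathbf 0_k<\boldsymbol m\le \mathbf 1_k} a_{\boldsymbol m}\, z\,\boldsymbol\ell_1^{m_1}\cdots\boldsymbol\ell_k^{m_k}$$ (the comparison $\mathbf 0_k<\boldsymbol m\le\mathbf 1_k$ is lexicographic in $\mathbb Z^k$; here $\mathbf 0_k=(0,\dots,0)$, $\mathbf 1_k=(1,\dots,1)$). Then there exists a unique parabolic logarithmic transseries $\varphi\in\mathfrak L^0$ such that $\varphi\circ f\circ\varphi^{-1}=f_0$. Moreover $\varphi\in\mathcal L_k^0$.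
   Context: $z$ is an infinitesimal variable; $\boldsymbol\ell_1:=-1/\ln z$ and $\boldsymbol\ell_{j+1}:=\boldsymbol\ell_j\circ\boldsymbol\ell_1$. For $k\in\mathbb N$, $\mathcal L_k$ is the set of formal sums $f=\sum a_{\alpha,n_1,\dots,n_k}z^\alpha\boldsymbol\ell_1^{n_1}\cdots\boldsymbol\ell_k^{n_k}$ with real coefficients whose support $\mathrm{Supp}(f)=\{(\alpha,n_1,\dots,n_k):a_{\alpha,n_1,\dots,n_k}\neq0\}$ is a well-ordered subset of $\mathbb R_{\ge0}\times\mathbb Z^k$ for the lexicographic order. (A monomial with lexicographically larger exponent tuple is smaller, e.g. $z\prec\boldsymbol\ell_1\prec\boldsymbol\ell_2$.) $\mathcal L_m\subseteq\mathcal L_k$ for $m\le k$ in the obvious way (exponent tuples padded with zeros), and $\mathfrak L:=\bigcup_k\mathcal L_k$. The order $\mathrm{ord}(f)$ is the minimum of $\mathrm{Supp}(f)$; the leading term is the term of that order. "h.o.t." means terms of strictly higher order. $f$ is parabolic if its leading term is $z$; the parabolic elements of $\mathcal L_k$ form a group $\mathcal L_k^0$ under composition of transseries (standard composition of logarithmic(-exponential) transseries), and $\mathfrak L^0:=\bigcup_k\mathcal L_k^0$. $\varphi^{-1}$ denotes the compositional inverse. *)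

theory Defs
  imports Complex_Main
begin

text \<open>Logarithmic transseries. An exponent tuple (alpha, n_1, n_2, ...) is represented
as a pair (alpha, n) with n :: nat => int, where n i is the exponent of ell_(i+1)
(so only finitely many n i are non-zero for elements of the union of the L_k).
A formal sum is represented by its coefficient function.\<close>

type_synonym expo = "real \<times> (nat \<Rightarrow> int)"
type_synonym tser = "expo \<Rightarrow> real"

definition zero_exp :: expo where "zero_exp = (0, \<lambda>_. 0)"
definition z_exp :: expo where "z_exp = (1, \<lambda>_. 0)"
text \<open>exponent of the monomial ell_j, for j >= 1\<close>
definition ell_exp :: "nat \<Rightarrow> expo" where
  "ell_exp j = (0, \<lambda>i. if i = j - 1 then 1 else 0)"

definition eadd :: "expo \<Rightarrow> expo \<Rightarrow> expo" where
  "eadd e1 e2 = (fst e1 + fst e2, \<lambda>i. snd e1 i + snd e2 i)"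

definition seq_less :: "(nat \<Rightarrow> int) \<Rightarrow> (nat \<Rightarrow> int) \<Rightarrow> bool" where
  "seq_less n m \<longleftrightarrow> (\<exists>j. n j < m j \<and> (\<forall>i<j. n i = m i))"
definition seq_le :: "(nat \<Rightarrow> int) \<Rightarrow> (nat \<Rightarrow> int) \<Rightarrow> bool" where
  "seq_le n m \<longleftrightarrow> n = m \<or> seq_less n m"
definition lex_less :: "expo \<Rightarrow> expo \<Rightarrow> bool" where
  "lex_less e1 e2 \<longleftrightarrow> fst e1 < fst e2 \<or> (fst e1 = fst e2 \<and> seq_less (snd e1) (snd e2))"
definition lex_le :: "expo \<Rightarrow> expo \<Rightarrow> bool" where
  "lex_le e1 e2 \<longleftrightarrow> e1 = e2 \<or> lex_less e1 e2"

definition ts_supp :: "tser \<Rightarrow> expo set" where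
  "ts_supp f = {e. f e \<noteq> 0}"

definition lex_well_ordered :: "expo set \<Rightarrow> bool" where
  "lex_well_ordered S \<longleftrightarrow> (\<forall>T\<subseteq>S. T \<noteq> {} \<longrightarrow> (\<exists>x\<in>T. \<forall>y\<in>T. lex_le x y))"

definition Lk :: "nat \<Rightarrow> tser \<Rightarrow> bool" where
  "Lk k f \<longleftrightarrow> (\<forall>e\<in>ts_supp f. fst e \<ge> 0 \<and> (\<forall>j\<ge>k. snd e j = 0))
              \<and> lex_well_ordered (ts_supp f)"

definition LL :: "tser \<Rightarrow> bool" where
  "LL f \<longleftrightarrow> (\<exists>k. Lk k f)"

definition lead_lin :: "real \<Rightarrow> tser \<Rightarrow> bool" where
  "lead_lin c f \<longleftrightarrow> f z_exp = c \<and> (\<forall>e\<in>ts_supp f. lex_le z_exp e)"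

definition parabolic :: "tser \<Rightarrow> bool" where
  "parabolic f \<longleftrightarrow> lead_lin 1 f"

definition Lk0 :: "nat \<Rightarrow> tser \<Rightarrow> bool" where
  "Lk0 k f \<longleftrightarrow> Lk k f \<and> parabolic f"

definition LL0 :: "tser \<Rightarrow> bool" where
  "LL0 f \<longleftrightarrow> (\<exists>k. Lk0 k f)"

definition ts_mono :: "real \<Rightarrow> expo \<Rightarrow> tser" where
  "ts_mono c e = (\<lambda>e'. if e' = e then c else 0)"
definition ts_zero :: tser where "ts_zero = (\<lambda>_. 0)"
definition ts_one :: tser where "ts_one = ts_mono 1 zero_exp"
definition ts_z :: tser where "ts_z = ts_mono 1 z_exp"
definition ts_add :: "tser \<Rightarrow> tser \<Rightarrow> tser" where
  "ts_add f g = (\<lambda>e. f e + g e)"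
definition ts_scale :: "real \<Rightarrow> tser \<Rightarrow> tser" where
  "ts_scale c f = (\<lambda>e. c * f e)"

text \<open>Product (Cauchy product; the set of pairs is finite for well-ordered supports)\<close>
definition ts_mult :: "tser \<Rightarrow> tser \<Rightarrow> tser" where
  "ts_mult f g = (\<lambda>e. \<Sum>p\<in>{(e1, e2). eadd e1 e2 = e \<and> f e1 \<noteq> 0 \<and> g e2 \<noteq> 0}.
                        f (fst p) * g (snd p))"

fun ts_pow :: "tser \<Rightarrow> nat \<Rightarrow> tser" where
  "ts_pow f 0 = ts_one"
| "ts_pow f (Suc n) = ts_mult f (ts_pow f n)"

text \<open>Sum of a summable family (each coefficient receives finitely many contributions)\<close>
definition ts_sum :: "('i \<Rightarrow> tser) \<Rightarrow> tser" where
  "ts_sum F = (\<lambda>e. \<Sum>i\<in>{i. F i e \<noteq> 0}. F i e)"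

fun ts_fin_prod :: "(nat \<Rightarrow> tser) \<Rightarrow> nat \<Rightarrow> tser" where
  "ts_fin_prod F 0 = ts_one"
| "ts_fin_prod F (Suc n) = ts_mult (F n) (ts_fin_prod F n)"

definition ts_binom :: "real \<Rightarrow> tser \<Rightarrow> tser" where
  "ts_binom a d = ts_sum (\<lambda>j. ts_scale (a gchoose j) (ts_pow d j))"

definition ts_log1p :: "tser \<Rightarrow> tser" where
  "ts_log1p d = ts_sum (\<lambda>j. if j = 0 then ts_zero
                            else ts_scale ((-1) ^ (j + 1) / real j) (ts_pow d j))"

definition ts_geo1 :: "tser \<Rightarrow> tser" where
  "ts_geo1 x = ts_sum (\<lambda>i. if i = 0 then ts_zero else ts_pow x i)"

text \<open>For g = lam z + h.o.t. (lam > 0) write g = lam z (1 + eps).\<close>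
definition ts_lam :: "tser \<Rightarrow> real" where
  "ts_lam g = g z_exp"

definition ts_eps :: "tser \<Rightarrow> tser" where
  "ts_eps g = (\<lambda>e. if e = zero_exp then 0 else g (fst e + 1, snd e) / ts_lam g)"

text \<open>ell_0 o g = lam z (1 + delta_0) with ell_0 = z, and ell_j o g = ell_j (1 + delta_j) for j >= 1,
  where, using log ell_j = -1/ell_(j+1) and log z = -1/ell_1,
  ell_(j+1) o g = -1/(log ell_j + log c_j + log(1+delta_j))
               = ell_(j+1) / (1 - ell_(j+1) (log c_j + log(1+delta_j))).\<close>
fun ts_delta :: "tser \<Rightarrow> nat \<Rightarrow> tser" where
  "ts_delta g 0 = ts_eps g"
| "ts_delta g (Suc j) =
     ts_geo1 (ts_mult (ts_mono 1 (ell_exp (Suc j)))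
                      (ts_add (ts_mono (if j = 0 then ln (ts_lam g) else 0) zero_exp)
                              (ts_log1p (ts_delta g j))))"

definition exp_bound :: "expo \<Rightarrow> nat" where
  "exp_bound e = (LEAST K. \<forall>j\<ge>K. snd e j = 0)"

definition mono_comp :: "tser \<Rightarrow> expo \<Rightarrow> tser" where
  "mono_comp g e =
     ts_mult (ts_mono (ts_lam g powr fst e) e)
       (ts_mult (ts_binom (fst e) (ts_delta g 0))
          (ts_fin_prod (\<lambda>i. ts_binom (of_int (snd e i)) (ts_delta g (Suc i))) (exp_bound e)))"

definition ts_comp :: "tser \<Rightarrow> tser \<Rightarrow> tser" where
  "ts_comp f g = ts_sum (\<lambda>e. ts_scale (f e) (mono_comp g e))"

definition ts_inv :: "tser \<Rightarrow> tser" where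
  "ts_inv phi = (THE psi. LL0 psi \<and> ts_comp phi psi = ts_z \<and> ts_comp psi phi = ts_z)"

definition ones_k :: "nat \<Rightarrow> nat \<Rightarrow> int" where
  "ones_k k = (\<lambda>i. if i < k then 1 else 0)"

definition trunc0 :: "nat \<Rightarrow> tser \<Rightarrow> tser" where
  "trunc0 k f = (\<lambda>e. if fst e = 1 \<and> seq_le (\<lambda>_. 0) (snd e) \<and> seq_le (snd e) (ones_k k)
                     then f e else 0)"

end

theory Submission
  imports Defs "HOL-Library.Groups_Big_Fun" "HOL-Computational_Algebra.Formal_Power_Series"
begin

text \<open>Transseries are Hahn series over the lexicographically ordered exponent group. Write
  \<open>g = \<lambda> z exp u\<close> with \<open>u\<close> infinitesimal; composition with \<open>g\<close> is the strongly linear ring homomorphism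
  that multiplies the monomial of exponent \<open>e = (\<alpha>, n)\<close> by \<open>\<lambda>\<^sup>\<alpha> exp (\<theta> e)\<close>, where \<open>\<theta>\<close> is additive in \<open>e\<close>. This
  makes composition associative, and with \<open>\<phi> = z exp u\<close> the equation \<open>\<phi> \<circ> f = f\<^sub>0 \<circ> \<phi>\<close>
  becomes, after taking logarithms, the cohomological equation
  \<open>u \<circ> f - u = log (f\<^sub>0 / \<lambda> z) \<circ> \<phi> - log (f / \<lambda> z)\<close>.
  The left-hand side sends a monomial of exponent \<open>(\<alpha>, n)\<close> to a nonzero multiple of itself if \<open>\<alpha> > 0\<close>, and to a
  nonzero multiple of itself times \<open>\<ell>\<^sub>1 \<dots> \<ell>\<^sub>j\<close> if \<open>\<alpha> = 0\<close> and \<open>n\<^sub>j\<close> is the first nonzero entry of \<open>n\<close>, up to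
  higher order; the dependence of the right-hand side on \<open>u\<close> is of higher order still. The orders
  reached in this way are exactly those above \<open>\<ell>\<^sub>1 \<dots> \<ell>\<^sub>k\<close>, so \<open>u\<close> is determined term by
  term.\<close>

section \<open>Well-ordered subsets of ordered groups\<close>

text \<open>Only infinitesimal series can be exponentiated, so the constant
  \<open>c = ln lam\<close> is carried separately from the infinitesimal exponent \<open>u\<close>
  throughout. Solving term by term is not set up as a contraction: the gain in order depends on the
  exponent, and a limit of successive approximations would still need a well-ordered support.
  Partial solutions are glued instead, which requires only the leading term of a difference of
  residuals, strict monotonicity of the exponent map, and the fact that every possible leading
  residual lies in its range. A competing \<open>phi\<close> may have larger depth than
  \<open>f\<close>, so the equation is studied at every depth \<open>l >= k\<close> with the same
  truncated series. This works because an exponent of depth \<open>k\<close> above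
  \<open>ones k\<close> exceeds it first at a position below \<open>k\<close>, and therefore lies
  above every \<open>ones l\<close>. The solution of depth \<open>k\<close> then also solves the
  equation at the larger depth, where uniqueness identifies it with the competitor.\<close>

definition well_ordered :: "'a::linorder set \<Rightarrow> bool" where
  "well_ordered S \<longleftrightarrow> (\<forall>T\<subseteq>S. T \<noteq> {} \<longrightarrow> (\<exists>x\<in>T. \<forall>y\<in>T. x \<le> y))"

lemma well_orderedD: "well_ordered S \<Longrightarrow> T \<subseteq> S \<Longrightarrow> T \<noteq> {} \<Longrightarrow> \<exists>x\<in>T. \<forall>y\<in>T. x \<le> y"
  unfolding well_ordered_def by blast

lemma well_ordered_subset: "well_ordered S \<Longrightarrow> T \<subseteq> S \<Longrightarrow> well_ordered T"
  unfolding well_ordered_def by (meson order_trans)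

text \<open>A monotone subsequence exists in every linear order; a nonincreasing one is constant
  from the index of its minimum on, and that tail serves instead.\<close>

lemma well_ordered_seq_le:
  fixes f :: "nat \<Rightarrow> 'a::linorder"
  assumes "well_ordered S" "\<And>i. f i \<in> S"
  shows "\<exists>r::nat \<Rightarrow> nat. strict_mono r \<and> mono (f \<circ> r)"
proof -
  obtain r :: "nat \<Rightarrow> nat" where r: "strict_mono r" "monoseq (\<lambda>n. f (r n))"
    using seq_monosub[of f] by blast
  show ?thesis
  proof (cases "\<forall>m n. m \<le> n \<longrightarrow> f (r m) \<le> f (r n)")
    case True
    then show ?thesis using r(1) by (auto simp: mono_def)
  next
    case False
    then have dec: "f (r n) \<le> f (r m)" if "m \<le> n" for m n
      using r(2) that unfolding monoseq_def by blast
    obtain N where N: "\<And>n. f (r N) \<le> f (r n)"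
      using well_orderedD[OF assms(1), of "range (\<lambda>n. f (r n))"] assms(2) by auto
    have "f (r (N + n)) = f (r N)" for n
      using N[of "N + n"] dec[of N "N + n"] by simp
    then have "mono (f \<circ> (\<lambda>n. r (N + n)))" by (simp add: mono_def)
    moreover have "strict_mono (\<lambda>n. r (N + n))" using r(1) by (simp add: strict_mono_def)
    ultimately show ?thesis by blast
  qed
qed

text \<open>A nonempty set without minimum admits a strictly decreasing sequence, obtained by
  iterating a choice of smaller elements. In this form well-orderedness follows from the existence
  of good pairs in sequences.\<close>

lemma well_orderedI_seq:
  fixes S :: "'a::linorder set"
  assumes "\<And>f::nat \<Rightarrow> 'a. (\<And>i. f i \<in> S) \<Longrightarrow> \<exists>i j. i < j \<and> f i \<le> f j"
  shows "well_ordered S"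
  unfolding well_ordered_def
proof (intro allI impI)
  fix T assume T: "T \<subseteq> S" "T \<noteq> {}"
  show "\<exists>x\<in>T. \<forall>y\<in>T. x \<le> y"
  proof (rule ccontr)
    assume "\<not> ?thesis"
    then have "\<forall>x\<in>T. \<exists>y\<in>T. y < x" by (meson linorder_not_le)
    then obtain g where g: "\<And>x. x \<in> T \<Longrightarrow> g x \<in> T \<and> g x < x" by metis
    obtain x0 where x0: "x0 \<in> T" using T by blast
    define f where "f n = (g ^^ n) x0" for n
    have fT: "f n \<in> T" for n by (induction n) (auto simp: f_def x0 g)
    have dec: "f (Suc n) < f n" for n using g[OF fT[of n]] by (simp add: f_def)
    have "\<exists>i j. i < j \<and> f i \<le> f j" by (rule assms) (use fT T in blast)
    then obtain i j where ij: "i < j" "f i \<le> f j" by blast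
    have "f j \<le> f (Suc i)"
      by (rule lift_Suc_antimono_le[of f]) (use dec ij(1) in \<open>auto intro: less_imp_le\<close>)
    then show False using ij(2) dec[of i] by simp
  qed
qed

lemma well_ordered_finite: "finite S \<Longrightarrow> well_ordered S"
  unfolding well_ordered_def by (metis Min_in Min_le finite_subset)

lemma well_ordered_Un: "well_ordered A \<Longrightarrow> well_ordered B \<Longrightarrow> well_ordered (A \<union> B)"
  unfolding well_ordered_def
proof (intro allI impI)
  fix T assume A: "\<forall>T\<subseteq>A. T \<noteq> {} \<longrightarrow> (\<exists>x\<in>T. \<forall>y\<in>T. x \<le> y)"
    and B: "\<forall>T\<subseteq>B. T \<noteq> {} \<longrightarrow> (\<exists>x\<in>T. \<forall>y\<in>T. x \<le> y)"
    and T: "T \<subseteq> A \<union> B" "T \<noteq> {}"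
  show "\<exists>x\<in>T. \<forall>y\<in>T. x \<le> y"
  proof (cases "T \<inter> A = {} \<or> T \<inter> B = {}")
    case True
    then have "T \<subseteq> A \<or> T \<subseteq> B" using T by blast
    then show ?thesis using A B T(2) by blast
  next
    case False
    obtain x where x: "x \<in> T \<inter> A" "\<forall>y\<in>T \<inter> A. x \<le> y" using A False by (metis inf_le2)
    obtain x' where x': "x' \<in> T \<inter> B" "\<forall>y\<in>T \<inter> B. x' \<le> y" using B False by (metis inf_le2)
    have "\<forall>y\<in>T. min x x' \<le> y" using x x' T by (auto simp: min_le_iff_disj)
    moreover have "min x x' \<in> T" using x x' by (auto simp: min_def)
    ultimately show ?thesis by blast
  qed
qed

lemma well_ordered_UN_finite: "finite I \<Longrightarrow> (\<And>i. i \<in> I \<Longrightarrow> well_ordered (A i)) \<Longrightarrow> well_ordered (\<Union>i\<in>I. A i)"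
  by (induction I rule: finite_induct) (auto intro: well_ordered_Un well_ordered_finite)

definition sumset :: "'a::plus set \<Rightarrow> 'a set \<Rightarrow> 'a set" where
  "sumset A B = {a + b | a b. a \<in> A \<and> b \<in> B}"

lemma sumsetI: "a \<in> A \<Longrightarrow> b \<in> B \<Longrightarrow> a + b \<in> sumset A B"
  unfolding sumset_def by blast

lemma sumset_mono: "A \<subseteq> A' \<Longrightarrow> B \<subseteq> B' \<Longrightarrow> sumset A B \<subseteq> sumset A' B'"
  unfolding sumset_def by blast

lemma well_ordered_sumset:
  fixes A B :: "'a::linordered_ab_group_add set"
  assumes "well_ordered A" "well_ordered B"
  shows "well_ordered (sumset A B)"
proof (rule well_orderedI_seq)
  fix f :: "nat \<Rightarrow> 'a" assume "\<And>i. f i \<in> sumset A B"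
  then have "\<forall>i. \<exists>a b. a \<in> A \<and> b \<in> B \<and> f i = a + b" unfolding sumset_def by blast
  then obtain a b where ab: "\<And>i. a i \<in> A" "\<And>i. b i \<in> B" "\<And>i. f i = a i + b i" by metis
  obtain r :: "nat \<Rightarrow> nat" where r: "strict_mono r" "mono (a \<circ> r)"
    using well_ordered_seq_le[OF assms(1), of a] ab by blast
  obtain s :: "nat \<Rightarrow> nat" where s: "strict_mono s" "mono (b \<circ> r \<circ> s)"
    using well_ordered_seq_le[OF assms(2), of "b \<circ> r"] ab by auto
  have "s 0 < s 1" using s(1) by (simp add: strict_mono_def)
  moreover have "a (r (s 0)) \<le> a (r (s 1))" using r(2) calculation by (simp add: mono_def)
  moreover have "b (r (s 0)) \<le> b (r (s 1))" using s(2) by (simp add: mono_def)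
  ultimately show "\<exists>i j. i < j \<and> f i \<le> f j"
    using r(1) by (metis ab(3) add_mono strict_monoD)
qed

text \<open>Infinitely many \<open>a\<close> would contain a sequence along which both
  \<open>a\<close> and \<open>e - a\<close> are nondecreasing, hence constant, against injectivity.
  This is the finiteness behind every coefficient of a product.\<close>

lemma well_ordered_fibre_finite:
  fixes A B :: "'a::linordered_ab_group_add set"
  assumes "well_ordered A" "well_ordered B"
  shows "finite {a \<in> A. e - a \<in> B}"
proof (rule ccontr)
  assume "\<not> ?thesis"
  then obtain f :: "nat \<Rightarrow> 'a" where f: "inj f" "range f \<subseteq> {a \<in> A. e - a \<in> B}"
    using infinite_countable_subset by blast
  obtain r :: "nat \<Rightarrow> nat" where r: "strict_mono r" "mono (f \<circ> r)"
    using well_ordered_seq_le[OF assms(1), of f] f(2) by blast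
  obtain s :: "nat \<Rightarrow> nat" where s: "strict_mono s" "mono ((\<lambda>i. e - f (r i)) \<circ> s)"
    using well_ordered_seq_le[OF assms(2), of "\<lambda>i. e - f (r i)"] f(2) by auto
  have "s 0 < s 1" using s(1) by (simp add: strict_mono_def)
  moreover have "f (r (s 0)) \<le> f (r (s 1))" using r(2) calculation by (simp add: mono_def)
  moreover have "e - f (r (s 0)) \<le> e - f (r (s 1))" using s(2) by (simp add: mono_def)
  ultimately have "f (r (s 0)) = f (r (s 1))" by simp
  then have "r (s 0) = r (s 1)" using f(1) by (simp add: inj_eq)
  then show False using r(1) \<open>s 0 < s 1\<close> by (metis less_irrefl strict_monoD)
qed

section \<open>Finite sums of positive elements\<close>

inductive nsum :: "'a::comm_monoid_add set \<Rightarrow> nat \<Rightarrow> 'a \<Rightarrow> bool" for S where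
  nsum_0: "nsum S 0 0"
| nsum_Suc: "a \<in> S \<Longrightarrow> nsum S n x \<Longrightarrow> nsum S (Suc n) (a + x)"

definition generated :: "'a::comm_monoid_add set \<Rightarrow> 'a set" where
  "generated S = {x. \<exists>n. nsum S n x}"

lemma nsum_nonneg:
  fixes S :: "'a::linordered_ab_group_add set"
  assumes "\<And>s. s \<in> S \<Longrightarrow> 0 < s"
  shows "nsum S n x \<Longrightarrow> 0 \<le> x"
  by (induction rule: nsum.induct) (auto simp: assms less_imp_le)

lemma generated_nonneg:
  fixes S :: "'a::linordered_ab_group_add set"
  shows "(\<And>s. s \<in> S \<Longrightarrow> 0 < s) \<Longrightarrow> x \<in> generated S \<Longrightarrow> 0 \<le> x"
  unfolding generated_def using nsum_nonneg by blast

text \<open>Under this quasi-order a larger pair has a larger sum, strictly if it has more summands;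
  it is compatible with adding a summand, so Nash-Williams' minimal bad sequences apply.\<close>

definition pair_le :: "nat \<times> 'a::linordered_ab_group_add \<Rightarrow> nat \<times> 'a \<Rightarrow> bool" where
  "pair_le p q \<longleftrightarrow> snd p < snd q \<and> fst p \<le> fst q \<or> p = q"

lemma pair_le_add_both: "a \<le> b \<Longrightarrow> pair_le (m, x) (n, y) \<Longrightarrow> pair_le (Suc m, a + x) (Suc n, b + y)"
  by (cases "a = b") (auto simp: pair_le_def add_le_less_mono add_less_le_mono)

lemma pair_le_add_right: "0 < b \<Longrightarrow> pair_le p (n, y) \<Longrightarrow> pair_le p (Suc n, b + y)"
  by (cases p) (auto simp: pair_le_def intro: add_strict_increasing2 less_imp_le)

definition bad_seq :: "'a::linordered_ab_group_add set \<Rightarrow> (nat \<Rightarrow> nat \<times> 'a) \<Rightarrow> bool" where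
  "bad_seq S f \<longleftrightarrow> (\<forall>i. nsum S (fst (f i)) (snd (f i))) \<and> (\<forall>i j. i < j \<longrightarrow> \<not> pair_le (f i) (f j))"

lemma no_bad_seq:
  fixes S :: "'a::linordered_ab_group_add set"
  assumes well_ordered: "well_ordered S" and pos: "\<And>s. s \<in> S \<Longrightarrow> 0 < s"
  shows "\<not> bad_seq S f"
proof
  assume bad: "bad_seq S f"
  \<comment> \<open>\<open>ext n g\<close> says that the first \<open>n\<close> entries of
    \<open>g\<close> can be continued to a bad sequence; \<open>minim n g\<close> that entry
    \<open>n\<close> uses the fewest summands among all such continuations of the entries before
    it.\<close>
  define ext where "ext n g \<longleftrightarrow> (\<exists>h. bad_seq S h \<and> (\<forall>i<n. h i = g i))"
    for n and g :: "nat \<Rightarrow> nat \<times> 'a"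
  define minim where "minim n g \<longleftrightarrow> (\<forall>p. ext (Suc n) (g(n := p)) \<longrightarrow> fst (g n) \<le> fst p)"
    for n and g :: "nat \<Rightarrow> nat \<times> 'a"
  have step: "\<exists>p. ext (Suc n) (g(n := p)) \<and> (\<forall>q. ext (Suc n) (g(n := q)) \<longrightarrow> fst p \<le> fst q)"
    if "ext n g" for n g
  proof -
    obtain h where h: "bad_seq S h" "\<forall>i<n. h i = g i" using \<open>ext n g\<close> unfolding ext_def by blast
    then have "ext (Suc n) (g(n := h n))" unfolding ext_def by (intro exI[of _ h]) (auto simp: less_Suc_eq)
    then show ?thesis using ex_has_least_nat[of "\<lambda>p. ext (Suc n) (g(n := p))" "h n" fst] by blast
  qed
  define P where "P n g \<longleftrightarrow> ext n g \<and> (\<forall>i<n. minim i g)" for n g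
  have "\<exists>G. \<forall>n. P n (G n) \<and> (\<forall>i<n. G (Suc n) i = G n i)"
  proof (rule dependent_nat_choice)
    show "\<exists>g. P 0 g" using bad unfolding P_def ext_def by auto
  next
    fix g n assume g: "P n g"
    obtain p where p: "ext (Suc n) (g(n := p))" "\<And>q. ext (Suc n) (g(n := q)) \<Longrightarrow> fst p \<le> fst q"
      using step g unfolding P_def by blast
    have "minim i (g(n := p))" if "i < Suc n" for i
    proof (cases "i = n")
      case True
      then show ?thesis using p(2) unfolding minim_def by simp
    next
      case False
      then have "i < n" using that by simp
      have "ext (Suc i) ((g(n := p))(i := q)) \<longleftrightarrow> ext (Suc i) (g(i := q))" for q
        unfolding ext_def using \<open>i < n\<close> by auto
      then show ?thesis using g \<open>i < n\<close> unfolding P_def minim_def by simp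
    qed
    then show "\<exists>y. P (Suc n) y \<and> (\<forall>i<n. y i = g i)"
      using p(1) unfolding P_def by (intro exI[of _ "g(n := p)"]) auto
  qed
  then obtain G where G: "\<And>n. P n (G n)" "\<And>n i. i < n \<Longrightarrow> G (Suc n) i = G n i" by blast
  \<comment> \<open>The finite stages agree on their common initial segments, so the diagonal
    \<open>w\<close> is itself a bad sequence, minimal at every index.\<close>
  define w where "w n = G (Suc n) n" for n
  have Gw: "i < n \<Longrightarrow> G n i = w i" for n i
    by (induction n) (auto simp: w_def less_Suc_eq G(2))
  have extw: "ext n w" for n
    using G(1)[of n] Gw unfolding P_def ext_def by (metis (no_types, lifting))
  have minw: "fst (w n) \<le> fst p" if "ext (Suc n) (w(n := p))" for n p
  proof -
    have "minim n (G (Suc n))" using G(1)[of "Suc n"] unfolding P_def by simp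
    moreover have "ext (Suc n) ((G (Suc n))(n := p))"
      using that Gw unfolding ext_def by (metis fun_upd_apply)
    ultimately show ?thesis unfolding minim_def w_def by blast
  qed
  have badw: "bad_seq S w"
    unfolding bad_seq_def
  proof (intro conjI allI impI)
    fix i
    show "nsum S (fst (w i)) (snd (w i))"
      using extw[of "Suc i"] unfolding ext_def bad_seq_def by (metis lessI)
  next
    fix i j :: nat assume "i < j"
    then show "\<not> pair_le (w i) (w j)"
      using extw[of "Suc j"] unfolding ext_def bad_seq_def by (metis less_Suc_eq)
  qed
  \<comment> \<open>The empty sum precedes every later pair: that pair is either
    \<open>(0, 0)\<close> again or has a positive sum. So each entry of \<open>w\<close> has a
    summand to split off.\<close>
  have nz: "fst (w n) \<noteq> 0" for n
  proof
    assume z: "fst (w n) = 0"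
    have "nsum S (fst (w n)) (snd (w n))" using badw unfolding bad_seq_def by blast
    then have "w n = (0, 0)" using z by (cases rule: nsum.cases) (auto simp: prod_eq_iff)
    moreover have ns: "nsum S (fst (w (Suc n))) (snd (w (Suc n)))" using badw unfolding bad_seq_def by blast
    ultimately have "\<not> pair_le (0, 0) (w (Suc n))" using badw unfolding bad_seq_def by (metis lessI)
    then have le: "snd (w (Suc n)) \<le> 0" "w (Suc n) \<noteq> (0, 0)" by (auto simp: pair_le_def)
    from ns show False
    proof (cases rule: nsum.cases)
      case nsum_0
      then show ?thesis using le by (auto simp: prod_eq_iff)
    next
      case (nsum_Suc a m x)
      have "0 < a + x" using pos[OF nsum_Suc(3)] nsum_nonneg[OF pos nsum_Suc(4)] by (simp add: add_pos_nonneg)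
      then show ?thesis using le nsum_Suc by simp
    qed
  qed
  have "\<exists>a m x. a \<in> S \<and> nsum S m x \<and> w n = (Suc m, a + x)" for n
  proof -
    have "nsum S (fst (w n)) (snd (w n))" using badw unfolding bad_seq_def by blast
    then show ?thesis using nz[of n] by (cases rule: nsum.cases) (auto simp: prod_eq_iff)
  qed
  then obtain a m x where amx: "\<And>n. a n \<in> S" "\<And>n. nsum S (m n) (x n)" "\<And>n. w n = (Suc (m n), a n + x n)"
    by metis
  obtain r :: "nat \<Rightarrow> nat" where r: "strict_mono r" "mono (a \<circ> r)"
    using well_ordered_seq_le[OF well_ordered, of a] amx by blast
  define N where "N = r 0"
  \<comment> \<open>From index \<open>N = r 0\<close> on, \<open>w\<close> is replaced by the
    remainders along a subsequence whose split-off summands are nondecreasing. A good pair in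
    \<open>v\<close> would give a good pair in \<open>w\<close>, so \<open>v\<close> is bad, yet its
    entry \<open>N\<close> has one summand fewer than \<open>w N\<close>.\<close>
  define v where "v i = (if i < N then w i else (m (r (i - N)), x (r (i - N))))" for i
  have rge: "N + (i - N) \<le> r (i - N)" for i
  proof -
    have "r 0 + n \<le> r n" for n
    proof (induction n)
      case (Suc n)
      then show ?case using strict_monoD[OF r(1), of n "Suc n"] by simp
    qed simp
    then show ?thesis by (simp add: N_def)
  qed
  have "bad_seq S v"
    unfolding bad_seq_def
  proof (intro conjI allI impI)
    fix i
    show "nsum S (fst (v i)) (snd (v i))"
      using badw amx(2) by (auto simp: v_def bad_seq_def)
  next
    fix i j :: nat assume ij: "i < j"
    consider "j < N" | "i < N" "N \<le> j" | "N \<le> i" using ij by linarith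
    then show "\<not> pair_le (v i) (v j)"
    proof cases
      case 1
      then show ?thesis using badw ij by (simp add: v_def bad_seq_def)
    next
      case 2
      let ?k = "r (j - N)"
      have "i < ?k" using rge[of j] 2 by linarith
      then have "\<not> pair_le (w i) (w ?k)" using badw by (simp add: bad_seq_def)
      then show ?thesis using 2 pair_le_add_right[OF pos[OF amx(1)[of ?k]], of "w i"] amx(3)[of ?k]
        by (auto simp: v_def)
    next
      case 3
      let ?k = "r (j - N)" and ?l = "r (i - N)"
      have "?l < ?k" using 3 ij r(1) by (simp add: strict_mono_def)
      then have "\<not> pair_le (w ?l) (w ?k)" using badw by (simp add: bad_seq_def)
      moreover have "a ?l \<le> a ?k" using r(2) 3 ij by (simp add: mono_def)
      ultimately show ?thesis using 3 ij pair_le_add_both[of "a ?l" "a ?k"] amx(3) by (auto simp: v_def)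
    qed
  qed
  then have "ext (Suc N) (w(N := v N))"
    unfolding ext_def by (intro exI[of _ v]) (auto simp: v_def less_Suc_eq)
  then have "fst (w N) \<le> fst (v N)" by (rule minw)
  then show False by (simp add: v_def N_def amx(3))
qed

text \<open>Neumann's lemma\<close>

lemma well_ordered_generated:
  fixes S :: "'a::linordered_ab_group_add set"
  assumes "well_ordered S" and "\<And>s. s \<in> S \<Longrightarrow> 0 < s"
  shows "well_ordered (generated S)"
proof (rule well_orderedI_seq)
  fix f :: "nat \<Rightarrow> 'a" assume "\<And>i. f i \<in> generated S"
  then have "\<forall>i. \<exists>n. nsum S n (f i)" unfolding generated_def by simp
  then obtain n where n: "\<forall>i. nsum S (n i) (f i)" by (rule choice[THEN exE])
  have "\<not> bad_seq S (\<lambda>i. (n i, f i))" by (rule no_bad_seq[OF assms])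
  then obtain i j where "i < j" "pair_le (n i, f i) (n j, f j)"
    using n unfolding bad_seq_def by auto
  then have "f i \<le> f j" by (auto simp: pair_le_def)
  then show "\<exists>i j. i < j \<and> f i \<le> f j" using \<open>i < j\<close> by blast
qed

text \<open>Pairs with the same sum are comparable under \<open>pair_le\<close> only if equal, so
  infinitely many values of \<open>n\<close> would form a bad sequence. Hence a given exponent
  occurs in only finitely many powers of an infinitesimal series, which makes power series
  summable.\<close>

lemma finite_nsum:
  fixes S :: "'a::linordered_ab_group_add set"
  assumes "well_ordered S" and "\<And>s. s \<in> S \<Longrightarrow> 0 < s"
  shows "finite {n. nsum S n x}"
proof (rule ccontr)
  assume inf: "infinite {n. nsum S n x}"
  then obtain n :: "nat \<Rightarrow> nat" where n: "inj n" "range n \<subseteq> {n. nsum S n x}"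
    using infinite_countable_subset by blast
  have "\<not> bad_seq S (\<lambda>i. (n i, x))" by (rule no_bad_seq[OF assms])
  then obtain i j where "i < j" "pair_le (n i, x) (n j, x)"
    using n(2) unfolding bad_seq_def by (auto simp: image_subset_iff)
  then show False using inj_eq[OF n(1), of i j] by (auto simp: pair_le_def)
qed

section \<open>Hahn series with real coefficients\<close>

text \<open>Well-ordered support is part of the type, so the ring laws hold without side conditions
  and the class \<open>comm_ring_1\<close> applies.\<close>

typedef (overloaded) 'g hahn = "{f :: 'g::linordered_ab_group_add \<Rightarrow> real. well_ordered {e. f e \<noteq> 0}}"
  morphisms coeff Hahn
  by (rule exI[of _ "\<lambda>_. 0"]) (simp add: well_ordered_def)

definition supp :: "'g::linordered_ab_group_add hahn \<Rightarrow> 'g set" where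
  "supp f = {e. coeff f e \<noteq> 0}"

lemma supp_iff: "e \<in> supp f \<longleftrightarrow> coeff f e \<noteq> 0"
  by (simp add: supp_def)

lemma well_ordered_supp: "well_ordered (supp f)"
  using coeff[of f] by (simp add: supp_def)

lemma coeff_Hahn: "well_ordered {e. f e \<noteq> 0} \<Longrightarrow> coeff (Hahn f) = f"
  by (simp add: Hahn_inverse)

lemma coeff_Hahn_subset: "{e. f e \<noteq> 0} \<subseteq> S \<Longrightarrow> well_ordered S \<Longrightarrow> coeff (Hahn f) = f"
  by (rule coeff_Hahn) (rule well_ordered_subset)

lemma hahn_eqI: "(\<And>e. coeff f e = coeff g e) \<Longrightarrow> f = g"
  by (simp add: coeff_inject[symmetric] ext)

lemma Sum_any_mono_neutral:
  "finite A \<Longrightarrow> (\<And>a. a \<notin> A \<Longrightarrow> g a = 0) \<Longrightarrow> Sum_any g = sum g A"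
  by (rule Sum_any.expand_superset) auto

lemma Sum_any_neq_0E:
  assumes "Sum_any g \<noteq> 0" obtains a where "g a \<noteq> 0"
  using assms by (rule Sum_any.not_neutral_obtains_not_neutral)

lemma Sum_any_swap_finite:
  assumes "finite A" "finite B" "\<And>a b. g a b \<noteq> 0 \<Longrightarrow> a \<in> A \<and> b \<in> B"
  shows "Sum_any (\<lambda>a. Sum_any (g a)) = Sum_any (\<lambda>b. Sum_any (\<lambda>a. g a b))"
  by (rule Sum_any.swap[of "A \<times> B"]) (use assms in auto)

lemma Sum_any_pair_finite:
  assumes "finite A" "finite B" "\<And>a b. g a b \<noteq> 0 \<Longrightarrow> a \<in> A \<and> b \<in> B"
  shows "Sum_any (\<lambda>a. Sum_any (g a)) = Sum_any (\<lambda>(a, b). g a b)"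
  by (rule Sum_any.cartesian_product[of "A \<times> B"]) (use assms in auto)

subsection \<open>Ring structure\<close>

definition hmono :: "real \<Rightarrow> 'g::linordered_ab_group_add \<Rightarrow> 'g hahn" where
  "hmono c e = Hahn (\<lambda>x. if x = e then c else 0)"

lemma coeff_hmono: "coeff (hmono c e) x = (if x = e then c else 0)"
  unfolding hmono_def by (subst coeff_Hahn_subset[of _ "{e}"]) (auto intro: well_ordered_finite)

definition conv :: "('g::linordered_ab_group_add \<Rightarrow> real) \<Rightarrow> ('g \<Rightarrow> real) \<Rightarrow> 'g \<Rightarrow> real" where
  "conv f g e = Sum_any (\<lambda>a. f a * g (e - a))"

instantiation hahn :: (linordered_ab_group_add) "{zero, one, plus, minus, uminus, times}"
begin
definition zero_hahn :: "'a hahn" where "zero_hahn = Hahn (\<lambda>_. 0)"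
definition one_hahn :: "'a hahn" where "one_hahn = hmono 1 0"
definition plus_hahn :: "'a hahn \<Rightarrow> 'a hahn \<Rightarrow> 'a hahn" where
  "plus_hahn f g = Hahn (\<lambda>e. coeff f e + coeff g e)"
definition minus_hahn :: "'a hahn \<Rightarrow> 'a hahn \<Rightarrow> 'a hahn" where
  "minus_hahn f g = Hahn (\<lambda>e. coeff f e - coeff g e)"
definition uminus_hahn :: "'a hahn \<Rightarrow> 'a hahn" where
  "uminus_hahn f = Hahn (\<lambda>e. - coeff f e)"
definition times_hahn :: "'a hahn \<Rightarrow> 'a hahn \<Rightarrow> 'a hahn" where
  "times_hahn f g = Hahn (conv (coeff f) (coeff g))"
instance ..
end

lemma coeff_zero [simp]: "coeff 0 e = 0"
  by (simp add: zero_hahn_def coeff_Hahn well_ordered_def)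

lemma coeff_one: "coeff 1 e = (if e = 0 then 1 else 0)"
  by (simp add: one_hahn_def coeff_hmono)

lemma coeff_plus [simp]: "coeff (f + g) e = coeff f e + coeff g e"
  unfolding plus_hahn_def
  by (subst coeff_Hahn_subset[of _ "supp f \<union> supp g"]) (auto simp: supp_def[symmetric] supp_iff intro: well_ordered_Un well_ordered_supp)

lemma coeff_minus [simp]: "coeff (f - g) e = coeff f e - coeff g e"
  unfolding minus_hahn_def
  by (subst coeff_Hahn_subset[of _ "supp f \<union> supp g"]) (auto simp: supp_iff intro: well_ordered_Un well_ordered_supp)

lemma coeff_uminus [simp]: "coeff (- f) e = - coeff f e"
  unfolding uminus_hahn_def
  by (subst coeff_Hahn_subset[of _ "supp f"]) (auto simp: supp_iff intro: well_ordered_supp)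

lemma coeff_times: "coeff (f * g) e = Sum_any (\<lambda>a. coeff f a * coeff g (e - a))"
proof -
  have "{e. conv (coeff f) (coeff g) e \<noteq> 0} \<subseteq> sumset (supp f) (supp g)"
  proof
    fix e assume "e \<in> {e. conv (coeff f) (coeff g) e \<noteq> 0}"
    then have "Sum_any (\<lambda>a. coeff f a * coeff g (e - a)) \<noteq> 0" by (simp add: conv_def)
    then obtain a where "coeff f a * coeff g (e - a) \<noteq> 0" by (rule Sum_any_neq_0E)
    then have "a \<in> supp f" "e - a \<in> supp g" "e = a + (e - a)" by (auto simp: supp_iff)
    then show "e \<in> sumset (supp f) (supp g)" unfolding sumset_def by blast
  qed
  then show ?thesis
    unfolding times_hahn_def by (subst coeff_Hahn_subset) (auto simp: conv_def intro: well_ordered_sumset well_ordered_supp)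
qed

lemma supp_times: "supp (f * g) \<subseteq> sumset (supp f) (supp g)"
proof
  fix e assume "e \<in> supp (f * g)"
  then have "Sum_any (\<lambda>a. coeff f a * coeff g (e - a)) \<noteq> 0" by (simp add: supp_iff coeff_times)
  then obtain a where "coeff f a * coeff g (e - a) \<noteq> 0" by (rule Sum_any_neq_0E)
  then have "a \<in> supp f" "e - a \<in> supp g" "e = a + (e - a)" by (auto simp: supp_iff)
  then show "e \<in> sumset (supp f) (supp g)" unfolding sumset_def by blast
qed

lemma supp_plus: "supp (f + g) \<subseteq> supp f \<union> supp g"
  by (auto simp: supp_iff)

lemma supp_minus: "supp (f - g) \<subseteq> supp f \<union> supp g"
  by (auto simp: supp_iff)

lemma supp_uminus [simp]: "supp (- f) = supp f"
  by (auto simp: supp_iff)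

lemma supp_zero [simp]: "supp 0 = {}"
  by (auto simp: supp_iff)

lemma supp_one: "supp 1 = {0}"
  by (auto simp: supp_iff coeff_one split: if_splits)

lemma supp_hmono: "supp (hmono c e) \<subseteq> {e}"
  by (auto simp: supp_iff coeff_hmono split: if_splits)

lemma supp_eq_empty: "supp f = {} \<longleftrightarrow> f = 0"
  by (auto simp: supp_def intro: hahn_eqI)

lemma finite_conv_supp: "finite {a. coeff f a * coeff g (e - a) \<noteq> 0}"
  by (rule finite_subset[OF _ well_ordered_fibre_finite[OF well_ordered_supp[of f] well_ordered_supp[of g], of e]]) (auto simp: supp_iff)

lemma mult_comm_hahn: "f * g = g * (f :: 'a::linordered_ab_group_add hahn)"
proof (rule hahn_eqI)
  fix e :: 'a
  have "bij (\<lambda>a. e - a)" by (rule bij_betw_byWitness[where f' = "\<lambda>a. e - a"]) (auto simp: algebra_simps)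
  then show "coeff (f * g) e = coeff (g * f) e"
    unfolding coeff_times by (rule Sum_any.reindex_cong) (auto simp: mult.commute)
qed

lemma mult_assoc_hahn: "(f * g) * h = f * (g * (h :: 'a::linordered_ab_group_add hahn))"
proof (rule hahn_eqI)
  fix e
  define A where "A = {a \<in> sumset (supp f) (supp g). e - a \<in> supp h}"
  define B where "B = (\<Union>a\<in>A. {b \<in> supp f. a - b \<in> supp g})"
  have finA: "finite A" unfolding A_def by (intro well_ordered_fibre_finite well_ordered_sumset well_ordered_supp)
  then have finB: "finite B" unfolding B_def by (auto intro: well_ordered_fibre_finite well_ordered_supp)
  have "coeff (f * g * h) e = Sum_any (\<lambda>a. Sum_any (\<lambda>b. coeff f b * coeff g (a - b) * coeff h (e - a)))"
    unfolding coeff_times by (subst Sum_any_left_distrib[OF finite_conv_supp]) (rule refl)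
  also have "\<dots> = Sum_any (\<lambda>b. Sum_any (\<lambda>a. coeff f b * coeff g (a - b) * coeff h (e - a)))"
  proof (rule Sum_any_swap_finite[OF finA finB])
    fix a b assume nz: "coeff f b * coeff g (a - b) * coeff h (e - a) \<noteq> 0"
    have "a = b + (a - b)" "b \<in> supp f" "a - b \<in> supp g" using nz by (auto simp: supp_iff)
    then have "a \<in> A" unfolding A_def using nz sumsetI[of b "supp f" "a - b" "supp g"] by (auto simp: supp_iff)
    then show "a \<in> A \<and> b \<in> B" unfolding B_def using nz by (auto simp: supp_iff)
  qed
  also have "\<dots> = Sum_any (\<lambda>b. coeff f b * coeff (g * h) (e - b))"
  proof (rule Sum_any.cong)
    fix b :: 'a
    have "bij (\<lambda>c. b + c)" by (rule bij_betw_byWitness[where f' = "\<lambda>c. c - b"]) auto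
    then have "Sum_any (\<lambda>a. coeff f b * coeff g (a - b) * coeff h (e - a))
      = Sum_any (\<lambda>c. coeff f b * (coeff g c * coeff h (e - b - c)))"
      by (rule Sum_any.reindex_cong) (auto simp: algebra_simps)
    also have "\<dots> = coeff f b * coeff (g * h) (e - b)"
      unfolding coeff_times by (rule Sum_any_right_distrib[symmetric, OF finite_conv_supp])
    finally show "Sum_any (\<lambda>a. coeff f b * coeff g (a - b) * coeff h (e - a)) = coeff f b * coeff (g * h) (e - b)" .
  qed
  finally show "coeff (f * g * h) e = coeff (f * (g * h)) e" by (simp only: coeff_times[of f])
qed

lemma coeff_hmono_times: "coeff (hmono c d * f) e = c * coeff f (e - d)"
proof -
  have "coeff (hmono c d * f) e = sum (\<lambda>a. coeff (hmono c d) a * coeff f (e - a)) {d}"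
    unfolding coeff_times by (rule Sum_any_mono_neutral) (auto simp: coeff_hmono)
  then show ?thesis by (simp add: coeff_hmono)
qed

instance hahn :: (linordered_ab_group_add) comm_ring_1
proof
  fix a b c :: "'a hahn"
  show "a * b * c = a * (b * c)" by (rule mult_assoc_hahn)
  show "a * b = b * a" by (rule mult_comm_hahn)
  show "1 * a = a" by (rule hahn_eqI) (simp add: one_hahn_def coeff_hmono_times)
  show "a + b + c = a + (b + c)" "a + b = b + a" "0 + a = a" "- a + a = 0" "a - b = a + - b"
    by (rule hahn_eqI; simp)+
  show "(0::'a hahn) \<noteq> 1" using coeff_one[of 0] coeff_zero[of 0] by (metis zero_neq_one)
  show "(a + b) * c = a * c + b * c"
  proof (rule hahn_eqI)
    fix e
    show "coeff ((a + b) * c) e = coeff (a * c + b * c) e"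
      using Sum_any.distrib[OF finite_conv_supp[of a c e] finite_conv_supp[of b c e]]
      by (simp add: coeff_times distrib_right)
  qed
qed

lemma hmono_mult: "hmono c d * hmono c' d' = hmono (c * c') (d + d')"
  by (rule hahn_eqI) (auto simp: coeff_hmono_times coeff_hmono algebra_simps)

definition hconst :: "real \<Rightarrow> 'g::linordered_ab_group_add hahn" where
  "hconst c = hmono c 0"

lemma coeff_hconst_times [simp]: "coeff (hconst c * f) e = c * coeff f e"
  by (simp add: hconst_def coeff_hmono_times)

lemma coeff_hconst: "coeff (hconst c) e = (if e = 0 then c else 0)"
  by (simp add: hconst_def coeff_hmono)

lemma hconst_0 [simp]: "hconst 0 = 0" and hconst_1 [simp]: "hconst 1 = 1"
  by (rule hahn_eqI; simp add: coeff_hconst coeff_one)+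

lemma hconst_add: "hconst (a + b) = hconst a + hconst b" and hconst_mult: "hconst (a * b) = hconst a * hconst b"
  and hconst_minus: "hconst (- a) = - hconst a"
  by (rule hahn_eqI; simp add: coeff_hconst)+

lemma hconst_times_hmono: "hconst a * hmono c e = hmono (a * c) e"
  by (simp add: hconst_def hmono_mult)

lemma hmono_zero [simp]: "hmono 0 e = 0"
  by (rule hahn_eqI) (simp add: coeff_hmono)

lemma hmono_one_zero: "hmono 1 0 = 1"
  by (simp add: one_hahn_def)

lemma coeff_sum: "coeff (sum F A) e = (\<Sum>i\<in>A. coeff (F i) e)"
  by (induction A rule: infinite_finite_induct) auto

lemma supp_hconst_times: "supp (hconst c * f) \<subseteq> supp f"
  by (auto simp: supp_iff)

lemma supp_sum: "supp (sum F A) \<subseteq> (\<Union>i\<in>A. supp (F i))"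
  by (induction A rule: infinite_finite_induct) (use supp_plus in fastforce)+

subsection \<open>Summable families\<close>

definition hsummable :: "('i \<Rightarrow> 'g::linordered_ab_group_add hahn) \<Rightarrow> bool" where
  "hsummable F \<longleftrightarrow> (\<forall>e. finite {i. coeff (F i) e \<noteq> 0}) \<and> well_ordered (\<Union>i. supp (F i))"

definition hsum :: "('i \<Rightarrow> 'g::linordered_ab_group_add hahn) \<Rightarrow> 'g hahn" where
  "hsum F = Hahn (\<lambda>e. Sum_any (\<lambda>i. coeff (F i) e))"

lemma hsummableI:
  assumes "\<And>e. finite {i. coeff (F i) e \<noteq> 0}" "\<And>i. supp (F i) \<subseteq> W" "well_ordered W"
  shows "hsummable F"
  unfolding hsummable_def using assms well_ordered_subset[of W "\<Union>i. supp (F i)"] by blast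

lemma hsummable_finite: "hsummable F \<Longrightarrow> finite {i. coeff (F i) e \<noteq> 0}"
  by (simp add: hsummable_def)

lemma hsummable_well_ordered: "hsummable F \<Longrightarrow> well_ordered (\<Union>i. supp (F i))"
  by (simp add: hsummable_def)

lemma coeff_hsum:
  assumes "hsummable F"
  shows "coeff (hsum F) e = Sum_any (\<lambda>i. coeff (F i) e)"
proof -
  have "{e. Sum_any (\<lambda>i. coeff (F i) e) \<noteq> 0} \<subseteq> (\<Union>i. supp (F i))"
    by (auto elim!: Sum_any_neq_0E simp: supp_iff)
  then show ?thesis
    unfolding hsum_def by (subst coeff_Hahn_subset) (auto intro: hsummable_well_ordered[OF assms])
qed

lemma supp_hsum: "hsummable F \<Longrightarrow> supp (hsum F) \<subseteq> (\<Union>i. supp (F i))"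
  by (auto simp: supp_iff coeff_hsum elim!: Sum_any_neq_0E)

lemma hsummable_subset:
  assumes "hsummable F" "\<And>i. supp (G i) \<subseteq> supp (F i)"
  shows "hsummable G"
proof (rule hsummableI)
  fix e
  have "coeff (F i) e \<noteq> 0" if "coeff (G i) e \<noteq> 0" for i
    using assms(2)[of i] that by (auto simp: supp_def)
  then show "finite {i. coeff (G i) e \<noteq> 0}"
    by (intro finite_subset[OF _ hsummable_finite[OF assms(1), of e]]) auto
  show "supp (G i) \<subseteq> (\<Union>i. supp (F i))" for i using assms(2)[of i] by blast
qed (rule hsummable_well_ordered[OF assms(1)])

lemma hsummable_hconst: "hsummable F \<Longrightarrow> hsummable (\<lambda>i. hconst (c i) * F i)"
  by (erule hsummable_subset) (rule supp_hconst_times)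

lemma hsum_add:
  assumes "hsummable F" "hsummable G"
  shows "hsummable (\<lambda>i. F i + G i)" "hsum (\<lambda>i. F i + G i) = hsum F + hsum G"
proof -
  show s: "hsummable (\<lambda>i. F i + G i)"
  proof (rule hsummableI)
    fix e
    show "finite {i. coeff (F i + G i) e \<noteq> 0}"
      by (rule finite_subset[OF _ finite_UnI[OF hsummable_finite[OF assms(1), of e] hsummable_finite[OF assms(2), of e]]]) auto
    show "supp (F i + G i) \<subseteq> (\<Union>i. supp (F i)) \<union> (\<Union>i. supp (G i))" for i
      using supp_plus[of "F i" "G i"] by blast
    show "well_ordered ((\<Union>i. supp (F i)) \<union> (\<Union>i. supp (G i)))" by (intro well_ordered_Un hsummable_well_ordered assms)
  qed
  show "hsum (\<lambda>i. F i + G i) = hsum F + hsum G"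
    by (rule hahn_eqI) (simp add: coeff_hsum s assms Sum_any.distrib hsummable_finite)
qed

lemma hsum_mult:
  assumes "hsummable F"
  shows "hsummable (\<lambda>i. g * F i)" "hsum (\<lambda>i. g * F i) = g * hsum F"
proof -
  let ?W = "\<Union>i. supp (F i)"
  have fin: "finite {a \<in> supp g. e - a \<in> ?W}" for e
    by (intro well_ordered_fibre_finite well_ordered_supp hsummable_well_ordered assms)
  \<comment> \<open>Only finitely many \<open>a\<close> can contribute to the exponent
    \<open>e\<close>, and for each of them only finitely many \<open>i\<close>; \<open>I e\<close>
    collects these indices.\<close>
  define I where "I e = (\<Union>a\<in>{a \<in> supp g. e - a \<in> ?W}. {i. coeff (F i) (e - a) \<noteq> 0})" for e
  have finI: "finite (I e)" for e unfolding I_def using fin hsummable_finite[OF assms] by blast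
  have inI: "i \<in> I e" if "coeff g a \<noteq> 0" "coeff (F i) (e - a) \<noteq> 0" for a i e
    using that by (auto simp: I_def supp_iff)
  show s: "hsummable (\<lambda>i. g * F i)"
  proof (rule hsummableI)
    fix e
    show "finite {i. coeff (g * F i) e \<noteq> 0}"
      by (rule finite_subset[OF _ finI[of e]]) (auto simp: coeff_times elim!: Sum_any_neq_0E intro: inI)
    show "supp (g * F i) \<subseteq> sumset (supp g) ?W" for i
      by (rule order_trans[OF supp_times sumset_mono]) auto
    show "well_ordered (sumset (supp g) ?W)" by (intro well_ordered_sumset well_ordered_supp hsummable_well_ordered assms)
  qed
  show "hsum (\<lambda>i. g * F i) = g * hsum F"
  proof (rule hahn_eqI)
    fix e
    have "coeff (hsum (\<lambda>i. g * F i)) e = Sum_any (\<lambda>i. Sum_any (\<lambda>a. coeff g a * coeff (F i) (e - a)))"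
      by (simp add: coeff_hsum[OF s] coeff_times)
    also have "\<dots> = Sum_any (\<lambda>a. Sum_any (\<lambda>i. coeff g a * coeff (F i) (e - a)))"
      by (rule Sum_any_swap_finite[OF finI[of e] fin[of e]]) (use inI in \<open>auto simp: supp_iff\<close>)
    also have "\<dots> = Sum_any (\<lambda>a. coeff g a * coeff (hsum F) (e - a))"
      by (rule Sum_any.cong) (simp add: coeff_hsum[OF assms] Sum_any_right_distrib[OF hsummable_finite[OF assms]])
    finally show "coeff (hsum (\<lambda>i. g * F i)) e = coeff (g * hsum F) e" by (simp add: coeff_times)
  qed
qed

lemma hsum_Fubini:
  assumes "hsummable (\<lambda>(i, j). F i j)"
  shows "\<And>i. hsummable (F i)" "hsummable (\<lambda>i. hsum (F i))"
    "hsum (\<lambda>(i, j). F i j) = hsum (\<lambda>i. hsum (F i))"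
proof -
  let ?W = "\<Union>p. supp (case p of (i, j) \<Rightarrow> F i j)"
  have W: "well_ordered ?W" by (rule hsummable_well_ordered[OF assms])
  have sub: "supp (F i j) \<subseteq> ?W" for i j by force
  have fin: "finite {(i, j). coeff (F i j) e \<noteq> 0}" for e
    using hsummable_finite[OF assms, of e] by (simp add: case_prod_unfold)
  have inA: "i \<in> fst ` {(i, j). coeff (F i j) e \<noteq> 0}" if "coeff (F i j) e \<noteq> 0" for i j e
    using that by force
  have inB: "j \<in> snd ` {(i, j). coeff (F i j) e \<noteq> 0}" if "coeff (F i j) e \<noteq> 0" for i j e
    using that by force
  show s: "hsummable (F i)" for i
  proof (rule hsummableI[OF _ sub W])
    fix e
    show "finite {j. coeff (F i j) e \<noteq> 0}"
      by (rule finite_subset[OF _ finite_imageI[OF fin[of e], of snd]]) (use inB in blast)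
  qed
  show s': "hsummable (\<lambda>i. hsum (F i))"
  proof (rule hsummableI[OF _ _ W])
    fix e
    show "finite {i. coeff (hsum (F i)) e \<noteq> 0}"
      by (rule finite_subset[OF _ finite_imageI[OF fin[of e], of fst]])
         (auto simp: coeff_hsum[OF s] elim!: Sum_any_neq_0E intro: inA)
    show "supp (hsum (F i)) \<subseteq> ?W" for i
      using supp_hsum[OF s[of i]] sub by blast
  qed
  show "hsum (\<lambda>(i, j). F i j) = hsum (\<lambda>i. hsum (F i))"
  proof (rule hahn_eqI)
    fix e
    have "coeff (hsum (\<lambda>i. hsum (F i))) e = Sum_any (\<lambda>i. Sum_any (\<lambda>j. coeff (F i j) e))"
      by (simp add: coeff_hsum s s')
    also have "\<dots> = Sum_any (\<lambda>(i, j). coeff (F i j) e)"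
      by (rule Sum_any_pair_finite[OF finite_imageI[OF fin[of e], of fst] finite_imageI[OF fin[of e], of snd]])
         (use inA inB in blast)
    also have "\<dots> = Sum_any (\<lambda>p. coeff (case p of (i, j) \<Rightarrow> F i j) e)"
      by (rule Sum_any.cong) (simp split: prod.split)
    also have "\<dots> = coeff (hsum (\<lambda>(i, j). F i j)) e" by (rule coeff_hsum[OF assms, symmetric])
    finally show "coeff (hsum (\<lambda>(i, j). F i j)) e = coeff (hsum (\<lambda>i. hsum (F i))) e" ..
  qed
qed

text \<open>Both families are extended by zero outside \<open>I\<close> and \<open>J\<close>. This
  covers a mere change of index type as well as the passage from all pairs \<open>(i, j)\<close> to
  the pairs \<open>(i + j, i)\<close>, which do not fill their type.\<close>

lemma hsum_reindex:
  assumes "bij_betw h I J" "\<And>i. i \<notin> I \<Longrightarrow> F i = 0" "\<And>j. j \<notin> J \<Longrightarrow> G j = 0"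
    "\<And>i. i \<in> I \<Longrightarrow> G (h i) = F i" "hsummable F"
  shows "hsummable G" "hsum G = hsum F"
proof -
  have eq: "{j. coeff (G j) e \<noteq> 0} = h ` {i. coeff (F i) e \<noteq> 0}" for e
  proof (intro equalityI subsetI)
    fix j assume j: "j \<in> {j. coeff (G j) e \<noteq> 0}"
    then have "j \<in> J" using assms(3) by fastforce
    then obtain i where "i \<in> I" "j = h i" using assms(1) by (auto simp: bij_betw_def)
    then show "j \<in> h ` {i. coeff (F i) e \<noteq> 0}" using j assms(4) by auto
  next
    fix j assume "j \<in> h ` {i. coeff (F i) e \<noteq> 0}"
    then obtain i where i: "j = h i" "coeff (F i) e \<noteq> 0" by blast
    then have "i \<in> I" using assms(2) by fastforce
    then show "j \<in> {j. coeff (G j) e \<noteq> 0}" using i assms(4) by simp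
  qed
  show s: "hsummable G"
  proof (rule hsummableI[OF _ _ hsummable_well_ordered[OF assms(5)]])
    show "finite {j. coeff (G j) e \<noteq> 0}" for e
      unfolding eq by (intro finite_imageI hsummable_finite assms)
    show "supp (G j) \<subseteq> (\<Union>i. supp (F i))" for j
      using eq by (fastforce simp: supp_iff)
  qed
  show "hsum G = hsum F"
  proof (rule hahn_eqI)
    fix e
    have sub: "{i. coeff (F i) e \<noteq> 0} \<subseteq> I" using assms(2) by fastforce
    have "coeff (hsum G) e = sum (\<lambda>j. coeff (G j) e) (h ` {i. coeff (F i) e \<noteq> 0})"
      unfolding coeff_hsum[OF s] Sum_any.expand_set eq ..
    also have "\<dots> = sum (\<lambda>i. coeff (G (h i)) e) {i. coeff (F i) e \<noteq> 0}"
      using assms(1) sub by (subst sum.reindex) (auto simp: bij_betw_def intro: inj_on_subset)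
    also have "\<dots> = sum (\<lambda>i. coeff (F i) e) {i. coeff (F i) e \<noteq> 0}"
      using sub assms(4) by (intro sum.cong) auto
    finally show "coeff (hsum G) e = coeff (hsum F) e"
      unfolding coeff_hsum[OF assms(5)] Sum_any.expand_set .
  qed
qed

lemma hsum_swap:
  assumes "hsummable (\<lambda>(i, j). F i j)"
  shows "hsum (\<lambda>i. hsum (F i)) = hsum (\<lambda>j. hsum (\<lambda>i. F i j))"
proof -
  have b: "bij_betw prod.swap UNIV UNIV" by simp
  have s: "hsummable (\<lambda>(j, i). F i j)" "hsum (\<lambda>(j, i). F i j) = hsum (\<lambda>(i, j). F i j)"
    by (rule hsum_reindex[OF b _ _ _ assms]; auto)+
  show ?thesis
    using hsum_Fubini(3)[OF assms] hsum_Fubini(3)[OF s(1)] s(2) by simp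
qed

lemma hsum_finite_sum:
  assumes "finite A" "\<And>i. i \<notin> A \<Longrightarrow> F i = 0"
  shows "hsummable F" "hsum F = sum F A"
proof -
  show s: "hsummable F"
  proof (rule hsummableI)
    show "finite {i. coeff (F i) e \<noteq> 0}" for e
      by (rule finite_subset[OF _ assms(1)]) (use assms(2) in fastforce)
    show "supp (F i) \<subseteq> (\<Union>i\<in>A. supp (F i))" for i using assms(2)[of i] by (cases "i \<in> A") auto
    show "well_ordered (\<Union>i\<in>A. supp (F i))" by (intro well_ordered_UN_finite assms well_ordered_supp)
  qed
  show "hsum F = sum F A"
    by (rule hahn_eqI) (auto simp: coeff_hsum[OF s] coeff_sum assms(2) intro!: Sum_any_mono_neutral assms(1))
qed

lemma hsum_product:
  assumes "hsummable F" "hsummable G"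
  shows "hsummable (\<lambda>(i, j). F i * G j)" "hsum (\<lambda>(i, j). F i * G j) = hsum F * hsum G"
proof -
  let ?V = "\<Union>i. supp (F i)" and ?W = "\<Union>i. supp (G i)"
  have fin: "finite {a \<in> ?V. e - a \<in> ?W}" for e
    by (intro well_ordered_fibre_finite hsummable_well_ordered assms)
  show s: "hsummable (\<lambda>(i, j). F i * G j)"
  proof (rule hsummableI)
    fix e
    let ?I = "\<Union>a\<in>{a \<in> ?V. e - a \<in> ?W}. {i. coeff (F i) a \<noteq> 0} \<times> {j. coeff (G j) (e - a) \<noteq> 0}"
    have "finite ?I" using fin hsummable_finite[OF assms(1)] hsummable_finite[OF assms(2)] by blast
    moreover have "{p. coeff (case p of (i, j) \<Rightarrow> F i * G j) e \<noteq> 0} \<subseteq> ?I"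
    proof (clarsimp simp: coeff_times)
      fix i j assume "Sum_any (\<lambda>a. coeff (F i) a * coeff (G j) (e - a)) \<noteq> 0"
      then obtain a where "coeff (F i) a * coeff (G j) (e - a) \<noteq> 0" by (rule Sum_any_neq_0E)
      then show "\<exists>a. (\<exists>i. a \<in> supp (F i)) \<and> (\<exists>j. e - a \<in> supp (G j)) \<and> coeff (F i) a \<noteq> 0 \<and> coeff (G j) (e - a) \<noteq> 0"
        by (auto simp: supp_iff)
    qed
    ultimately show "finite {p. coeff (case p of (i, j) \<Rightarrow> F i * G j) e \<noteq> 0}" by (rule rev_finite_subset)
    show "supp (case p of (i, j) \<Rightarrow> F i * G j) \<subseteq> sumset ?V ?W" for p
      by (cases p) (simp, rule order_trans[OF supp_times sumset_mono], auto)
    show "well_ordered (sumset ?V ?W)" by (intro well_ordered_sumset hsummable_well_ordered assms)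
  qed
  have "hsum (\<lambda>(i, j). F i * G j) = hsum (\<lambda>i. F i * hsum G)"
    by (simp add: hsum_Fubini(3)[OF s] hsum_mult(2)[OF assms(2)])
  then show "hsum (\<lambda>(i, j). F i * G j) = hsum F * hsum G"
    using hsum_mult(2)[OF assms(1), of "hsum G"] by (simp add: mult.commute)
qed

lemma hsum_antidiagonal:
  fixes F :: "nat \<Rightarrow> nat \<Rightarrow> 'g::linordered_ab_group_add hahn"
  assumes "hsummable (\<lambda>(i, j). F i j)"
  shows "hsum (\<lambda>(i, j). F i j) = hsum (\<lambda>n. \<Sum>i\<le>n. F i (n - i))"
proof -
  define G where "G n i = (if i \<le> n then F i (n - i) else 0)" for n i
  have b: "bij_betw (\<lambda>(i, j). (i + j, i)) UNIV {(n, i::nat). i \<le> n}"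
    by (rule bij_betw_byWitness[where f' = "\<lambda>(n, i). (i, n - i)"]) auto
  have s: "hsummable (\<lambda>(n, i). G n i)" "hsum (\<lambda>(n, i). G n i) = hsum (\<lambda>(i, j). F i j)"
    by (rule hsum_reindex[OF b _ _ _ assms]; auto simp: G_def)+
  have "hsum (G n) = (\<Sum>i\<le>n. F i (n - i))" for n
    by (subst hsum_finite_sum[of "{..n}"]) (auto simp: G_def)
  then show ?thesis using s(2) hsum_Fubini(3)[OF s(1)] by simp
qed

lemma hsum_expansion:
  "hsummable (\<lambda>e. hmono (coeff f e) e)" "hsum (\<lambda>e. hmono (coeff f e) e) = f"
proof -
  show s: "hsummable (\<lambda>e. hmono (coeff f e) e)"
  proof (rule hsummableI[OF _ _ well_ordered_supp[of f]])
    show "finite {i. coeff (hmono (coeff f i) i) e \<noteq> 0}" for e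
      by (rule finite_subset[of _ "{e}"]) (auto simp: coeff_hmono split: if_splits)
    show "supp (hmono (coeff f i) i) \<subseteq> supp f" for i
      by (auto simp: supp_iff coeff_hmono split: if_splits)
  qed
  show "hsum (\<lambda>e. hmono (coeff f e) e) = f"
    by (rule hahn_eqI) (simp add: coeff_hsum[OF s] coeff_hmono)
qed

subsection \<open>Orders\<close>

definition ord_ge :: "'g::linordered_ab_group_add \<Rightarrow> 'g hahn \<Rightarrow> bool" where
  "ord_ge e f \<longleftrightarrow> (\<forall>x\<in>supp f. e \<le> x)"

definition ord_gt :: "'g::linordered_ab_group_add \<Rightarrow> 'g hahn \<Rightarrow> bool" where
  "ord_gt e f \<longleftrightarrow> (\<forall>x\<in>supp f. e < x)"

lemma ord_geD: "ord_ge e f \<Longrightarrow> x < e \<Longrightarrow> coeff f x = 0"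
  by (metis ord_ge_def supp_iff linorder_not_le)

lemma ord_gtD: "ord_gt e f \<Longrightarrow> x \<le> e \<Longrightarrow> coeff f x = 0"
  by (metis ord_gt_def supp_iff linorder_not_le)

lemma ord_gt_imp_ord_ge: "ord_gt e f \<Longrightarrow> ord_ge e f"
  unfolding ord_ge_def ord_gt_def by (simp add: less_imp_le)

lemma ord_gt_iff: "ord_gt e f \<longleftrightarrow> ord_ge e f \<and> coeff f e = 0"
  unfolding ord_ge_def ord_gt_def by (metis supp_iff less_irrefl less_le)

lemma ord_ge_trans: "ord_ge e f \<Longrightarrow> e' \<le> e \<Longrightarrow> ord_ge e' f"
  unfolding ord_ge_def by (meson order_trans)

lemma ord_ge_imp_ord_gt: "ord_ge e f \<Longrightarrow> e' < e \<Longrightarrow> ord_gt e' f"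
  unfolding ord_ge_def ord_gt_def by (meson less_le_trans)

lemma ord_ge_zero [simp]: "ord_ge e 0" and ord_gt_zero [simp]: "ord_gt e 0"
  by (auto simp: ord_ge_def ord_gt_def)

lemma ord_ge_uminus [simp]: "ord_ge e (- f) \<longleftrightarrow> ord_ge e f"
  and ord_gt_uminus [simp]: "ord_gt e (- f) \<longleftrightarrow> ord_gt e f"
  by (auto simp: ord_ge_def ord_gt_def)

lemma ord_ge_add: "ord_ge e f \<Longrightarrow> ord_ge e g \<Longrightarrow> ord_ge e (f + g)"
  unfolding ord_ge_def using supp_plus[of f g] by blast

lemma ord_gt_add: "ord_gt e f \<Longrightarrow> ord_gt e g \<Longrightarrow> ord_gt e (f + g)"
  unfolding ord_gt_def using supp_plus[of f g] by blast

lemma ord_ge_diff: "ord_ge e f \<Longrightarrow> ord_ge e g \<Longrightarrow> ord_ge e (f - g)"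
  unfolding ord_ge_def using supp_minus[of f g] by blast

lemma ord_gt_diff: "ord_gt e f \<Longrightarrow> ord_gt e g \<Longrightarrow> ord_gt e (f - g)"
  unfolding ord_gt_def using supp_minus[of f g] by blast

lemma ord_ge_sum: "(\<And>i. i \<in> A \<Longrightarrow> ord_ge e (F i)) \<Longrightarrow> ord_ge e (sum F A)"
  by (induction A rule: infinite_finite_induct) (auto intro: ord_ge_add)

lemma ord_gt_sum: "(\<And>i. i \<in> A \<Longrightarrow> ord_gt e (F i)) \<Longrightarrow> ord_gt e (sum F A)"
  by (induction A rule: infinite_finite_induct) (auto intro: ord_gt_add)

lemma ord_ge_mult: "ord_ge a f \<Longrightarrow> ord_ge b g \<Longrightarrow> ord_ge (a + b) (f * g)"
  unfolding ord_ge_def using supp_times[of f g] by (fastforce simp: sumset_def intro: add_mono)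

lemma ord_gt_mult: "ord_gt a f \<Longrightarrow> ord_ge b g \<Longrightarrow> ord_gt (a + b) (f * g)"
  unfolding ord_ge_def ord_gt_def using supp_times[of f g]
  by (fastforce simp: sumset_def intro: add_less_le_mono)

lemma ord_ge_hmono: "ord_ge e (hmono c e)"
  unfolding ord_ge_def using supp_hmono[of c e] by auto

lemma ord_ge_hconst: "ord_ge 0 (hconst c)"
  unfolding hconst_def by (rule ord_ge_hmono)

lemma ord_ge_one: "ord_ge 0 1"
  using ord_ge_hconst[of 1] by simp

lemma ord_ge_hconst_times: "ord_ge e f \<Longrightarrow> ord_ge e (hconst c * f)"
  unfolding ord_ge_def using supp_hconst_times[of c f] by blast

lemma ord_gt_hconst_times: "ord_gt e f \<Longrightarrow> ord_gt e (hconst c * f)"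
  unfolding ord_gt_def using supp_hconst_times[of c f] by blast

lemma ord_ge_hsum: "hsummable F \<Longrightarrow> (\<And>i. ord_ge e (F i)) \<Longrightarrow> ord_ge e (hsum F)"
  unfolding ord_ge_def using supp_hsum[of F] by blast

lemma ord_gt_hsum: "hsummable F \<Longrightarrow> (\<And>i. ord_gt e (F i)) \<Longrightarrow> ord_gt e (hsum F)"
  unfolding ord_gt_def using supp_hsum[of F] by blast

lemma coeff_mult_lead:
  assumes "ord_ge a f" "ord_ge b g"
  shows "coeff (f * g) (a + b) = coeff f a * coeff g b"
proof -
  have "coeff (f * g) (a + b) = sum (\<lambda>x. coeff f x * coeff g (a + b - x)) {a}"
    unfolding coeff_times
  proof (rule Sum_any_mono_neutral)
    fix x assume "x \<notin> {a}"
    then consider "x < a" | "a + b - x < b" by (cases "x < a") (auto simp: algebra_simps)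
    then show "coeff f x * coeff g (a + b - x) = 0"
      by cases (simp_all add: ord_geD[OF assms(1)] ord_geD[OF assms(2)])
  qed simp
  then show ?thesis by simp
qed

lemma lead_exists:
  assumes "f \<noteq> 0" obtains e where "ord_ge e f" "coeff f e \<noteq> 0"
proof -
  obtain e where "e \<in> supp f" "\<forall>y\<in>supp f. e \<le> y"
    using well_orderedD[OF well_ordered_supp[of f], of "supp f"] assms by (auto simp: supp_eq_empty)
  then show ?thesis using that by (auto simp: ord_ge_def supp_iff)
qed

subsection \<open>Evaluation of formal power series at infinitesimals\<close>

text \<open>Evaluation turns out to be a ring homomorphism compatible with composition, so
  identities of exponential, logarithmic and binomial series are proved for real formal power series
  and then transferred.\<close>

definition fps_eval :: "'g::linordered_ab_group_add hahn \<Rightarrow> real fps \<Rightarrow> 'g hahn" where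
  "fps_eval d F = hsum (\<lambda>n. hconst (fps_nth F n) * d ^ n)"

lemma supp_power: "supp d \<subseteq> S \<Longrightarrow> supp (d ^ n) \<subseteq> {x. nsum S n x}"
proof (induction n)
  case 0
  then show ?case by (auto simp: supp_one intro: nsum_0)
next
  case (Suc n)
  then have "supp (d * d ^ n) \<subseteq> sumset S {x. nsum S n x}"
    by (intro order_trans[OF supp_times sumset_mono])
  also have "\<dots> \<subseteq> {x. nsum S (Suc n) x}" by (auto simp: sumset_def intro: nsum_Suc)
  finally show ?case by simp
qed

lemma power_summable:
  assumes "ord_gt 0 d" shows "hsummable (\<lambda>n. d ^ n)"
proof (rule hsummableI)
  have pos: "\<And>s. s \<in> supp d \<Longrightarrow> 0 < s" using assms by (simp add: ord_gt_def)
  have sub: "supp (d ^ n) \<subseteq> {x. nsum (supp d) n x}" for n by (rule supp_power) simp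
  show "finite {n. coeff (d ^ n) e \<noteq> 0}" for e
    by (rule finite_subset[OF _ finite_nsum[OF well_ordered_supp pos, of d e]]) (use sub in \<open>auto simp: supp_def\<close>)
  show "supp (d ^ n) \<subseteq> generated (supp d)" for n using sub by (auto simp: generated_def)
  show "well_ordered (generated (supp d))" by (rule well_ordered_generated[OF well_ordered_supp pos])
qed

lemma fps_eval_summable: "ord_gt 0 d \<Longrightarrow> hsummable (\<lambda>n. hconst (fps_nth F n) * d ^ n)"
  by (rule hsummable_hconst[OF power_summable])

lemma supp_fps_eval:
  assumes "ord_gt 0 d" "supp d \<subseteq> S" shows "supp (fps_eval d F) \<subseteq> generated S"
proof -
  have "supp (hconst (fps_nth F n) * d ^ n) \<subseteq> generated S" for n
    using supp_hconst_times[of "fps_nth F n" "d ^ n"] supp_power[OF assms(2), of n] by (auto simp: generated_def)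
  then show ?thesis unfolding fps_eval_def using supp_hsum[OF fps_eval_summable[OF assms(1)]] by blast
qed

lemma ord_ge_fps_eval: "ord_gt 0 d \<Longrightarrow> ord_ge 0 (fps_eval d F)"
  unfolding ord_ge_def using supp_fps_eval[of d "supp d" F] generated_nonneg[of "supp d"]
  by (auto simp: ord_gt_def)

lemma hconst_sum: "hconst (sum f A) = (\<Sum>i\<in>A. hconst (f i))"
  by (induction A rule: infinite_finite_induct) (auto simp: hconst_add)

lemma fps_eval_add: "ord_gt 0 d \<Longrightarrow> fps_eval d (F + G) = fps_eval d F + fps_eval d G"
  unfolding fps_eval_def by (simp add: hsum_add(2)[OF fps_eval_summable fps_eval_summable, symmetric] hconst_add distrib_right)

lemma fps_eval_mult:
  assumes "ord_gt 0 d" shows "fps_eval d (F * G) = fps_eval d F * fps_eval d G"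
proof -
  note s = fps_eval_summable[OF assms]
  have "fps_eval d F * fps_eval d G = hsum (\<lambda>(i, j). (hconst (fps_nth F i) * d ^ i) * (hconst (fps_nth G j) * d ^ j))"
    unfolding fps_eval_def by (rule hsum_product(2)[OF s s, symmetric])
  also have "\<dots> = hsum (\<lambda>n. \<Sum>i\<le>n. (hconst (fps_nth F i) * d ^ i) * (hconst (fps_nth G (n - i)) * d ^ (n - i)))"
    by (rule hsum_antidiagonal[OF hsum_product(1)[OF s s]])
  also have "\<dots> = fps_eval d (F * G)"
    unfolding fps_eval_def
  proof (rule arg_cong[where f = hsum], rule ext)
    fix n
    have "hconst (fps_nth F i) * d ^ i * (hconst (fps_nth G (n - i)) * d ^ (n - i))
        = hconst (fps_nth F i * fps_nth G (n - i)) * d ^ n" if "i \<le> n" for i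
    proof -
      have "hconst (fps_nth F i) * d ^ i * (hconst (fps_nth G (n - i)) * d ^ (n - i))
        = hconst (fps_nth F i) * hconst (fps_nth G (n - i)) * (d ^ i * d ^ (n - i))" by (simp add: ac_simps)
      then show ?thesis using that by (simp add: hconst_mult power_add[symmetric])
    qed
    then show "(\<Sum>i\<le>n. hconst (fps_nth F i) * d ^ i * (hconst (fps_nth G (n - i)) * d ^ (n - i)))
        = hconst (fps_nth (F * G) n) * d ^ n"
      by (simp add: fps_mult_nth hconst_sum sum_distrib_right atMost_atLeast0)
  qed
  finally show ?thesis ..
qed

lemma fps_eval_const: "ord_gt 0 d \<Longrightarrow> fps_eval d (fps_const c) = hconst c"
  unfolding fps_eval_def by (subst hsum_finite_sum[of "{0}"]) auto

lemma fps_eval_1: "ord_gt 0 d \<Longrightarrow> fps_eval d 1 = 1"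
  using fps_eval_const[of d 1] by simp

lemma fps_eval_X: "ord_gt 0 d \<Longrightarrow> fps_eval d fps_X = d"
  unfolding fps_eval_def by (subst hsum_finite_sum[of "{1}"]) (auto simp: fps_X_def)

lemma fps_eval_uminus: "ord_gt 0 d \<Longrightarrow> fps_eval d (- F) = - fps_eval d F"
  using fps_eval_add[of d F "- F"] fps_eval_const[of d 0] minus_unique[of "fps_eval d F" "fps_eval d (- F)"] by simp

lemma fps_eval_diff: "ord_gt 0 d \<Longrightarrow> fps_eval d (F - G) = fps_eval d F - fps_eval d G"
  using fps_eval_add[of d F "- G"] by (simp add: fps_eval_uminus)

lemma fps_eval_power: "ord_gt 0 d \<Longrightarrow> fps_eval d (F ^ n) = fps_eval d F ^ n"
  by (induction n) (simp_all add: fps_eval_1 fps_eval_mult)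

lemma fps_eval_const_mult: "ord_gt 0 d \<Longrightarrow> fps_eval d (fps_const c * F) = hconst c * fps_eval d F"
  by (simp add: fps_eval_mult fps_eval_const)

lemma fps_split_X: "F = fps_const (fps_nth F 0) + fps_X * fps_shift 1 (F :: real fps)"
  by (rule fps_ext) (simp add: fps_X_mult_nth)

text \<open>Peeling off the constant term exhibits a factor \<open>d\<close> in the rest; orders and
  leading coefficients of \<open>fps_eval d F\<close> are read off from this form.\<close>

lemma fps_eval_split: "ord_gt 0 d \<Longrightarrow> fps_eval d F = hconst (fps_nth F 0) + d * fps_eval d (fps_shift 1 F)"
  by (subst fps_split_X) (simp add: fps_eval_add fps_eval_mult fps_eval_const fps_eval_X)

lemma ord_ge_fps_eval_0:
  assumes "ord_gt 0 d" "fps_nth F 0 = 0" "ord_ge e d" shows "ord_ge e (fps_eval d F)"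
  using ord_ge_mult[OF assms(3) ord_ge_fps_eval[OF assms(1), of "fps_shift 1 F"]] fps_eval_split[OF assms(1), of F] assms(2) by simp

lemma ord_gt_fps_eval_0: "ord_gt 0 d \<Longrightarrow> fps_nth F 0 = 0 \<Longrightarrow> ord_gt 0 (fps_eval d F)"
  using ord_gt_mult[of 0 d 0 "fps_eval d (fps_shift 1 F)"] fps_eval_split[of d F] ord_ge_fps_eval[of d "fps_shift 1 F"] by simp

lemma coeff_fps_eval_lead:
  assumes "ord_gt 0 d" "fps_nth F 0 = 0" "ord_ge e d" "0 \<le> e"
  shows "coeff (fps_eval d F) e = fps_nth F 1 * coeff d e"
proof -
  let ?G = "fps_shift 1 F"
  have "coeff (fps_eval d F) (e + 0) = coeff d e * coeff (fps_eval d ?G) 0"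
    using coeff_mult_lead[OF assms(3) ord_ge_fps_eval[OF assms(1), of ?G]] fps_eval_split[OF assms(1), of F] assms(2) by simp
  moreover have "coeff (fps_eval d ?G) 0 = fps_nth F 1"
    using fps_eval_split[OF assms(1), of ?G] ord_gtD[OF ord_gt_mult[OF assms(1) ord_ge_fps_eval[OF assms(1)]], of 0]
    by (simp add: coeff_hconst)
  ultimately show ?thesis by simp
qed

text \<open>Since \<open>G\<close> has no constant term, \<open>G ^ i\<close> starts at degree
  \<open>i\<close>. Each power of \<open>d\<close> therefore collects finitely many terms, the
  double family is summable, and exchanging the two sums compares the sides.\<close>

lemma fps_eval_compose:
  assumes "ord_gt 0 d" "fps_nth G 0 = 0"
  shows "fps_eval d (F oo G) = fps_eval (fps_eval d G) F"
proof -
  note inf = ord_gt_fps_eval_0[OF assms]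
  have ord: "fps_nth (G ^ i) n = 0" if "n < i" for i n
    using startsby_zero_power_prefix[OF assms(2)] that by blast
  have s: "hsummable (\<lambda>(i, n). hconst (fps_nth F i * fps_nth (G ^ i) n) * d ^ n)"
  proof (rule hsummableI[OF _ _ hsummable_well_ordered[OF power_summable[OF assms(1)]]])
    fix e
    have "{p. coeff (case p of (i, n) \<Rightarrow> hconst (fps_nth F i * fps_nth (G ^ i) n) * d ^ n) e \<noteq> 0}
      \<subseteq> (\<Union>n\<in>{n. coeff (d ^ n) e \<noteq> 0}. {..n} \<times> {n})"
      using ord by (auto simp: not_less[symmetric])
    then show "finite {p. coeff (case p of (i, n) \<Rightarrow> hconst (fps_nth F i * fps_nth (G ^ i) n) * d ^ n) e \<noteq> 0}"
      by (rule finite_subset) (use hsummable_finite[OF power_summable[OF assms(1)], of e] in auto)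
    show "supp (case p of (i, n) \<Rightarrow> hconst (fps_nth F i * fps_nth (G ^ i) n) * d ^ n) \<subseteq> (\<Union>n. supp (d ^ n))" for p
      by (cases p) (use supp_hconst_times in auto)
  qed
  have "fps_eval (fps_eval d G) F = hsum (\<lambda>i. hconst (fps_nth F i) * fps_eval d (G ^ i))"
    unfolding fps_eval_def[of "fps_eval d G"] by (simp add: fps_eval_power[OF assms(1)])
  also have "\<dots> = hsum (\<lambda>i. hsum (\<lambda>n. hconst (fps_nth F i * fps_nth (G ^ i) n) * d ^ n))"
    unfolding fps_eval_def by (simp add: hsum_mult(2)[OF fps_eval_summable[OF assms(1)], symmetric] hconst_mult mult.assoc)
  also have "\<dots> = hsum (\<lambda>n. hsum (\<lambda>i. hconst (fps_nth F i * fps_nth (G ^ i) n) * d ^ n))"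
    by (rule hsum_swap[OF s])
  also have "\<dots> = fps_eval d (F oo G)"
    unfolding fps_eval_def
  proof (rule arg_cong[where f = hsum], rule ext)
    fix n
    have "hsum (\<lambda>i. hconst (fps_nth F i * fps_nth (G ^ i) n) * d ^ n)
      = (\<Sum>i=0..n. hconst (fps_nth F i * fps_nth (G ^ i) n) * d ^ n)"
      by (rule hsum_finite_sum(2)) (auto simp: ord)
    then show "hsum (\<lambda>i. hconst (fps_nth F i * fps_nth (G ^ i) n) * d ^ n) = hconst (fps_nth (F oo G) n) * d ^ n"
      by (simp add: fps_compose_nth hconst_sum sum_distrib_right)
  qed
  finally show ?thesis ..
qed

subsection \<open>Exponential and logarithm\<close>

definition hexp :: "'g::linordered_ab_group_add hahn \<Rightarrow> 'g hahn" where
  "hexp d = fps_eval d (fps_exp 1)"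

definition hln1 :: "'g::linordered_ab_group_add hahn \<Rightarrow> 'g hahn" where
  "hln1 d = fps_eval d (fps_ln 1)"

text \<open>Two independent arguments are involved, so no identity of one-variable series can simply
  be evaluated; the product is regrouped by total degree and the binomial theorem applied.\<close>

lemma hexp_add:
  assumes "ord_gt 0 a" "ord_gt 0 b" shows "hexp (a + b) = hexp a * hexp b"
proof -
  note s = fps_eval_summable[OF assms(1)] fps_eval_summable[OF assms(2)]
  have "hexp a * hexp b = hsum (\<lambda>(i, j). (hconst (fps_nth (fps_exp 1) i) * a ^ i) * (hconst (fps_nth (fps_exp 1) j) * b ^ j))"
    unfolding hexp_def fps_eval_def by (rule hsum_product(2)[OF s, symmetric])
  also have "\<dots> = hsum (\<lambda>n. \<Sum>i\<le>n. (hconst (fps_nth (fps_exp 1) i) * a ^ i) * (hconst (fps_nth (fps_exp 1) (n - i)) * b ^ (n - i)))"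
    by (rule hsum_antidiagonal[OF hsum_product(1)[OF s]])
  also have "\<dots> = hexp (a + b)"
    unfolding hexp_def fps_eval_def
  proof (rule arg_cong[where f = hsum], rule ext)
    fix n
    have of_nat: "of_nat m = (hconst (of_nat m) :: 'a hahn)" for m
      by (induction m) (simp_all add: hconst_add)
    have "hconst (1 / fact n) * (of_nat (n choose i) * a ^ i * b ^ (n - i)) =
       hconst (1 / fact i) * a ^ i * (hconst (1 / fact (n - i)) * b ^ (n - i))" if "i \<le> n" for i
    proof -
      have "1 / fact n * real (n choose i) = 1 / fact i * (1 / fact (n - i))"
        using that by (simp add: binomial_fact)
      then have "hconst (1 / fact n) * of_nat (n choose i) = hconst (1 / fact i) * (hconst (1 / fact (n - i)) :: 'a hahn)"
        unfolding of_nat hconst_mult[symmetric] by simp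
      then have "hconst (1 / fact n) * of_nat (n choose i) * (a ^ i * b ^ (n - i))
         = hconst (1 / fact i) * hconst (1 / fact (n - i)) * (a ^ i * b ^ (n - i))" by simp
      then show ?thesis by (simp add: ac_simps)
    qed
    then show "(\<Sum>i\<le>n. hconst (fps_nth (fps_exp 1) i) * a ^ i * (hconst (fps_nth (fps_exp 1) (n - i)) * b ^ (n - i)))
       = hconst (fps_nth (fps_exp 1) n) * (a + b) ^ n"
      by (simp add: binomial_ring sum_distrib_left)
  qed
  finally show ?thesis ..
qed

lemma hexp_0 [simp]: "hexp 0 = 1"
  unfolding hexp_def fps_eval_def by (subst hsum_finite_sum[of "{0}"]) (auto simp: power_0_left)

lemma ord_gt_hexp: "ord_gt 0 d \<Longrightarrow> ord_gt 0 (hexp d - 1)"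
  using ord_gt_fps_eval_0[of d "fps_exp 1 - 1"] by (simp add: hexp_def fps_eval_diff fps_eval_1)

lemma ord_ge_hexp: "ord_gt 0 d \<Longrightarrow> ord_ge e d \<Longrightarrow> ord_ge e (hexp d - 1)"
  using ord_ge_fps_eval_0[of d "fps_exp 1 - 1"] by (simp add: hexp_def fps_eval_diff fps_eval_1)

lemma coeff_hexp_lead: "ord_gt 0 d \<Longrightarrow> ord_ge e d \<Longrightarrow> 0 \<le> e \<Longrightarrow> coeff (hexp d - 1) e = coeff d e"
  using coeff_fps_eval_lead[of d "fps_exp 1 - 1" e] by (simp add: hexp_def fps_eval_diff fps_eval_1)

lemma fps_ln_nth_0: "fps_nth (fps_ln 1) 0 = (0::real)"
  by (simp add: fps_ln_def)

lemma fps_ln_nth_1: "fps_nth (fps_ln 1) (Suc 0) = (1::real)"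
  by (simp add: fps_ln_def)

lemma ord_gt_hln1: "ord_gt 0 d \<Longrightarrow> ord_gt 0 (hln1 d)"
  unfolding hln1_def by (rule ord_gt_fps_eval_0) (simp_all add: fps_ln_nth_0)

lemma ord_ge_hln1: "ord_gt 0 d \<Longrightarrow> ord_ge e d \<Longrightarrow> ord_ge e (hln1 d)"
  unfolding hln1_def by (rule ord_ge_fps_eval_0) (simp_all add: fps_ln_nth_0)

lemma coeff_hln1_lead: "ord_gt 0 d \<Longrightarrow> ord_ge e d \<Longrightarrow> 0 \<le> e \<Longrightarrow> coeff (hln1 d) e = coeff d e"
  using coeff_fps_eval_lead[of d "fps_ln 1" e] by (simp add: hln1_def fps_ln_nth_0 fps_ln_nth_1)

lemma fps_exp_oo_ln: "(fps_exp 1 - 1) oo fps_ln (1::real) = fps_X"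
  unfolding fps_ln_fps_exp_inv[of "1::real", simplified] by (rule fps_inv_right) simp_all

lemma fps_ln_oo_exp: "fps_ln (1::real) oo (fps_exp 1 - 1) = fps_X"
  unfolding fps_ln_fps_exp_inv[of "1::real", simplified] by (rule fps_inv) simp_all

lemma hexp_hln1:
  assumes "ord_gt 0 d" shows "hexp (hln1 d) = 1 + d"
proof -
  have "hexp (hln1 d) - 1 = fps_eval (hln1 d) (fps_exp 1 - 1)"
    by (simp add: hexp_def fps_eval_diff fps_eval_1 ord_gt_hln1 assms)
  also have "\<dots> = fps_eval d fps_X"
    unfolding hln1_def by (subst fps_eval_compose[OF assms, symmetric]) (simp_all add: fps_ln_nth_0 fps_exp_oo_ln)
  finally have "hexp (hln1 d) - 1 = d" by (simp add: fps_eval_X assms)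
  then show ?thesis by (simp add: algebra_simps)
qed

lemma hln1_hexp:
  assumes "ord_gt 0 d" shows "hln1 (hexp d - 1) = d"
proof -
  have "hexp d - 1 = fps_eval d (fps_exp 1 - 1)" by (simp add: hexp_def fps_eval_diff fps_eval_1 assms)
  then have "hln1 (hexp d - 1) = fps_eval d (fps_ln 1 oo (fps_exp 1 - 1))"
    unfolding hln1_def using fps_eval_compose[OF assms, of "fps_exp 1 - 1" "fps_ln 1"] by simp
  then show ?thesis by (simp add: fps_ln_oo_exp fps_eval_X assms)
qed

lemma hexp_inj: "ord_gt 0 a \<Longrightarrow> ord_gt 0 b \<Longrightarrow> hexp a = hexp b \<Longrightarrow> a = b"
  by (metis hln1_hexp)

lemma hexp_minus: "ord_gt 0 a \<Longrightarrow> hexp (- a) * hexp a = 1"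
  using hexp_add[of "- a" a] by simp

lemma hexp_diff: "ord_gt 0 a \<Longrightarrow> ord_gt 0 b \<Longrightarrow> hexp a - hexp b = hexp b * (hexp (a - b) - 1)"
  using hexp_add[of b "a - b"] by (simp add: ord_gt_diff algebra_simps)

lemma ord_ge_hexp_diff:
  assumes "ord_gt 0 a" "ord_gt 0 b" "ord_ge e (a - b)"
  shows "ord_ge e (hexp a - hexp b)"
proof -
  have "ord_ge 0 (hexp b)" unfolding hexp_def by (rule ord_ge_fps_eval[OF assms(2)])
  then have "ord_ge (0 + e) (hexp b * (hexp (a - b) - 1))"
    by (rule ord_ge_mult) (intro ord_ge_hexp ord_gt_diff assms)
  then show ?thesis by (simp add: hexp_diff assms)
qed

lemma hln1_mult:
  assumes "ord_gt 0 a" "ord_gt 0 b" "1 + c = (1 + a) * (1 + b)"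
  shows "ord_gt 0 c" "hln1 c = hln1 a + hln1 b"
proof -
  have "c = a + b + a * b" using assms(3) by (simp add: algebra_simps)
  moreover have "ord_gt (0 + 0) (a * b)" by (rule ord_gt_mult[OF assms(1) ord_gt_imp_ord_ge[OF assms(2)]])
  ultimately show c: "ord_gt 0 c" using assms by (simp add: ord_gt_add)
  show "hln1 c = hln1 a + hln1 b"
    by (rule hexp_inj) (simp_all add: ord_gt_hln1 ord_gt_add hexp_add hexp_hln1 assms c)
qed

text \<open>The left-hand side satisfies the differential equation \<open>(1 + X) B' = a B\<close>
  of the binomial series and has constant term 1. Evaluated at an infinitesimal, this turns binomial
  series into exponentials of logarithms.\<close>

lemma fps_exp_oo_ln_scale: "fps_exp 1 oo (fps_const a * fps_ln (1::real)) = fps_binomial a"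
proof -
  let ?L = "fps_const a * fps_ln (1::real)" and ?B = "fps_exp 1 oo (fps_const a * fps_ln (1::real))"
  have z: "fps_nth ?L 0 = 0" by (simp add: fps_ln_nth_0)
  have "fps_deriv ?B = (fps_exp 1 oo ?L) * (fps_const a * inverse (1 + fps_X))"
    by (subst fps_compose_deriv[OF z]) (simp add: fps_ln_deriv)
  then have "fps_deriv ?B = fps_const a * ?B / (1 + fps_X)"
    by (simp add: fps_divide_unit mult.assoc mult.left_commute)
  then have "?B = fps_const (fps_nth ?B 0) * fps_binomial a"
    by (simp only: fps_binomial_ODE_unique)
  then show ?thesis by simp
qed

lemma fps_eval_binomial:
  assumes "ord_gt 0 d" shows "fps_eval d (fps_binomial a) = hexp (hconst a * hln1 d)"
proof -
  have "hconst a * hln1 d = fps_eval d (fps_const a * fps_ln 1)"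
    by (simp add: hln1_def fps_eval_const_mult assms)
  then show ?thesis
    unfolding hexp_def by (simp add: fps_eval_compose[OF assms, symmetric] fps_ln_nth_0 fps_exp_oo_ln_scale)
qed

text \<open>The expansion of \<open>x / (1 - x)\<close>, so that \<open>1 + fps_geo1\<close> is the
  geometric series.\<close>

definition fps_geo1 :: "real fps" where
  "fps_geo1 = Abs_fps (\<lambda>n. if n = 0 then 0 else 1)"

lemma fps_eval_geo1:
  assumes "ord_gt 0 d" shows "(1 + fps_eval d fps_geo1) * (1 - d) = 1" "ord_gt 0 (fps_eval d fps_geo1)"
proof -
  have "(1 + fps_geo1) * (1 - fps_X) = 1"
    by (rule fps_ext) (auto simp: fps_geo1_def algebra_simps fps_X_mult_nth)
  then have "fps_eval d ((1 + fps_geo1) * (1 - fps_X)) = 1" by (simp add: fps_eval_1 assms)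
  then show "(1 + fps_eval d fps_geo1) * (1 - d) = 1"
    by (simp add: fps_eval_mult fps_eval_add fps_eval_diff fps_eval_1 fps_eval_X assms)
  show "ord_gt 0 (fps_eval d fps_geo1)" by (rule ord_gt_fps_eval_0[OF assms]) (simp add: fps_geo1_def)
qed

text \<open>The series \<open>1 + fps_geo1\<close> evaluated at \<open>d\<close> is the inverse of
  \<open>1 - d\<close>, and the logarithm turns inversion into a sign.\<close>

lemma hln1_geo1:
  assumes "ord_gt 0 d" shows "hln1 (fps_eval d fps_geo1) = - hln1 (- d)"
proof -
  have "hln1 0 = hln1 (fps_eval d fps_geo1) + hln1 (- d)"
    by (rule hln1_mult(2)) (use fps_eval_geo1[OF assms] assms in simp_all)
  moreover have "hln1 0 = hln1 (0::'a hahn) + hln1 0" by (rule hln1_mult(2)) simp_all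
  ultimately show ?thesis by (simp add: eq_neg_iff_add_eq_0 add.commute)
qed

lemma ord_ge_hln1_diff:
  assumes "ord_gt 0 x" "ord_gt 0 y" "ord_ge e (x - y)"
  shows "ord_ge e (hln1 (- x) - hln1 (- y))"
proof -
  let ?g = "fps_eval y fps_geo1"
  \<comment> \<open>\<open>w\<close> is \<open>(x - y) / (1 - y)\<close>, so that
    \<open>1 - x = (1 - y) * (1 - w)\<close> and the difference of logarithms is
    \<open>hln1 (- w)\<close>.\<close>
  define w where "w = (x - y) * (1 + ?g)"
  have g: "(1 + ?g) * (1 - y) = 1" "ord_gt 0 ?g" using fps_eval_geo1[OF assms(2)] by auto
  have g0: "ord_ge 0 (1 + ?g)" by (intro ord_ge_add ord_ge_one ord_gt_imp_ord_ge g)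
  have w: "ord_ge e w" using ord_ge_mult[OF assms(3) g0] by (simp add: w_def)
  have w0: "ord_gt 0 w" using ord_gt_mult[OF ord_gt_diff[OF assms(1,2)] g0] by (simp add: w_def)
  have "(1 - y) * (1 - w) = (1 - y) - (x - y) * ((1 + ?g) * (1 - y))"
    by (simp add: w_def algebra_simps)
  then have "1 + - x = (1 + - y) * (1 + - w)" unfolding g by simp
  then have "hln1 (- x) = hln1 (- y) + hln1 (- w)" by (rule hln1_mult(2)[rotated 2]) (simp_all add: assms w0)
  then show ?thesis using ord_ge_hln1[of "- w" e] w w0 by simp
qed

section \<open>Substitutions\<close>

definition msub :: "('g \<Rightarrow> real) \<Rightarrow> ('g \<Rightarrow> 'g hahn) \<Rightarrow> 'g \<Rightarrow> 'g::linordered_ab_group_add hahn" where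
  "msub c th e = hmono (c e) e * hexp (th e)"

definition hsubst :: "('g \<Rightarrow> real) \<Rightarrow> ('g \<Rightarrow> 'g hahn) \<Rightarrow> 'g hahn \<Rightarrow> 'g::linordered_ab_group_add hahn" where
  "hsubst c th f = hsum (\<lambda>e. hconst (coeff f e) * msub c th e)"

text \<open>The supports of all \<open>th e\<close> lie in one set \<open>S\<close> independent of
  \<open>e\<close>. By Neumann's lemma all \<open>hexp (th e)\<close> are then supported in the
  single well-ordered set \<open>generated S\<close>, and this uniformity makes the images of the
  monomials of a series summable. The rules \<open>c_add\<close> and \<open>th_add\<close> make
  substitution multiplicative.\<close>

locale substitution =
  fixes c :: "'g::linordered_ab_group_add \<Rightarrow> real" and th :: "'g \<Rightarrow> 'g hahn" and S :: "'g set"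
  assumes c_0: "c 0 = 1" and c_add: "c (a + b) = c a * c b"
    and th_add: "th (a + b) = th a + th b"
    and well_ordered_S: "well_ordered S" and S_pos: "s \<in> S \<Longrightarrow> 0 < s" and supp_th: "supp (th e) \<subseteq> S"
begin

abbreviation "m \<equiv> msub c th"
abbreviation "C \<equiv> hsubst c th"

lemma ord_gt_th: "ord_gt 0 (th e)"
  using supp_th S_pos unfolding ord_gt_def by blast

lemma th_0: "th 0 = 0"
  using th_add[of 0 0] by simp

lemma m_0: "m 0 = 1"
  by (simp add: msub_def c_0 th_0 hmono_one_zero)

lemma m_add: "m (a + b) = m a * m b"
proof -
  have "m a * m b = (hmono (c a) a * hmono (c b) b) * (hexp (th a) * hexp (th b))"
    by (simp add: msub_def ac_simps)
  then show ?thesis by (simp add: msub_def hmono_mult c_add th_add hexp_add ord_gt_th)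
qed

lemma supp_m: "supp (m e) \<subseteq> sumset {e} (generated S)"
  unfolding msub_def hexp_def
  by (rule order_trans[OF supp_times sumset_mono[OF supp_hmono supp_fps_eval[OF ord_gt_th supp_th]]])

lemma ord_ge_m: "ord_ge e (m e)"
  using ord_ge_mult[OF ord_ge_hmono[of e "c e"] ord_ge_fps_eval[OF ord_gt_th[of e], of "fps_exp 1"]]
  by (simp add: msub_def hexp_def)

lemma coeff_m: "coeff (m e) e = c e"
proof -
  have "coeff (hexp (th e)) 0 = 1"
    using ord_gtD[OF ord_gt_hexp[OF ord_gt_th[of e]], of 0] by (simp add: coeff_one)
  then show ?thesis
    using coeff_hmono_times[of "c e" e "hexp (th e)" e] by (simp add: msub_def)
qed

text \<open>A contribution to the exponent \<open>x\<close> comes from some \<open>e\<close> in the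
  union of the supports with \<open>x - e\<close> in \<open>generated S\<close>: finitely many
  \<open>e\<close>, and for each of them finitely many \<open>i\<close>. Indexing by
  \<open>i\<close> and \<open>e\<close> together gives linearity over infinite sums by exchanging
  summations.\<close>

lemma family_summable:
  assumes "hsummable F"
  shows "hsummable (\<lambda>(i, e). hconst (coeff (F i) e) * m e)"
proof (rule hsummableI)
  let ?W = "\<Union>i. supp (F i)"
  have W: "well_ordered ?W" by (rule hsummable_well_ordered[OF assms])
  have G: "well_ordered (generated S)" by (rule well_ordered_generated[OF well_ordered_S S_pos])
  have sub: "x - e \<in> generated S" if "coeff (m e) x \<noteq> 0" for x e
    using supp_m[of e] that by (force simp: supp_def sumset_def)
  show "finite {p. coeff (case p of (i, e) \<Rightarrow> hconst (coeff (F i) e) * m e) x \<noteq> 0}" for x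
  proof (rule finite_subset)
    show "{p. coeff (case p of (i, e) \<Rightarrow> hconst (coeff (F i) e) * m e) x \<noteq> 0}
      \<subseteq> (\<Union>e\<in>{e \<in> ?W. x - e \<in> generated S}. {i. coeff (F i) e \<noteq> 0} \<times> {e})"
      using sub by (auto simp: supp_iff)
    show "finite (\<Union>e\<in>{e \<in> ?W. x - e \<in> generated S}. {i. coeff (F i) e \<noteq> 0} \<times> {e})"
      using well_ordered_fibre_finite[OF W G, of x] hsummable_finite[OF assms] by auto
  qed
  show "well_ordered (sumset ?W (generated S))" by (rule well_ordered_sumset[OF W G])
  show "supp (case p of (i, e) \<Rightarrow> hconst (coeff (F i) e) * m e) \<subseteq> sumset ?W (generated S)" for p
  proof
    fix x assume x: "x \<in> supp (case p of (i, e) \<Rightarrow> hconst (coeff (F i) e) * m e)"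
    obtain i e where p: "p = (i, e)" by (cases p)
    have "e \<in> ?W" "coeff (m e) x \<noteq> 0" using x by (auto simp: p supp_iff)
    then have "e + (x - e) \<in> sumset ?W (generated S)" by (intro sumsetI sub)
    then show "x \<in> sumset ?W (generated S)" by simp
  qed
qed

lemma C_summable: "hsummable (\<lambda>e. hconst (coeff f e) * m e)"
proof -
  have "hsummable (\<lambda>_::unit. f)" by (rule hsum_finite_sum(1)[of UNIV]) simp_all
  from hsum_Fubini(1)[OF family_summable[OF this]] show ?thesis .
qed

lemma C_hsum:
  assumes "hsummable F"
  shows "hsummable (\<lambda>i. C (F i))" "C (hsum F) = hsum (\<lambda>i. C (F i))"
proof -
  note s = family_summable[OF assms]
  show "hsummable (\<lambda>i. C (F i))" using hsum_Fubini(2)[OF s] by (simp add: hsubst_def)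
  have "hsum (\<lambda>i. hconst (coeff (F i) e) * m e) = hconst (coeff (hsum F) e) * m e" for e
  proof -
    have "hsum (\<lambda>i. hconst (coeff (F i) e) * m e) = (\<Sum>i\<in>{i. coeff (F i) e \<noteq> 0}. hconst (coeff (F i) e) * m e)"
      by (rule hsum_finite_sum(2)) (simp_all add: hsummable_finite[OF assms])
    also have "\<dots> = hconst (coeff (hsum F) e) * m e"
      by (simp add: coeff_hsum[OF assms] Sum_any.expand_set hconst_sum sum_distrib_right)
    finally show ?thesis .
  qed
  then show "C (hsum F) = hsum (\<lambda>i. C (F i))"
    unfolding hsubst_def using hsum_swap[OF s] by simp
qed

lemma C_hmono: "C (hmono a e) = hconst a * m e"
  unfolding hsubst_def by (subst hsum_finite_sum[of "{e}"]) (auto simp: coeff_hmono)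

lemma C_hconst: "C (hconst a) = hconst a"
  using C_hmono[of a 0] by (simp add: hconst_def[symmetric] m_0)

lemma C_1: "C 1 = 1"
  using C_hconst[of 1] by simp

lemma C_0: "C 0 = 0"
  using C_hconst[of 0] by simp

lemma C_add: "C (f + g) = C f + C g"
  unfolding hsubst_def
  by (simp add: hsum_add(2)[OF C_summable C_summable, symmetric] hconst_add distrib_right)

lemma C_mult: "C (f * g) = C f * C g"
proof -
  note e = hsum_expansion
  have "f * g = hsum (\<lambda>(a, b). hmono (coeff f a) a * hmono (coeff g b) b)"
    by (simp add: hsum_product(2)[OF e(1) e(1)] e(2))
  then have "C (f * g) = hsum (\<lambda>p. C (case p of (a, b) \<Rightarrow> hmono (coeff f a) a * hmono (coeff g b) b))"
    by (simp only: C_hsum(2)[OF hsum_product(1)[OF e(1) e(1)]])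
  also have "\<dots> = hsum (\<lambda>(a, b). (hconst (coeff f a) * m a) * (hconst (coeff g b) * m b))"
    by (rule arg_cong[where f = hsum]) (auto simp: hmono_mult C_hmono hconst_mult m_add ac_simps)
  also have "\<dots> = C f * C g"
    unfolding hsubst_def by (rule hsum_product(2)[OF C_summable C_summable])
  finally show ?thesis .
qed

lemma C_uminus: "C (- f) = - C f"
  using C_add[of f "- f"] minus_unique[of "C f" "C (- f)"] by (simp add: C_0)

lemma C_diff: "C (f - g) = C f - C g"
  using C_add[of f "- g"] by (simp add: C_uminus)

lemma C_power: "C (f ^ n) = C f ^ n"
  by (induction n) (simp_all add: C_1 C_mult)

lemma C_sum: "C (sum F A) = (\<Sum>i\<in>A. C (F i))"
  by (induction A rule: infinite_finite_induct) (simp_all add: C_0 C_add)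

lemma ord_ge_C:
  assumes "ord_ge e f" shows "ord_ge e (C f)"
  unfolding hsubst_def
proof (rule ord_ge_hsum[OF C_summable])
  fix x show "ord_ge e (hconst (coeff f x) * m x)"
  proof (cases "e \<le> x")
    case True
    then show ?thesis by (intro ord_ge_hconst_times ord_ge_trans[OF ord_ge_m])
  qed (simp add: ord_geD[OF assms])
qed

lemma coeff_C_lead:
  assumes "ord_ge e f" shows "coeff (C f) e = c e * coeff f e"
proof -
  have "coeff (C f) e = sum (\<lambda>x. coeff f x * coeff (m x) e) {e}"
    unfolding hsubst_def coeff_hsum[OF C_summable] coeff_hconst_times
  proof (rule Sum_any_mono_neutral)
    fix x assume "x \<notin> {e}"
    then consider "x < e" | "e < x" by fastforce
    then show "coeff f x * coeff (m x) e = 0"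
      by cases (simp_all add: ord_geD[OF assms] ord_geD[OF ord_ge_m])
  qed simp
  then show ?thesis by (simp add: coeff_m)
qed

lemma ord_gt_C: "ord_gt e f \<Longrightarrow> ord_gt e (C f)"
  by (simp add: ord_gt_iff ord_ge_C coeff_C_lead)

lemma C_fps_eval:
  assumes "ord_gt 0 d" shows "C (fps_eval d F) = fps_eval (C d) F"
  unfolding fps_eval_def C_hsum(2)[OF fps_eval_summable[OF assms]] by (simp add: C_mult C_hconst C_power)

lemma C_hexp: "ord_gt 0 d \<Longrightarrow> C (hexp d) = hexp (C d)"
  unfolding hexp_def by (rule C_fps_eval)

lemma C_hln1: "ord_gt 0 d \<Longrightarrow> C (hln1 d) = hln1 (C d)"
  unfolding hln1_def by (rule C_fps_eval)

lemma supp_C: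
  assumes "\<And>e. e \<in> supp f \<Longrightarrow> supp (m e) \<subseteq> Z" shows "supp (C f) \<subseteq> Z"
proof -
  have "supp (hconst (coeff f e) * m e) \<subseteq> Z" for e
    using assms[of e] supp_hconst_times[of "coeff f e" "m e"] by (cases "e \<in> supp f") (auto simp: supp_iff)
  then show ?thesis unfolding hsubst_def using supp_hsum[OF C_summable[of f]] by blast
qed

end

section \<open>Solving equations by leading terms\<close>

text \<open>A series \<open>u\<close> is an approximate solution if every term of \<open>u\<close> is forced, i.e. if the
  residual \<open>Q u\<close> lies strictly above \<open>\<sigma> e\<close> for each \<open>e\<close> in the support. Approximate solutions form
  a chain under truncation, and their union is an exact solution.\<close>

locale triangular =
  fixes Q :: "'g::linordered_ab_group_add hahn \<Rightarrow> 'g hahn" and \<sigma> :: "'g \<Rightarrow> 'g" and d :: "'g \<Rightarrow> real"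
    and Y :: "'g set"
  assumes Q_diff: "supp u \<subseteq> Y \<Longrightarrow> supp v \<subseteq> Y \<Longrightarrow> ord_ge e (u - v) \<Longrightarrow> coeff (u - v) e \<noteq> 0 \<Longrightarrow>
      ord_ge (\<sigma> e) (Q u - Q v) \<and> coeff (Q u - Q v) (\<sigma> e) = d e * coeff (u - v) e"
    and d_nonzero: "e \<in> Y \<Longrightarrow> d e \<noteq> 0"
    and \<sigma>_mono: "e \<in> Y \<Longrightarrow> e' \<in> Y \<Longrightarrow> e < e' \<Longrightarrow> \<sigma> e < \<sigma> e'"
begin

lemma \<sigma>_mono_le: "e \<in> Y \<Longrightarrow> e' \<in> Y \<Longrightarrow> e \<le> e' \<Longrightarrow> \<sigma> e \<le> \<sigma> e'"
  using \<sigma>_mono[of e e'] by (auto simp: le_less)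

lemma supp_Y_diff: "supp u \<subseteq> Y \<Longrightarrow> supp v \<subseteq> Y \<Longrightarrow> coeff (u - v) e \<noteq> 0 \<Longrightarrow> e \<in> Y"
  using supp_minus[of u v] by (auto simp: supp_iff)

lemma unique_solution:
  assumes "supp u \<subseteq> Y" "supp v \<subseteq> Y" "Q u = 0" "Q v = 0"
  shows "u = v"
proof (rule ccontr)
  assume "u \<noteq> v"
  then have "u - v \<noteq> 0" by simp
  then obtain e where e: "ord_ge e (u - v)" "coeff (u - v) e \<noteq> 0" by (rule lead_exists)
  have "d e * coeff (u - v) e = 0" using Q_diff[OF assms(1,2) e] assms(3,4) by simp
  then show False using d_nonzero[OF supp_Y_diff[OF assms(1,2) e(2)]] e(2) by (metis mult_eq_0_iff)
qed

section \<open>Gluing approximate solutions\<close>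

definition approx :: "'g hahn set" where
  "approx = {u. supp u \<subseteq> Y \<and> (\<forall>e\<in>supp u. ord_gt (\<sigma> e) (Q u))}"

text \<open>At \<open>\<sigma> e\<close> the residuals must differ, yet \<open>Q u\<close> vanishes
  there because \<open>e\<close> is in the support of \<open>u\<close>, and \<open>Q v\<close> would
  vanish too if \<open>v\<close> had a term at or beyond \<open>e\<close>. So \<open>v\<close> stops
  before the first difference and is a truncation of \<open>u\<close>.\<close>

lemma approx_truncation:
  assumes u: "u \<in> approx" and v: "v \<in> approx" and e: "ord_ge e (u - v)" "coeff (u - v) e \<noteq> 0"
    and eu: "e \<in> supp u" and x: "x \<in> supp v"
  shows "x < e"
proof (rule ccontr)
  assume "\<not> x < e"
  have Yu: "supp u \<subseteq> Y" and Yv: "supp v \<subseteq> Y" using u v by (auto simp: approx_def)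
  have eY: "e \<in> Y" "x \<in> Y" using eu x Yu Yv by auto
  have "coeff (Q u - Q v) (\<sigma> e) \<noteq> 0" using Q_diff[OF Yu Yv e] d_nonzero[OF eY(1)] e(2) by simp
  moreover have "coeff (Q u) (\<sigma> e) = 0" using u eu ord_gtD[of "\<sigma> e" "Q u"] by (auto simp: approx_def)
  moreover have "ord_gt (\<sigma> x) (Q v)" using v x by (auto simp: approx_def)
  then have "coeff (Q v) (\<sigma> e) = 0" by (rule ord_gtD) (use \<sigma>_mono_le[OF eY] \<open>\<not> x < e\<close> in simp)
  ultimately show False by simp
qed

text \<open>Whichever of the two series has a term at the first difference \<open>e\<close>, the
  other one lies entirely before \<open>e\<close>; since \<open>s <= t\<close>, both cases give
  \<open>s < e\<close>. This makes the choice in \<open>glue\<close> immaterial.\<close>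

lemma approx_agree:
  assumes u: "u \<in> approx" and v: "v \<in> approx" and "t \<in> supp u" "s \<in> supp v" "s \<le> t"
  shows "coeff u s = coeff v s"
proof (cases "u = v")
  case False
  then have "u - v \<noteq> 0" by simp
  then obtain e where e: "ord_ge e (u - v)" "coeff (u - v) e \<noteq> 0" by (rule lead_exists)
  have "v - u = - (u - v)" by simp
  then have e': "ord_ge e (v - u)" "coeff (v - u) e \<noteq> 0" using e by (metis ord_ge_uminus, simp)
  have "s < e"
  proof (cases "e \<in> supp u")
    case True
    then show ?thesis by (rule approx_truncation[OF u v e _ \<open>s \<in> supp v\<close>])
  next
    case False
    then have "e \<in> supp v" using e(2) by (simp add: supp_iff)
    then have "t < e" by (rule approx_truncation[OF v u e' _ \<open>t \<in> supp u\<close>])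
    then show ?thesis using \<open>s \<le> t\<close> by simp
  qed
  then show ?thesis using ord_geD[OF e(1), of s] by simp
qed simp

definition glue :: "'g hahn" where
  "glue = Hahn (\<lambda>x. if \<exists>u\<in>approx. coeff u x \<noteq> 0
     then coeff (SOME u. u \<in> approx \<and> coeff u x \<noteq> 0) x else 0)"

lemma coeff_glue:
  "coeff glue x = (if \<exists>u\<in>approx. coeff u x \<noteq> 0
     then coeff (SOME u. u \<in> approx \<and> coeff u x \<noteq> 0) x else 0)"
proof -
  let ?f = "\<lambda>x. if \<exists>u\<in>approx. coeff u x \<noteq> 0
     then coeff (SOME u. u \<in> approx \<and> coeff u x \<noteq> 0) x else 0"
  have nz: "\<exists>u\<in>approx. x \<in> supp u" if "?f x \<noteq> 0" for x
    using that by (auto simp: supp_iff split: if_splits)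
  have "well_ordered {x. ?f x \<noteq> 0}"
    unfolding well_ordered_def
  proof (intro allI impI)
    fix T assume T: "T \<subseteq> {x. ?f x \<noteq> 0}" "T \<noteq> {}"
    obtain t where t: "t \<in> T" using T(2) by blast
    obtain u where u: "u \<in> approx" "t \<in> supp u" using nz t T(1) by blast
    \<comment> \<open>Up to \<open>t\<close>, nothing of the glued support lies outside the support
      of the single series \<open>u\<close>, so a minimum of \<open>T\<close> can be sought in a
      well-ordered set.\<close>
    have "T \<inter> {..t} \<subseteq> supp u"
    proof
      fix s assume s: "s \<in> T \<inter> {..t}"
      then obtain v where v: "v \<in> approx" "s \<in> supp v" using nz T(1) by blast
      then show "s \<in> supp u" using approx_agree[OF u(1) v(1) u(2) v(2)] s by (simp add: supp_iff)
    qed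
    moreover have "T \<inter> {..t} \<noteq> {}" using t by blast
    ultimately have "\<exists>x\<in>T \<inter> {..t}. \<forall>y\<in>T \<inter> {..t}. x \<le> y" by (rule well_orderedD[OF well_ordered_supp])
    then obtain x where x: "x \<in> T \<inter> {..t}" "\<forall>y\<in>T \<inter> {..t}. x \<le> y" by blast
    have "x \<le> y" if "y \<in> T" for y
      using x that by (cases "y \<le> t") auto
    then show "\<exists>x\<in>T. \<forall>y\<in>T. x \<le> y" using x(1) by blast
  qed
  then show ?thesis unfolding glue_def by (simp add: coeff_Hahn)
qed

lemma coeff_glue_eq:
  assumes "u \<in> approx" "x \<in> supp u" shows "coeff glue x = coeff u x"
proof -
  let ?v = "SOME u. u \<in> approx \<and> coeff u x \<noteq> 0"
  have "?v \<in> approx \<and> coeff ?v x \<noteq> 0" by (rule someI[of _ u]) (use assms in \<open>simp add: supp_iff\<close>)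
  then have "coeff u x = coeff ?v x"
    using approx_agree[OF assms(1) _ assms(2), of ?v x] by (simp add: supp_iff)
  moreover have "\<exists>u\<in>approx. coeff u x \<noteq> 0" using assms by (auto simp: supp_iff)
  ultimately show ?thesis by (simp add: coeff_glue)
qed

lemma supp_glue:
  assumes "x \<in> supp glue" shows "\<exists>u\<in>approx. x \<in> supp u"
  using assms by (auto simp: supp_iff coeff_glue split: if_splits)

text \<open>Up to a support point \<open>t\<close>, \<open>glue\<close> coincides with an
  approximate solution, so by strict monotonicity of \<open>\<sigma>\<close> the two residuals agree
  up to \<open>\<sigma> t\<close>.\<close>

lemma glue_approx: "glue \<in> approx"
proof -
  have sub: "supp glue \<subseteq> Y" using supp_glue by (fastforce simp: approx_def)
  have "ord_gt (\<sigma> t) (Q glue)" if t: "t \<in> supp glue" for t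
  proof -
    obtain u where u: "u \<in> approx" "t \<in> supp u" using supp_glue[OF t] by blast
    have Yu: "supp u \<subseteq> Y" and su: "ord_gt (\<sigma> t) (Q u)" using u by (auto simp: approx_def)
    have agree: "coeff (glue - u) s = 0" if "s \<le> t" for s
    proof (cases "s \<in> supp glue")
      case True
      then obtain v where v: "v \<in> approx" "s \<in> supp v" using supp_glue by blast
      then show ?thesis using approx_agree[OF u(1) v(1) u(2) v(2) that] coeff_glue_eq[OF v] by simp
    next
      case False
      then have "coeff u s = 0" using coeff_glue_eq[OF u(1), of s] by (auto simp: supp_iff)
      then show ?thesis using False by (simp add: supp_iff)
    qed
    show ?thesis
    proof (cases "glue = u")
      case False
      then have "glue - u \<noteq> 0" by simp
      then obtain e where e: "ord_ge e (glue - u)" "coeff (glue - u) e \<noteq> 0" by (rule lead_exists)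
      have "t < e" using agree[of e] e(2) by force
      moreover have "e \<in> Y" by (rule supp_Y_diff[OF sub Yu e(2)])
      ultimately have "\<sigma> t < \<sigma> e" using \<sigma>_mono[of t e] u(2) Yu by blast
      then have "ord_gt (\<sigma> t) (Q glue - Q u)" using Q_diff[OF sub Yu e] ord_ge_imp_ord_gt by blast
      then show ?thesis using ord_gt_add[OF _ su, of "Q glue - Q u"] by simp
    qed (use su in simp)
  qed
  then show ?thesis using sub by (simp add: approx_def)
qed

text \<open>A nonzero residual of \<open>glue\<close> has its leading exponent at some
  \<open>\<sigma> e\<close>, with \<open>e\<close> beyond the support of \<open>glue\<close>.
  Cancelling that term gives a longer approximate solution, whose new term \<open>glue\<close> would
  already have to contain.\<close>

lemma solution_exists:
  assumes img: "\<And>u v. supp u \<subseteq> Y \<Longrightarrow> ord_ge v (Q u) \<Longrightarrow> coeff (Q u) v \<noteq> 0 \<Longrightarrow> v \<in> \<sigma> ` Y"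
  shows "\<exists>u. supp u \<subseteq> Y \<and> Q u = 0"
proof (rule exI[of _ glue], rule conjI)
  show sub: "supp glue \<subseteq> Y" using glue_approx by (simp add: approx_def)
  show "Q glue = 0"
  proof (rule ccontr)
    assume "Q glue \<noteq> 0"
    then obtain v where v: "ord_ge v (Q glue)" "coeff (Q glue) v \<noteq> 0" by (rule lead_exists)
    then obtain e where e: "e \<in> Y" "v = \<sigma> e" using img[OF sub] by blast
    have lt: "t < e" if "t \<in> supp glue" for t
    proof (rule ccontr)
      assume "\<not> t < e"
      then have "\<sigma> e \<le> \<sigma> t" using \<sigma>_mono_le[of e t] e(1) that sub by auto
      moreover have "ord_gt (\<sigma> t) (Q glue)" using glue_approx that by (simp add: approx_def)
      ultimately show False using ord_gtD v(2) e(2) by blast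
    qed
    \<comment> \<open>The term \<open>- a\<close> at \<open>e\<close> changes the residual at
      \<open>\<sigma> e\<close> by \<open>- d e * a\<close>, which cancels its leading
      coefficient.\<close>
    define a where "a = coeff (Q glue) v / d e"
    define w where "w = glue - hmono a e"
    have "a \<noteq> 0" using v(2) d_nonzero[OF e(1)] by (simp add: a_def)
    have supw: "supp w \<subseteq> insert e (supp glue)"
      unfolding w_def using supp_minus[of glue "hmono a e"] supp_hmono[of a e] by blast
    have Yw: "supp w \<subseteq> Y" using supw sub e(1) by blast
    have "w - glue = - hmono a e" by (simp add: w_def)
    then have "ord_ge e (w - glue)" "coeff (w - glue) e = - a" by (simp_all add: ord_ge_hmono coeff_hmono)
    then have "ord_ge (\<sigma> e) (Q w - Q glue)" "coeff (Q w - Q glue) (\<sigma> e) = - coeff (Q glue) v"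
      using Q_diff[OF Yw sub, of e] \<open>a \<noteq> 0\<close> d_nonzero[OF e(1)] by (auto simp: a_def)
    then have "ord_ge (\<sigma> e) (Q w)" "coeff (Q w) (\<sigma> e) = 0"
      using ord_ge_add[of "\<sigma> e" "Q w - Q glue" "Q glue"] v(1) e(2) by auto
    then have sw: "ord_gt (\<sigma> e) (Q w)" by (simp add: ord_gt_iff)
    have "ord_gt (\<sigma> x) (Q w)" if "x \<in> supp w" for x
    proof -
      have "x \<in> Y" "x \<le> e" using supw that lt Yw by (auto simp: less_imp_le)
      then have "\<sigma> x \<le> \<sigma> e" using \<sigma>_mono_le e(1) by blast
      then show ?thesis using sw unfolding ord_gt_def by (meson le_less_trans)
    qed
    then have "w \<in> approx" using Yw by (simp add: approx_def)
    moreover have "coeff glue e = 0" using lt[of e] by (auto simp: supp_iff)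
    then have "e \<in> supp w" using \<open>a \<noteq> 0\<close> by (simp add: w_def supp_iff coeff_hmono)
    ultimately have "coeff glue e = coeff w e" by (rule coeff_glue_eq)
    then show False using \<open>a \<noteq> 0\<close> by (simp add: w_def coeff_hmono)
  qed
qed

end

section \<open>The exponent group\<close>

text \<open>A copy of the exponent type, since the product and function types
  already carry other orders.\<close>

typedef lexp = "UNIV :: expo set"
  morphisms expo_of Lexp ..

lemmas Lexp_inverse' [simp] = Lexp_inverse[OF UNIV_I]
declare expo_of_inverse [simp]

lemma seq_less_irrefl: "\<not> seq_less n n"
  by (simp add: seq_less_def)

lemma seq_less_trans:
  assumes "seq_less a b" "seq_less b c" shows "seq_less a c"
proof -
  obtain j where j: "a j < b j" "\<forall>i<j. a i = b i" using assms(1) by (auto simp: seq_less_def)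
  obtain l where l: "b l < c l" "\<forall>i<l. b i = c i" using assms(2) by (auto simp: seq_less_def)
  have "a (min j l) < c (min j l)" using j l by (cases j l rule: linorder_cases) (auto simp: min_def)
  moreover have "\<forall>i<min j l. a i = c i" using j l by simp
  ultimately show ?thesis unfolding seq_less_def by blast
qed

lemma seq_less_total:
  assumes "a \<noteq> b" shows "seq_less a b \<or> seq_less b a"
proof -
  have ex: "\<exists>i. a i \<noteq> b i" using assms by auto
  define j where "j = (LEAST i. a i \<noteq> b i)"
  have "a j \<noteq> b j" unfolding j_def by (rule LeastI_ex[OF ex])
  moreover have "\<forall>i<j. a i = b i" unfolding j_def using not_less_Least by blast
  ultimately show ?thesis unfolding seq_less_def by (metis linorder_neqE)
qed

instantiation lexp :: linordered_ab_group_add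
begin
definition zero_lexp :: lexp where "zero_lexp = Lexp zero_exp"
definition plus_lexp :: "lexp \<Rightarrow> lexp \<Rightarrow> lexp" where
  "plus_lexp x y = Lexp (eadd (expo_of x) (expo_of y))"
definition uminus_lexp :: "lexp \<Rightarrow> lexp" where
  "uminus_lexp x = Lexp (- fst (expo_of x), \<lambda>i. - snd (expo_of x) i)"
definition minus_lexp :: "lexp \<Rightarrow> lexp \<Rightarrow> lexp" where
  "minus_lexp x y = x + - y"
definition less_eq_lexp :: "lexp \<Rightarrow> lexp \<Rightarrow> bool" where
  "less_eq_lexp x y \<longleftrightarrow> lex_le (expo_of x) (expo_of y)"
definition less_lexp :: "lexp \<Rightarrow> lexp \<Rightarrow> bool" where
  "less_lexp x y \<longleftrightarrow> lex_less (expo_of x) (expo_of y)"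
instance
proof
  fix a b c :: lexp
  have irrefl: "\<not> lex_less x x" for x by (simp add: lex_less_def seq_less_irrefl)
  have trans: "lex_less x y \<Longrightarrow> lex_less y z \<Longrightarrow> lex_less x z" for x y z
    using seq_less_trans[of "snd x" "snd y" "snd z"] by (auto simp: lex_less_def)
  have total: "lex_less x y \<or> x = y \<or> lex_less y x" for x y
    using seq_less_total[of "snd x" "snd y"] by (auto simp: lex_less_def prod_eq_iff)
  show "a + b + c = a + (b + c)" "a + b = b + a" "0 + a = a" "- a + a = 0" "a - b = a + - b"
    by (simp_all add: plus_lexp_def zero_lexp_def uminus_lexp_def minus_lexp_def eadd_def zero_exp_def algebra_simps)
  show "(a < b) = (a \<le> b \<and> \<not> b \<le> a)"
    unfolding less_lexp_def less_eq_lexp_def lex_le_def using irrefl trans by metis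
  show "a \<le> a" by (simp add: less_eq_lexp_def lex_le_def)
  show "a \<le> b \<Longrightarrow> b \<le> c \<Longrightarrow> a \<le> c"
    unfolding less_eq_lexp_def lex_le_def using trans by metis
  show "a \<le> b \<Longrightarrow> b \<le> a \<Longrightarrow> a = b"
    unfolding less_eq_lexp_def lex_le_def using trans irrefl by (metis expo_of_inverse)
  show "a \<le> b \<or> b \<le> a"
    unfolding less_eq_lexp_def lex_le_def using total[of "expo_of a" "expo_of b"] by metis
  show "a \<le> b \<Longrightarrow> c + a \<le> c + b"
    by (auto simp: less_eq_lexp_def lex_le_def lex_less_def plus_lexp_def eadd_def seq_less_def)
qed
end

definition zdeg :: "lexp \<Rightarrow> real" where "zdeg x = fst (expo_of x)"
definition ldeg :: "lexp \<Rightarrow> nat \<Rightarrow> int" where "ldeg x = snd (expo_of x)"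

lemma zdeg_simps [simp]: "zdeg (x + y) = zdeg x + zdeg y" "zdeg 0 = 0" "zdeg (- x) = - zdeg x" "zdeg (x - y) = zdeg x - zdeg y"
  by (simp_all add: zdeg_def plus_lexp_def zero_lexp_def uminus_lexp_def minus_lexp_def eadd_def zero_exp_def)

lemma ldeg_simps [simp]: "ldeg (x + y) i = ldeg x i + ldeg y i" "ldeg 0 i = 0" "ldeg (- x) i = - ldeg x i"
  "ldeg (x - y) i = ldeg x i - ldeg y i"
  by (simp_all add: ldeg_def plus_lexp_def zero_lexp_def uminus_lexp_def minus_lexp_def eadd_def zero_exp_def)

lemma zdeg_ldeg_Lexp [simp]: "zdeg (Lexp e) = fst e" "ldeg (Lexp e) = snd e"
  by (simp_all add: zdeg_def ldeg_def)

lemma lexp_eqI: "zdeg x = zdeg y \<Longrightarrow> (\<And>i. ldeg x i = ldeg y i) \<Longrightarrow> x = y"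
  by (metis zdeg_def expo_of_inverse ext ldeg_def prod_eqI)

lemma less_lexp_iff:
  "x < y \<longleftrightarrow> zdeg x < zdeg y \<or> zdeg x = zdeg y \<and> (\<exists>j. ldeg x j < ldeg y j \<and> (\<forall>i<j. ldeg x i = ldeg y i))"
  by (simp add: less_lexp_def lex_less_def seq_less_def zdeg_def ldeg_def)

lemma less_lexpI: "zdeg x = zdeg y \<Longrightarrow> ldeg x j < ldeg y j \<Longrightarrow> (\<And>i. i < j \<Longrightarrow> ldeg x i = ldeg y i) \<Longrightarrow> x < y"
  unfolding less_lexp_iff by blast

definition z_lexp :: lexp where "z_lexp = Lexp z_exp"
definition ell_lexp :: "nat \<Rightarrow> lexp" where "ell_lexp j = Lexp (ell_exp j)"
definition ones :: "nat \<Rightarrow> lexp" where "ones j = Lexp (0, \<lambda>i. if i < j then 1 else 0)"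

lemma zdeg_consts [simp]: "zdeg z_lexp = 1" "zdeg (ell_lexp j) = 0" "zdeg (ones j) = 0"
  by (simp_all add: z_lexp_def ell_lexp_def ones_def z_exp_def ell_exp_def)

lemma ldeg_consts [simp]: "ldeg z_lexp i = 0" "ldeg (ell_lexp (Suc j)) i = (if i = j then 1 else 0)"
  "ldeg (ones j) i = (if i < j then 1 else 0)"
  by (simp_all add: z_lexp_def ell_lexp_def ones_def z_exp_def ell_exp_def)

lemma ones_0: "ones 0 = 0"
  by (rule lexp_eqI) simp_all

lemma ones_Suc: "ones (Suc j) = ell_lexp (Suc j) + ones j"
  by (rule lexp_eqI) simp_all

lemma ell_lexp_pos: "0 < ell_lexp (Suc j)"
  by (rule less_lexpI[of _ _ j]) simp_all

lemma ones_pos: "0 < ones (Suc j)"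
  by (rule less_lexpI[of _ _ 0]) simp_all

lemma ones_mono: "i \<le> j \<Longrightarrow> ones i \<le> ones j"
proof (induction j)
  case (Suc j)
  have "ones j \<le> ones (Suc j)" unfolding ones_Suc using ell_lexp_pos[of j] by (simp add: less_imp_le)
  then show ?case using Suc by (metis le_Suc_eq order_refl order_trans)
qed simp

text \<open>The substitution by a hyperbolic series, minus the identity, multiplies the order of a monomial
  with exponent \<open>e > 0\<close> by the monomial with exponent \<open>shift e\<close>.\<close>

definition shift :: "lexp \<Rightarrow> lexp" where
  "shift e = (if zdeg e \<noteq> 0 then 0 else ones (Suc (LEAST i. ldeg e i \<noteq> 0)))"

lemma shift_eqI: "zdeg e = 0 \<Longrightarrow> ldeg e j \<noteq> 0 \<Longrightarrow> (\<And>i. i < j \<Longrightarrow> ldeg e i = 0) \<Longrightarrow> shift e = ones (Suc j)"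
  using Least_equality[of "\<lambda>i. ldeg e i \<noteq> 0" j] by (auto simp: shift_def not_less[symmetric])

lemma pos_lexp_cases:
  assumes "0 < e"
  obtains "0 < zdeg e" "shift e = 0"
  | j where "zdeg e = 0" "0 < ldeg e j" "\<And>i. i < j \<Longrightarrow> ldeg e i = 0" "shift e = ones (Suc j)"
proof (cases "zdeg e = 0")
  case True
  then obtain j where "0 < ldeg e j" "\<forall>i<j. ldeg e i = 0" using assms by (auto simp: less_lexp_iff)
  then show ?thesis using that(2)[of j] shift_eqI[of e j] True by simp
next
  case False
  then show ?thesis using assms that(1) by (auto simp: less_lexp_iff shift_def)
qed

text \<open>Let \<open>j\<close> and \<open>j'\<close> be the first nonzero positions when both
  z-degrees vanish. Then \<open>e < e'\<close> forces \<open>j' <= j\<close>, and for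
  \<open>j' < j\<close> the larger exponent ends up with at least 2 at position \<open>j'\<close>,
  the smaller one with exactly 1. Hence the leading terms that different monomials produce cannot
  cancel.\<close>

lemma add_shift_mono:
  assumes "0 < e" "e < e'" shows "e + shift e < e' + shift e'"
proof -
  have "0 < e'" using assms by (rule less_trans)
  show ?thesis
  proof (cases rule: pos_lexp_cases[OF assms(1)])
    case 1
    then have "shift e' = 0" using assms(2) by (auto simp: shift_def less_lexp_iff)
    then show ?thesis using 1 assms(2) by simp
  next
    case e: (2 j)
    show ?thesis
    proof (cases rule: pos_lexp_cases[OF \<open>0 < e'\<close>])
      case 1
      then show ?thesis using e by (simp add: less_lexp_iff)
    next
      case e': (2 j')
      obtain i where i: "ldeg e i < ldeg e' i" "\<forall>l<i. ldeg e l = ldeg e' l"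
        using assms(2) e(1) e'(1) by (auto simp: less_lexp_iff)
      have "j' \<le> j"
      proof (rule ccontr)
        assume "\<not> j' \<le> j"
        then have "ldeg e' j = 0" "\<And>l. l \<le> j \<Longrightarrow> ldeg e' l = 0" using e'(3) by auto
        moreover have "ldeg e l \<ge> 0" if "l \<le> j" for l using e(2,3) that by (cases "l = j") auto
        ultimately show False using i e(2) by (metis leD le_less_linear less_irrefl)
      qed
      then consider "j' = j" | "j' < j" by linarith
      then show ?thesis
      proof cases
        case 1
        then show ?thesis using e e' assms(2) by simp
      next
        case 2
        show ?thesis
          by (rule less_lexpI[of _ _ j']) (use e e' 2 in auto)
      qed
    qed
  qed
qed

text \<open>At z-degree zero, \<open>e + shift e\<close> starts with ones, possibly none, followed
  by an entry of at least 2, and so exceeds every \<open>ones k\<close>. This is the origin of the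
  truncation bound: exponents up to \<open>ones k\<close> are out of reach of composition minus the
  identity.\<close>

lemma ones_less_add_shift:
  assumes "0 < e" shows "ones k < e + shift e"
proof (cases rule: pos_lexp_cases[OF assms])
  case 1
  then show ?thesis by (simp add: less_lexp_iff)
next
  case (2 j)
  show ?thesis
  proof (cases "k \<le> j")
    case True
    show ?thesis
    proof (rule less_lexpI[of _ _ k])
      show "ldeg (ones k) k < ldeg (e + shift e) k" using 2 True by (cases "k = j") auto
    qed (use 2 True in auto)
  next
    case False
    show ?thesis by (rule less_lexpI[of _ _ j]) (use 2 False in auto)
  qed
qed

lemma shift_less_add_shift:
  assumes "0 < e" "0 < a" shows "shift a < e + shift e"
proof (cases rule: pos_lexp_cases[OF assms(2)])
  case 1
  then show ?thesis using ones_less_add_shift[OF assms(1), of 0] by (simp add: ones_0)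
qed (use ones_less_add_shift[OF assms(1)] in simp)

section \<open>Exponents of bounded depth\<close>

definition depth :: "nat \<Rightarrow> lexp set" where
  "depth k = {e. \<forall>j\<ge>k. ldeg e j = 0}"

lemma depth_add: "a \<in> depth k \<Longrightarrow> b \<in> depth k \<Longrightarrow> a + b \<in> depth k"
  by (simp add: depth_def)

lemma depth_mono: "k \<le> l \<Longrightarrow> depth k \<subseteq> depth l"
  by (auto simp: depth_def)

lemma depth_0: "0 \<in> depth k" and depth_z_lexp: "z_lexp \<in> depth k" and depth_ell_lexp: "j < k \<Longrightarrow> ell_lexp (Suc j) \<in> depth k"
  by (auto simp: depth_def)

lemma depth_shift_surj:
  assumes "v \<in> depth k" "ones k < v"
  obtains e where "e \<in> depth k" "0 < e" "v = e + shift e"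
proof (cases "zdeg v = 0")
  case True
  then obtain j where j: "ldeg (ones k) j < ldeg v j" "\<forall>i<j. ldeg (ones k) i = ldeg v i"
    using assms(2) by (auto simp: less_lexp_iff)
  have "j < k" using j(1) assms(1) by (cases "j < k") (auto simp: depth_def)
  \<comment> \<open>\<open>j\<close> is the first position where \<open>v\<close> exceeds 1.
    Subtracting the ones up to and including \<open>j\<close> leaves an exponent whose first nonzero
    entry is at \<open>j\<close>.\<close>
  let ?e = "v - ones (Suc j)"
  have "shift ?e = ones (Suc j)" by (rule shift_eqI) (use True j \<open>j < k\<close> in auto)
  moreover have "0 < ?e" by (rule less_lexpI[of _ _ j]) (use True j \<open>j < k\<close> in auto)
  moreover have "?e \<in> depth k" using assms(1) \<open>j < k\<close> by (auto simp: depth_def)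
  ultimately show ?thesis using that[of ?e] by simp
next
  case False
  then have "0 < v" "shift v = 0" using assms(2) by (auto simp: less_lexp_iff shift_def)
  then show ?thesis using that[of v] assms(1) by simp
qed

subsection \<open>Series of bounded depth\<close>

lemma generated_depth: "S \<subseteq> depth k \<Longrightarrow> generated S \<subseteq> depth k"
proof -
  assume S: "S \<subseteq> depth k"
  have "nsum S n x \<Longrightarrow> x \<in> depth k" for n x
    by (induction rule: nsum.induct) (use S in \<open>auto intro: depth_0 depth_add\<close>)
  then show ?thesis by (auto simp: generated_def)
qed

lemma sumset_depth: "A \<subseteq> depth k \<Longrightarrow> B \<subseteq> depth k \<Longrightarrow> sumset A B \<subseteq> depth k"
  unfolding sumset_def using depth_add by blast

lemma depth_times: "supp f \<subseteq> depth k \<Longrightarrow> supp g \<subseteq> depth k \<Longrightarrow> supp (f * g) \<subseteq> depth k"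
  by (rule order_trans[OF supp_times sumset_depth])

lemma depth_plus: "supp f \<subseteq> depth k \<Longrightarrow> supp g \<subseteq> depth k \<Longrightarrow> supp (f + g) \<subseteq> depth k"
  using supp_plus[of f g] by auto

lemma depth_minus: "supp f \<subseteq> depth k \<Longrightarrow> supp g \<subseteq> depth k \<Longrightarrow> supp (f - g) \<subseteq> depth k"
  using supp_minus[of f g] by auto

lemma depth_hmono: "e \<in> depth k \<Longrightarrow> supp (hmono c e) \<subseteq> depth k"
  using supp_hmono[of c e] by auto

lemma depth_fps_eval: "ord_gt 0 d \<Longrightarrow> supp d \<subseteq> depth k \<Longrightarrow> supp (fps_eval d F) \<subseteq> depth k"
  using supp_fps_eval[of d "depth k" F] generated_depth[of "depth k" k] by auto

subsection \<open>Iterated logarithms\<close>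

abbreviation ell :: "nat \<Rightarrow> lexp hahn" where "ell j \<equiv> hmono 1 (ell_lexp j)"

text \<open>If \<open>w = log (g / z)\<close>, then \<open>log_ratio w j = log ((ell j \<circ> g) / ell j)\<close> for \<open>j \<ge> 1\<close>.\<close>

primrec log_ratio :: "lexp hahn \<Rightarrow> nat \<Rightarrow> lexp hahn" where
  "log_ratio w 0 = w"
| "log_ratio w (Suc j) = - hln1 (- (ell (Suc j) * log_ratio w j))"

text \<open>Every stage multiplies by the next iterated logarithm, and \<open>- log (1 - x)\<close>
  has the same leading term as \<open>x\<close>. The constant term of \<open>w\<close> is thus
  carried along as the coefficient of the product of the first \<open>j\<close> iterated logarithms,
  the product that \<open>shift\<close> encodes.\<close>

lemma ord_ge_log_ratio_coeff:
  assumes "ord_ge 0 w"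
  shows "ord_ge (ones j) (log_ratio w j) \<and> coeff (log_ratio w j) (ones j) = coeff w 0"
proof (induction j)
  case 0
  then show ?case using assms by (simp add: ones_0)
next
  case (Suc j)
  let ?x = "ell (Suc j) * log_ratio w j"
  have x: "ord_ge (ones (Suc j)) ?x" "coeff ?x (ones (Suc j)) = coeff w 0"
    unfolding ones_Suc using ord_ge_mult[OF ord_ge_hmono, of "ones j" "log_ratio w j" "ell_lexp (Suc j)" 1] Suc
    by (auto simp: coeff_hmono_times)
  have s: "ord_gt 0 (- ?x)" using ord_ge_imp_ord_gt[OF x(1) ones_pos] by simp
  then show ?case using x ord_ge_hln1[OF s, of "ones (Suc j)"] coeff_hln1_lead[OF s, of "ones (Suc j)"]
    by (simp add: less_imp_le[OF ones_pos])
qed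

lemma ord_ge_log_ratio: "ord_ge 0 w \<Longrightarrow> ord_ge (ones j) (log_ratio w j)"
  using ord_ge_log_ratio_coeff by blast

lemma coeff_log_ratio: "ord_ge 0 w \<Longrightarrow> coeff (log_ratio w j) (ones j) = coeff w 0"
  using ord_ge_log_ratio_coeff by blast

lemma ord_gt_ell_log_ratio:
  assumes "ord_ge 0 w" shows "ord_gt 0 (ell (Suc j) * log_ratio w j)"
proof -
  have "ord_ge (ones (Suc j)) (ell (Suc j) * log_ratio w j)"
    unfolding ones_Suc by (intro ord_ge_mult ord_ge_hmono ord_ge_log_ratio assms)
  then show ?thesis by (rule ord_ge_imp_ord_gt[OF _ ones_pos])
qed

lemma ord_gt_log_ratio: "ord_ge 0 w \<Longrightarrow> ord_gt 0 (log_ratio w (Suc j))"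
  by (rule ord_ge_imp_ord_gt[OF ord_ge_log_ratio ones_pos])

text \<open>Each stage contributes its factor \<open>ell (Suc j)\<close> to differences as well, so
  the dependence on \<open>w\<close> is weakened by the same product that governs the leading
  terms.\<close>

lemma ord_ge_log_ratio_diff:
  assumes "ord_ge 0 w" "ord_ge 0 w'" "ord_ge e (w - w')"
  shows "ord_ge (ones j + e) (log_ratio w j - log_ratio w' j)"
proof (induction j)
  case 0
  then show ?case using assms by (simp add: ones_0)
next
  case (Suc j)
  have "ord_ge (ones (Suc j) + e) (ell (Suc j) * log_ratio w j - ell (Suc j) * log_ratio w' j)"
    using ord_ge_mult[OF ord_ge_hmono[of "ell_lexp (Suc j)" 1] Suc] by (simp add: ones_Suc algebra_simps)
  then have "ord_ge (ones (Suc j) + e) (hln1 (- (ell (Suc j) * log_ratio w j)) - hln1 (- (ell (Suc j) * log_ratio w' j)))"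
    by (intro ord_ge_hln1_diff ord_gt_ell_log_ratio assms)
  then have "ord_ge (ones (Suc j) + e) (- (hln1 (- (ell (Suc j) * log_ratio w j)) - hln1 (- (ell (Suc j) * log_ratio w' j))))"
    by (simp only: ord_ge_uminus)
  then show ?case by (simp add: algebra_simps)
qed

lemma depth_log_ratio: "ord_ge 0 w \<Longrightarrow> supp w \<subseteq> depth k \<Longrightarrow> j \<le> k \<Longrightarrow> supp (log_ratio w j) \<subseteq> depth k"
proof (induction j)
  case (Suc j)
  then have "supp (ell (Suc j) * log_ratio w j) \<subseteq> depth k" by (intro depth_times depth_hmono depth_ell_lexp) auto
  then show ?case using depth_fps_eval[of "- (ell (Suc j) * log_ratio w j)" k "fps_ln 1"] ord_gt_ell_log_ratio[OF Suc.prems(1), of j]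
    by (simp add: hln1_def)
qed simp

subsection \<open>Composition operators\<close>

text \<open>\<open>comp_op c u k\<close> is right composition with \<open>lin_exp c u = exp c * z * exp u\<close>, for series of depth
  at most \<open>k\<close>.\<close>

definition scale_factor :: "real \<Rightarrow> lexp \<Rightarrow> real" where "scale_factor c e = exp (c * zdeg e)"

text \<open>The logarithm of the infinitesimal change of the monomial of exponent \<open>e\<close>
  under composition. The factor \<open>exp (c * zdeg e)\<close> is split off into
  \<open>scale_factor\<close>, since \<open>c\<close> is not infinitesimal; in the iterated
  logarithms \<open>c\<close> stays inside \<open>hconst c + u\<close>. The sum stops at
  \<open>k\<close> because an exponent of this type may have infinitely many nonzero
  entries.\<close>

definition theta :: "real \<Rightarrow> lexp hahn \<Rightarrow> nat \<Rightarrow> lexp \<Rightarrow> lexp hahn" where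
  "theta c u k e = hconst (zdeg e) * u + (\<Sum>i<k. hconst (of_int (ldeg e i)) * log_ratio (hconst c + u) (Suc i))"

definition comp_op :: "real \<Rightarrow> lexp hahn \<Rightarrow> nat \<Rightarrow> lexp hahn \<Rightarrow> lexp hahn" where
  "comp_op c u k = hsubst (scale_factor c) (theta c u k)"

definition lin_exp :: "real \<Rightarrow> lexp hahn \<Rightarrow> lexp hahn" where
  "lin_exp c u = hmono (exp c) z_lexp * hexp u"

lemma ord_ge_hconst_plus: "ord_gt 0 u \<Longrightarrow> ord_ge 0 (hconst c + u)"
  by (intro ord_ge_add ord_ge_hconst ord_gt_imp_ord_ge)

lemma substitution_theta:
  assumes "ord_gt 0 u"
  shows "substitution (scale_factor c) (theta c u k) (supp u \<union> (\<Union>i<k. supp (log_ratio (hconst c + u) (Suc i))))"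
proof
  note w = ord_ge_hconst_plus[OF assms, of c]
  show "well_ordered (supp u \<union> (\<Union>i<k. supp (log_ratio (hconst c + u) (Suc i))))"
    by (intro well_ordered_Un well_ordered_UN_finite well_ordered_supp) simp
  show "0 < s" if "s \<in> supp u \<union> (\<Union>i<k. supp (log_ratio (hconst c + u) (Suc i)))" for s
    using that assms ord_gt_log_ratio[OF w] unfolding ord_gt_def by blast
  fix e
  have "supp (\<Sum>i<k. hconst (of_int (ldeg e i)) * log_ratio (hconst c + u) (Suc i)) \<subseteq> (\<Union>i<k. supp (log_ratio (hconst c + u) (Suc i)))"
    using supp_sum[of "\<lambda>i. hconst (of_int (ldeg e i)) * log_ratio (hconst c + u) (Suc i)" "{..<k}"] supp_hconst_times by blast
  then show "supp (theta c u k e) \<subseteq> supp u \<union> (\<Union>i<k. supp (log_ratio (hconst c + u) (Suc i)))"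
    unfolding theta_def
    using supp_plus[of "hconst (zdeg e) * u" "\<Sum>i<k. hconst (of_int (ldeg e i)) * log_ratio (hconst c + u) (Suc i)"] supp_hconst_times by blast
next
  fix a b
  show "scale_factor c (a + b) = scale_factor c a * scale_factor c b" by (simp add: scale_factor_def distrib_left exp_add)
  show "theta c u k (a + b) = theta c u k a + theta c u k b"
    by (simp add: theta_def hconst_add distrib_right sum.distrib del: log_ratio.simps)
qed (simp add: scale_factor_def)

lemma theta_z_lexp: "theta c u k z_lexp = u"
  by (simp add: theta_def)

lemma theta_ell_lexp: "j < k \<Longrightarrow> theta c u k (ell_lexp (Suc j)) = log_ratio (hconst c + u) (Suc j)"
proof -
  assume "j < k"
  have "(\<Sum>i<k. hconst (of_int (ldeg (ell_lexp (Suc j)) i)) * log_ratio (hconst c + u) (Suc i))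
    = (\<Sum>i<k. if i = j then log_ratio (hconst c + u) (Suc i) else 0)"
    by (intro sum.cong) auto
  then show ?thesis using \<open>j < k\<close> by (simp add: theta_def del: log_ratio.simps)
qed

lemma theta_depth: "e \<in> depth k \<Longrightarrow> k \<le> l \<Longrightarrow> theta c u l e = theta c u k e"
  unfolding theta_def by (intro arg_cong2[where f = plus] refl sum.mono_neutral_right) (auto simp: depth_def)

lemma comp_op_depth:
  assumes "supp f \<subseteq> depth k" "k \<le> l" shows "comp_op c u l f = comp_op c u k f"
proof -
  have "hconst (coeff f e) * msub (scale_factor c) (theta c u l) e = hconst (coeff f e) * msub (scale_factor c) (theta c u k) e" for e
  proof (cases "e \<in> supp f")
    case True
    then have "e \<in> depth k" using assms(1) by blast
    then show ?thesis by (simp add: msub_def theta_depth[OF _ assms(2)])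
  qed (simp add: supp_iff)
  then show ?thesis by (simp add: comp_op_def hsubst_def)
qed

lemma supp_comp_op:
  assumes "ord_gt 0 u" "supp u \<subseteq> depth k" "supp f \<subseteq> depth k"
  shows "supp (comp_op c u k f) \<subseteq> depth k"
proof -
  interpret substitution "scale_factor c" "theta c u k" "supp u \<union> (\<Union>i<k. supp (log_ratio (hconst c + u) (Suc i)))"
    by (rule substitution_theta[OF assms(1)])
  have "supp (hconst c + u) \<subseteq> depth k" unfolding hconst_def by (intro depth_plus depth_hmono depth_0 assms)
  then have "supp (log_ratio (hconst c + u) (Suc i)) \<subseteq> depth k" if "i < k" for i
    using depth_log_ratio[OF ord_ge_hconst_plus[OF assms(1)], of c k "Suc i"] that by simp
  then have "supp u \<union> (\<Union>i<k. supp (log_ratio (hconst c + u) (Suc i))) \<subseteq> depth k" using assms(2) by blast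
  then have "supp (m e) \<subseteq> depth k" if "e \<in> depth k" for e
    using that by (intro order_trans[OF supp_m sumset_depth] generated_depth) auto
  then show ?thesis unfolding comp_op_def using assms(3) by (intro supp_C) blast
qed

text \<open>With \<open>A\<close> and \<open>B\<close> the ratios of the inner and outer series,
  substitution sends \<open>ell\<close> to \<open>ell / (1 - ell * A)\<close>. Therefore
  \<open>1 - ell * (A + C B)\<close> factors as \<open>(1 - ell * A) * (1 - C (ell * B))\<close>,
  and logarithms turn this into an additive chain rule.\<close>

lemma log_ratio_comp_op:
  assumes u: "ord_gt 0 u" and w: "ord_ge 0 w"
  shows "j \<le> k \<Longrightarrow> log_ratio (hconst c + u + comp_op c u k w) j = log_ratio (hconst c + u) j + comp_op c u k (log_ratio w j)"
proof (induction j)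
  case (Suc j)
  interpret substitution "scale_factor c" "theta c u k" "supp u \<union> (\<Union>i<k. supp (log_ratio (hconst c + u) (Suc i)))"
    by (rule substitution_theta[OF u])
  note w' = ord_ge_hconst_plus[OF u, of c]
  define A B where "A = log_ratio (hconst c + u) j" and "B = log_ratio w j"
  let ?l = "ell (Suc j)"
  have sA: "ord_gt 0 (?l * A)" and sB: "ord_gt 0 (?l * B)"
    unfolding A_def B_def by (rule ord_gt_ell_log_ratio[OF w'], rule ord_gt_ell_log_ratio[OF w])
  have Cl: "C ?l = ?l * hexp (- hln1 (- (?l * A)))"
    using Suc.prems by (simp add: C_hmono msub_def scale_factor_def theta_ell_lexp[of j k, simplified] A_def)
  have "hexp (- hln1 (- (?l * A))) * hexp (hln1 (- (?l * A))) = 1"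
    using sA by (intro hexp_minus ord_gt_hln1) simp
  then have inv: "hexp (- hln1 (- (?l * A))) * (1 - ?l * A) = 1"
    using sA by (simp add: hexp_hln1)
  have Cl': "C ?l * (1 - ?l * A) = ?l" unfolding Cl using inv by (simp add: mult.assoc)
  have "(1 + - (?l * A)) * (1 + - (C ?l * C B)) = (1 - ?l * A) - (C ?l * (1 - ?l * A)) * C B"
    by (simp add: algebra_simps)
  then have "1 + - (?l * (A + C B)) = (1 + - (?l * A)) * (1 + - (C ?l * C B))"
    unfolding Cl' by (simp add: algebra_simps)
  then have "hln1 (- (?l * (A + C B))) = hln1 (- (?l * A)) + hln1 (- (C ?l * C B))"
    by (rule hln1_mult(2)[rotated 2]) (use sA ord_gt_C[OF sB] in \<open>simp_all add: C_mult\<close>)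
  moreover have "C (hln1 (- (?l * B))) = hln1 (- (C ?l * C B))"
    using C_hln1[of "- (?l * B)"] sB by (simp add: C_uminus C_mult)
  ultimately show ?case
    using Suc by (simp add: A_def B_def comp_op_def C_uminus)
qed simp

lemma theta_comp_op:
  assumes u: "ord_gt 0 u" and v: "ord_gt 0 v"
  shows "theta (c' + c) (u + comp_op c u k v) k e = theta c u k e + comp_op c u k (theta c' v k e)"
proof -
  interpret substitution "scale_factor c" "theta c u k" "supp u \<union> (\<Union>i<k. supp (log_ratio (hconst c + u) (Suc i)))"
    by (rule substitution_theta[OF u])
  have eq: "hconst (c' + c) + (u + comp_op c u k v) = hconst c + u + comp_op c u k (hconst c' + v)"
    by (simp add: comp_op_def C_add C_hconst hconst_add algebra_simps)
  have log_ratio: "log_ratio (hconst (c' + c) + (u + comp_op c u k v)) (Suc i)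
      = log_ratio (hconst c + u) (Suc i) + C (log_ratio (hconst c' + v) (Suc i))" if "i < k" for i
    unfolding eq using log_ratio_comp_op[OF u ord_ge_hconst_plus[OF v], of "Suc i" k c c'] that by (simp add: comp_op_def del: log_ratio.simps)
  have "(\<Sum>i<k. hconst (of_int (ldeg e i)) * log_ratio (hconst (c' + c) + (u + comp_op c u k v)) (Suc i))
      = (\<Sum>i<k. hconst (of_int (ldeg e i)) * (log_ratio (hconst c + u) (Suc i) + C (log_ratio (hconst c' + v) (Suc i))))"
    by (intro sum.cong refl) (simp only: log_ratio lessThan_iff)
  then show ?thesis
    unfolding theta_def[of "c' + c" _ k e] theta_def[of c u k e] theta_def[of c' v k e]
    by (simp add: comp_op_def C_add C_sum C_mult C_hconst distrib_left sum.distrib ac_simps del: log_ratio.simps)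
qed

text \<open>The additive chain rule for \<open>theta\<close> becomes multiplicative under
  \<open>hexp\<close>, so both sides agree on monomials, and linearity over infinite sums does the
  rest. This is associativity of composition.\<close>

lemma comp_op_comp_op:
  assumes u: "ord_gt 0 u" and v: "ord_gt 0 v"
  shows "comp_op c u k (comp_op c' v k f) = comp_op (c' + c) (u + comp_op c u k v) k f"
proof -
  interpret substitution "scale_factor c" "theta c u k" "supp u \<union> (\<Union>i<k. supp (log_ratio (hconst c + u) (Suc i)))"
    by (rule substitution_theta[OF u])
  interpret V: substitution "scale_factor c'" "theta c' v k" "supp v \<union> (\<Union>i<k. supp (log_ratio (hconst c' + v) (Suc i)))"
    by (rule substitution_theta[OF v])
  have "C (V.m e) = msub (scale_factor (c' + c)) (theta (c' + c) (u + comp_op c u k v) k) e" for e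
  proof -
    have "C (V.m e) = hconst (scale_factor c' e) * m e * hexp (C (theta c' v k e))"
      unfolding msub_def[of "scale_factor c'"] by (simp add: C_mult C_hmono C_hexp V.ord_gt_th)
    also have "\<dots> = (hconst (scale_factor c' e) * hmono (scale_factor c e) e) * (hexp (theta c u k e) * hexp (C (theta c' v k e)))"
      by (simp add: msub_def ac_simps)
    also have "\<dots> = hmono (scale_factor (c' + c) e) e * hexp (theta c u k e + C (theta c' v k e))"
      by (simp add: hconst_times_hmono scale_factor_def exp_add[symmetric] hexp_add ord_gt_th ord_gt_C V.ord_gt_th algebra_simps)
    finally show ?thesis unfolding msub_def[of "scale_factor (c' + c)"] theta_comp_op[OF u v] by (simp add: comp_op_def)
  qed
  moreover have "C (V.C f) = hsum (\<lambda>e. hconst (coeff f e) * C (V.m e))"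
    unfolding hsubst_def[of "scale_factor c'"] by (simp add: C_hsum(2)[OF V.C_summable] C_mult C_hconst)
  ultimately show ?thesis by (simp add: comp_op_def hsubst_def[of "scale_factor (c' + c)"])
qed

lemma comp_op_lin_exp:
  assumes u: "ord_gt 0 u" and v: "ord_gt 0 v"
  shows "comp_op c u k (lin_exp c' v) = lin_exp (c' + c) (u + comp_op c u k v)"
proof -
  interpret substitution "scale_factor c" "theta c u k" "supp u \<union> (\<Union>i<k. supp (log_ratio (hconst c + u) (Suc i)))"
    by (rule substitution_theta[OF u])
  have "comp_op c u k (lin_exp c' v) = hconst (exp c') * (hmono (scale_factor c z_lexp) z_lexp * hexp u) * hexp (C v)"
    by (simp add: comp_op_def lin_exp_def C_mult C_hmono C_hexp v msub_def theta_z_lexp)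
  also have "\<dots> = (hconst (exp c') * hmono (scale_factor c z_lexp) z_lexp) * (hexp u * hexp (C v))"
    by (simp add: ac_simps)
  also have "\<dots> = lin_exp (c' + c) (u + comp_op c u k v)"
    by (simp add: lin_exp_def hconst_times_hmono scale_factor_def exp_add hexp_add u v ord_gt_C comp_op_def)
  finally show ?thesis .
qed

section \<open>Inverses of parabolic series\<close>

definition pos_depth :: "nat \<Rightarrow> lexp set" where "pos_depth k = {e \<in> depth k. 0 < e}"

lemma supp_pos_depth_iff: "supp u \<subseteq> pos_depth k \<longleftrightarrow> ord_gt 0 u \<and> supp u \<subseteq> depth k"
  by (auto simp: pos_depth_def ord_gt_def)

lemma hln1_0 [simp]: "hln1 0 = 0"
  using hln1_hexp[of 0] by simp

lemma log_ratio_0: "log_ratio 0 j = 0"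
  by (induction j) simp_all

lemma comp_op_id: "comp_op 0 0 k f = f"
proof -
  have "theta 0 0 k e = 0" for e by (simp add: theta_def log_ratio_0 del: log_ratio.simps)
  then have "hconst (coeff f e) * msub (scale_factor 0) (theta 0 0 k) e = hmono (coeff f e) e" for e
    by (simp add: msub_def scale_factor_def hconst_times_hmono)
  then show ?thesis by (simp add: comp_op_def hsubst_def hsum_expansion(2))
qed

lemma comp_op_0: "ord_gt 0 u \<Longrightarrow> comp_op c u k 0 = 0"
  unfolding comp_op_def by (rule substitution.C_0[OF substitution_theta])

lemma comp_op_add: "ord_gt 0 u \<Longrightarrow> comp_op c u k (f + g) = comp_op c u k f + comp_op c u k g"
  unfolding comp_op_def by (rule substitution.C_add[OF substitution_theta])

lemma comp_op_diff: "ord_gt 0 u \<Longrightarrow> comp_op c u k (f - g) = comp_op c u k f - comp_op c u k g"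
  unfolding comp_op_def by (rule substitution.C_diff[OF substitution_theta])

lemma ord_gt_comp_op: "ord_gt 0 u \<Longrightarrow> ord_gt e f \<Longrightarrow> ord_gt e (comp_op c u k f)"
  unfolding comp_op_def by (rule substitution.ord_gt_C[OF substitution_theta])

text \<open>The equation expresses that composing \<open>lin_exp 0 v\<close> with inner series
  \<open>lin_exp 0 u\<close> gives \<open>z\<close>. Composition with a parabolic series preserves
  leading terms, so the equation is triangular with the identity as exponent map and all
  coefficients 1.\<close>

lemma left_inverse_exists:
  assumes "ord_gt 0 u" "supp u \<subseteq> depth k"
  shows "\<exists>v. ord_gt 0 v \<and> supp v \<subseteq> depth k \<and> u + comp_op 0 u k v = 0"
proof -
  interpret substitution "scale_factor 0" "theta 0 u k" "supp u \<union> (\<Union>i<k. supp (log_ratio (hconst 0 + u) (Suc i)))"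
    by (rule substitution_theta[OF assms(1)])
  interpret triangular "\<lambda>v. u + comp_op 0 u k v" "\<lambda>e. e" "\<lambda>_. 1" "pos_depth k"
  proof
    fix v w :: "lexp hahn" and e assume "ord_ge e (v - w)"
    then show "ord_ge e (u + comp_op 0 u k v - (u + comp_op 0 u k w)) \<and>
       coeff (u + comp_op 0 u k v - (u + comp_op 0 u k w)) e = 1 * coeff (v - w) e"
      using ord_ge_C[of e "v - w"] coeff_C_lead[of e "v - w"]
      by (simp add: comp_op_def C_diff scale_factor_def)
  qed simp_all
  have sub: "supp (u + comp_op 0 u k v) \<subseteq> pos_depth k" if "supp v \<subseteq> pos_depth k" for v
  proof -
    have "ord_gt 0 v" "supp v \<subseteq> depth k" using that by (auto simp: supp_pos_depth_iff)
    then show ?thesis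
      unfolding supp_pos_depth_iff using assms by (intro conjI ord_gt_add ord_gt_comp_op depth_plus supp_comp_op)
  qed
  have "\<exists>v. supp v \<subseteq> pos_depth k \<and> u + comp_op 0 u k v = 0"
  proof (rule solution_exists)
    fix v e assume "supp v \<subseteq> pos_depth k" "coeff (u + comp_op 0 u k v) e \<noteq> 0"
    then show "e \<in> (\<lambda>e. e) ` pos_depth k" using sub[of v] by (simp add: supp_def image_ident subset_iff)
  qed
  then show ?thesis unfolding supp_pos_depth_iff by blast
qed

text \<open>The usual monoid argument: \<open>v\<close> has a left inverse \<open>w\<close> of its
  own, hence the operators of \<open>u\<close> and \<open>w\<close> coincide and those of
  \<open>u\<close> and \<open>v\<close> are mutually inverse.\<close>

lemma left_inverse_imp_right_inverse:
  assumes u: "ord_gt 0 u" "supp u \<subseteq> depth k" and v: "ord_gt 0 v" "supp v \<subseteq> depth k"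
    and uv: "u + comp_op 0 u k v = 0"
  shows "v + comp_op 0 v k u = 0"
proof -
  obtain w where w: "ord_gt 0 w" "v + comp_op 0 v k w = 0"
    using left_inverse_exists[OF v] by blast
  have 1: "comp_op 0 u k (comp_op 0 v k f) = f" for f
    using comp_op_comp_op[OF u(1) v(1), of 0 k 0 f] uv by (simp add: comp_op_id)
  have 2: "comp_op 0 v k (comp_op 0 w k f) = f" for f
    using comp_op_comp_op[OF v(1) w(1), of 0 k 0 f] w(2) by (simp add: comp_op_id)
  have 3: "comp_op 0 v k (comp_op 0 u k f) = f" for f
    using 1 2 by metis
  have "comp_op 0 u k (v + comp_op 0 v k u) = 0"
    using uv 1[of u] by (simp add: comp_op_add[OF u(1)] add.commute)
  then show ?thesis using 3[of "v + comp_op 0 v k u"] comp_op_0[OF v(1)] by simp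
qed

section \<open>The conjugacy equation\<close>

lemma hsum_diff:
  assumes "hsummable F" "hsummable G"
  shows "hsummable (\<lambda>i. F i - G i)" "hsum (\<lambda>i. F i - G i) = hsum F - hsum G"
proof -
  have eq: "F i - G i = F i + hconst (-1) * G i" for i by (simp add: hconst_minus)
  have s: "hsummable (\<lambda>i. hconst (-1) * G i)" by (rule hsummable_hconst[OF assms(2)])
  show "hsummable (\<lambda>i. F i - G i)" unfolding eq by (rule hsum_add(1)[OF assms(1) s])
  have "hsum (\<lambda>i. F i - G i) = hsum F + hsum (\<lambda>i. hconst (-1) * G i)"
    unfolding eq by (rule hsum_add(2)[OF assms(1) s])
  then show "hsum (\<lambda>i. F i - G i) = hsum F - hsum G"
    unfolding hsum_mult(2)[OF assms(2)] by (simp add: hconst_minus)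
qed

text \<open>The coefficient at \<open>e + shift e\<close> that composition minus the identity
  produces from the monomial of exponent \<open>e > 0\<close>. With \<open>c = ln lam\<close>, the
  first case is \<open>lam\<close> to the z-degree, minus 1.\<close>

definition shift_coeff :: "real \<Rightarrow> lexp \<Rightarrow> real" where
  "shift_coeff c e = (if zdeg e \<noteq> 0 then scale_factor c e - 1 else c * of_int (ldeg e (LEAST i. ldeg e i \<noteq> 0)))"

lemma shift_coeff_nonzero:
  assumes "0 < e" "c \<noteq> 0" shows "shift_coeff c e \<noteq> 0"
proof (cases rule: pos_lexp_cases[OF assms(1)])
  case 1
  then show ?thesis using assms by (auto simp: shift_coeff_def scale_factor_def)
next
  case (2 j)
  then have "\<exists>i. ldeg e i \<noteq> 0" by (intro exI[of _ j]) simp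
  then have "ldeg e (LEAST i. ldeg e i \<noteq> 0) \<noteq> 0" by (rule LeastI_ex)
  then show ?thesis using 2 assms by (simp add: shift_coeff_def)
qed

text \<open>Summands before position \<open>j\<close> have coefficient zero, and those after it
  carry a longer product of iterated logarithms, so the summand at \<open>j\<close> alone determines
  the coefficient at \<open>ones (Suc j)\<close>.\<close>

lemma theta_lead:
  assumes "ord_gt 0 u" "zdeg e = 0" "\<And>i. i < j \<Longrightarrow> ldeg e i = 0" "j < k"
  shows "ord_ge (ones (Suc j)) (theta c u k e)" "coeff (theta c u k e) (ones (Suc j)) = of_int (ldeg e j) * c"
proof -
  let ?w = "hconst c + u"
  have w: "ord_ge 0 ?w" by (rule ord_ge_hconst_plus[OF assms(1)])
  have w0: "coeff ?w 0 = c" using ord_gtD[OF assms(1), of 0] by (simp add: coeff_hconst)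
  have t: "ord_ge (ones (Suc j)) (hconst (of_int (ldeg e i)) * log_ratio ?w (Suc i))" for i
  proof (cases "i < j")
    case True
    then show ?thesis by (simp add: assms(3))
  next
    case False
    then show ?thesis by (intro ord_ge_hconst_times ord_ge_trans[OF ord_ge_log_ratio[OF w]] ones_mono) simp
  qed
  show "ord_ge (ones (Suc j)) (theta c u k e)"
    unfolding theta_def using assms(2) ord_ge_sum[OF t] by (simp del: log_ratio.simps)
  have "coeff (log_ratio ?w (Suc i)) (ones (Suc j)) = 0" if "j < i" for i
  proof -
    have "ones (Suc j) < ones (Suc i)" by (rule less_lexpI[of _ _ "Suc j"]) (use that in auto)
    then show ?thesis by (rule ord_geD[OF ord_ge_log_ratio[OF w]])
  qed
  then have "of_int (ldeg e i) * coeff (log_ratio ?w (Suc i)) (ones (Suc j)) = (if i = j then of_int (ldeg e j) * c else 0)" for i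
    using assms(3)[of i] coeff_log_ratio[OF w, of "Suc j"] w0 by (cases i j rule: linorder_cases) (simp_all del: log_ratio.simps)
  then show "coeff (theta c u k e) (ones (Suc j)) = of_int (ldeg e j) * c"
    using assms(2,4) by (simp add: theta_def coeff_sum del: log_ratio.simps)
qed

lemma msub_lead:
  assumes "ord_gt 0 u" "0 < e" "e \<in> depth k"
  shows "ord_ge (e + shift e) (msub (scale_factor c) (theta c u k) e - hmono 1 e)"
    "coeff (msub (scale_factor c) (theta c u k) e - hmono 1 e) (e + shift e) = shift_coeff c e"
proof -
  interpret substitution "scale_factor c" "theta c u k" "supp u \<union> (\<Union>i<k. supp (log_ratio (hconst c + u) (Suc i)))"
    by (rule substitution_theta[OF assms(1)])
  have "ord_ge (e + shift e) (m e - hmono 1 e) \<and> coeff (m e - hmono 1 e) (e + shift e) = shift_coeff c e"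
  proof (cases rule: pos_lexp_cases[OF assms(2)])
    case 1
    then show ?thesis using ord_ge_diff[OF ord_ge_m ord_ge_hmono, of e 1] by (simp add: coeff_m coeff_hmono shift_coeff_def)
  next
    case (2 j)
    have jk: "j < k" using 2(2) assms(3) by (cases "j < k") (auto simp: depth_def)
    have least: "(LEAST i. ldeg e i \<noteq> 0) = j"
      by (rule Least_equality) (use 2 in \<open>auto simp: not_less[symmetric]\<close>)
    note tl = theta_lead[OF assms(1) 2(1) 2(3) jk, of c]
    have eq: "m e - hmono 1 e = hmono 1 e * (hexp (theta c u k e) - 1)"
      using 2(1) by (simp add: msub_def scale_factor_def algebra_simps)
    have "ord_ge (e + ones (Suc j)) (hmono 1 e * (hexp (theta c u k e) - 1))"
      by (intro ord_ge_mult ord_ge_hmono ord_ge_hexp ord_gt_th tl)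
    moreover have "coeff (hexp (theta c u k e) - 1) (ones (Suc j)) = of_int (ldeg e j) * c"
      using coeff_hexp_lead[OF ord_gt_th tl(1)] tl(2) by (simp add: less_imp_le[OF ones_pos])
    ultimately show ?thesis unfolding eq using 2 by (simp add: coeff_hmono_times shift_coeff_def least)
  qed
  then show "ord_ge (e + shift e) (m e - hmono 1 e)" "coeff (m e - hmono 1 e) (e + shift e) = shift_coeff c e"
    by auto
qed

text \<open>By \<open>add_shift_mono\<close> higher monomials of \<open>v\<close> contribute only
  beyond \<open>e + shift e\<close>, so the monomial at \<open>e\<close> alone decides the
  coefficient there.\<close>

lemma comp_op_minus_id_lead:
  assumes u: "ord_gt 0 u" and v: "supp v \<subseteq> pos_depth k" "ord_ge e v" and e: "e \<in> pos_depth k"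
  shows "ord_ge (e + shift e) (comp_op c u k v - v)"
    "coeff (comp_op c u k v - v) (e + shift e) = shift_coeff c e * coeff v e"
proof -
  interpret substitution "scale_factor c" "theta c u k" "supp u \<union> (\<Union>i<k. supp (log_ratio (hconst c + u) (Suc i)))"
    by (rule substitution_theta[OF u])
  define D where "D x = hconst (coeff v x) * (m x - hmono 1 x)" for x
  have D_eq: "D x = hconst (coeff v x) * m x - hmono (coeff v x) x" for x
    by (simp add: D_def right_diff_distrib hconst_times_hmono)
  have sD: "hsummable D" "hsum D = comp_op c u k v - v"
    unfolding D_eq[abs_def] using hsum_diff[OF C_summable[of v] hsum_expansion(1)[of v]]
    by (simp_all add: hsum_expansion(2) comp_op_def hsubst_def)
  have ord_ge_D: "ord_ge (x + shift x) (D x)" for x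
  proof (cases "x \<in> supp v")
    case True
    then have "0 < x" "x \<in> depth k" using v(1) by (auto simp: pos_depth_def)
    then show ?thesis unfolding D_def by (intro ord_ge_hconst_times msub_lead[OF u])
  qed (simp add: D_def supp_iff)
  have e': "0 < e" "e \<in> depth k" using e by (auto simp: pos_depth_def)
  have lt: "ord_gt (e + shift e) (D x)" if "x \<noteq> e" for x
  proof (cases "x \<in> supp v")
    case True
    then have "e < x" using v(2) that by (auto simp: ord_ge_def less_le)
    then show ?thesis by (rule ord_ge_imp_ord_gt[OF ord_ge_D add_shift_mono[OF e'(1)]])
  qed (simp add: D_def supp_iff)
  have "ord_ge (e + shift e) (D x)" for x
    using ord_ge_D[of e] ord_gt_imp_ord_ge[OF lt[of x]] by (cases "x = e") auto
  then show "ord_ge (e + shift e) (comp_op c u k v - v)" unfolding sD(2)[symmetric] by (rule ord_ge_hsum[OF sD(1)])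
  have "coeff (hsum D) (e + shift e) = sum (\<lambda>x. coeff (D x) (e + shift e)) {e}"
    unfolding coeff_hsum[OF sD(1)] by (rule Sum_any_mono_neutral) (use ord_gtD[OF lt] in auto)
  moreover have "coeff (D e) (e + shift e) = coeff v e * shift_coeff c e"
    unfolding D_def coeff_hconst_times msub_lead(2)[OF u e'] ..
  ultimately show "coeff (comp_op c u k v - v) (e + shift e) = shift_coeff c e * coeff v e"
    unfolding sD(2) by (simp add: mult.commute)
qed

section \<open>Dependence of composition on the inner series\<close>

lemma theta_diff:
  assumes "ord_gt 0 u" "ord_gt 0 u'" "ord_ge e (u - u')" "0 < x"
  shows "ord_ge (shift x + e) (theta c u k x - theta c u' k x)"
proof -
  have w: "ord_ge 0 (hconst c + u)" "ord_ge 0 (hconst c + u')" by (intro ord_ge_hconst_plus assms)+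
  have d: "ord_ge e ((hconst c + u) - (hconst c + u'))" using assms(3) by simp
  define L where "L i = hconst (of_int (ldeg x i)) * (log_ratio (hconst c + u) (Suc i) - log_ratio (hconst c + u') (Suc i))" for i
  have eq: "theta c u k x - theta c u' k x = hconst (zdeg x) * (u - u') + (\<Sum>i<k. L i)"
    by (simp add: theta_def L_def right_diff_distrib sum_subtractf del: log_ratio.simps)
  have L: "ord_ge (ones (Suc i) + e) (L i)" for i
    unfolding L_def by (intro ord_ge_hconst_times ord_ge_log_ratio_diff w d)
  show ?thesis
  proof (cases rule: pos_lexp_cases[OF assms(4)])
    case 1
    have "ord_ge e (L i)" for i by (rule ord_ge_trans[OF L[of i]]) (simp add: less_imp_le[OF ones_pos])
    then show ?thesis unfolding eq using 1 assms(3) by (simp add: ord_ge_add ord_ge_hconst_times ord_ge_sum)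
  next
    case (2 j)
    have "ord_ge (ones (Suc j) + e) (L i)" for i
    proof (cases "i < j")
      case True
      then show ?thesis by (simp add: L_def 2)
    next
      case False
      then show ?thesis by (intro ord_ge_trans[OF L[of i]] add_right_mono ones_mono) simp
    qed
    then show ?thesis unfolding eq using 2 by (simp add: ord_ge_sum)
  qed
qed

text \<open>The image of a monomial \<open>x\<close> of \<open>f\<close> changes by order at least
  \<open>x + shift x + e\<close>, which exceeds \<open>e + shift e\<close> by
  \<open>shift_less_add_shift\<close>. The nonlinear part of the conjugacy equation thus never
  interferes with the leading term of the linear part.\<close>

lemma comp_op_diff_ord_gt:
  assumes "ord_gt 0 u" "ord_gt 0 u'" "ord_ge e (u - u')" "0 < e" "ord_gt 0 f"
  shows "ord_gt (e + shift e) (comp_op 0 u k f - comp_op 0 u' k f)"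
proof -
  interpret substitution "scale_factor 0" "theta 0 u k" "supp u \<union> (\<Union>i<k. supp (log_ratio (hconst 0 + u) (Suc i)))"
    by (rule substitution_theta[OF assms(1)])
  interpret U: substitution "scale_factor 0" "theta 0 u' k" "supp u' \<union> (\<Union>i<k. supp (log_ratio (hconst 0 + u') (Suc i)))"
    by (rule substitution_theta[OF assms(2)])
  define D where "D x = hconst (coeff f x) * m x - hconst (coeff f x) * U.m x" for x
  have sD: "hsummable D" "hsum D = comp_op 0 u k f - comp_op 0 u' k f"
    unfolding D_def[abs_def] using hsum_diff[OF C_summable[of f] U.C_summable[of f]]
    by (simp_all add: comp_op_def hsubst_def)
  have "ord_gt (e + shift e) (D x)" for x
  proof (cases "x \<in> supp f")
    case True
    then have x: "0 < x" using assms(5) by (simp add: ord_gt_def)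
    have "D x = hconst (coeff f x) * (hmono 1 x * (hexp (theta 0 u k x) - hexp (theta 0 u' k x)))"
      by (simp add: D_def msub_def scale_factor_def right_diff_distrib)
    moreover have "ord_ge (x + (shift x + e)) (hmono 1 x * (hexp (theta 0 u k x) - hexp (theta 0 u' k x)))"
      by (intro ord_ge_mult ord_ge_hmono ord_ge_hexp_diff ord_gt_th U.ord_gt_th theta_diff assms x)
    ultimately have "ord_ge (x + (shift x + e)) (D x)" by (simp add: ord_ge_hconst_times)
    moreover have "e + shift e < x + (shift x + e)"
      using shift_less_add_shift[OF x assms(4)] by (simp add: algebra_simps)
    ultimately show ?thesis by (rule ord_ge_imp_ord_gt)
  qed (simp add: D_def supp_iff)
  then show ?thesis unfolding sD(2)[symmetric] by (rule ord_gt_hsum[OF sD(1)])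
qed

text \<open>With \<open>f = exp c * z * exp E\<close>, \<open>f\<^sub>0 = exp c * z * exp E0\<close> and \<open>\<phi> = z * exp u\<close>, taking logarithms
  turns \<open>\<phi> \<circ> f = f\<^sub>0 \<circ> \<phi>\<close> into the following equation for \<open>u\<close>.\<close>

lemma conjugacy_equation:
  assumes "c < 0" and E: "ord_gt 0 E" "supp E \<subseteq> depth k" and E0: "ord_gt 0 E0" "supp E0 \<subseteq> depth k"
    and EE0: "ord_gt (ones k) (E - E0)"
  shows "\<exists>!u. supp u \<subseteq> pos_depth k \<and> E + comp_op c E k u = u + comp_op 0 u k E0"
proof -
  \<comment> \<open>Grouped as inhomogeneity, linear operator and nonlinear perturbation; the last
    two vanish at \<open>u = 0\<close>, so \<open>Q 0 = E - E0\<close>.\<close>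
  define Q where "Q u = (E - E0) + (comp_op c E k u - u) - (comp_op 0 u k E0 - E0)" for u
  interpret triangular Q "\<lambda>e. e + shift e" "shift_coeff c" "pos_depth k"
  proof
    fix u v e assume uv: "supp u \<subseteq> pos_depth k" "supp v \<subseteq> pos_depth k" "ord_ge e (u - v)" "coeff (u - v) e \<noteq> 0"
    have sub: "supp (u - v) \<subseteq> pos_depth k" using uv(1,2) supp_minus[of u v] by blast
    have e: "e \<in> pos_depth k" using sub uv(4) by (auto simp: supp_def)
    have s: "ord_gt 0 u" "ord_gt 0 v" using uv(1,2) by (auto simp: supp_pos_depth_iff)
    have eq: "Q u - Q v = (comp_op c E k (u - v) - (u - v)) - (comp_op 0 u k E0 - comp_op 0 v k E0)"
      by (simp add: Q_def comp_op_diff[OF E(1)])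
    note L = comp_op_minus_id_lead[OF E(1) sub uv(3) e, of c]
    have tser_of: "ord_gt (e + shift e) (comp_op 0 u k E0 - comp_op 0 v k E0)"
      using e by (intro comp_op_diff_ord_gt s uv(3) E0(1)) (simp add: pos_depth_def)
    show "ord_ge (e + shift e) (Q u - Q v) \<and> coeff (Q u - Q v) (e + shift e) = shift_coeff c e * coeff (u - v) e"
      unfolding eq using ord_ge_diff[OF L(1) ord_gt_imp_ord_ge[OF tser_of]] L(2) ord_gtD[OF tser_of, of "e + shift e"]
      by (simp del: coeff_minus add: coeff_minus[of "_ - _" "comp_op 0 u k E0 - comp_op 0 v k E0"])
  next
    fix e e' assume "e \<in> pos_depth k" "e' \<in> pos_depth k" "e < e'"
    then show "e + shift e < e' + shift e'" by (auto simp: pos_depth_def intro: add_shift_mono)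
  next
    fix e assume "e \<in> pos_depth k"
    then show "shift_coeff c e \<noteq> 0" using assms(1) shift_coeff_nonzero[of e c] by (simp add: pos_depth_def)
  qed
  have Q_iff: "Q u = 0 \<longleftrightarrow> E + comp_op c E k u = u + comp_op 0 u k E0" for u
  proof -
    have "Q u = (E + comp_op c E k u) - (u + comp_op 0 u k E0)" by (simp add: Q_def)
    then show ?thesis by (simp only: right_minus_eq)
  qed
  have "\<exists>u. supp u \<subseteq> pos_depth k \<and> Q u = 0"
  proof (rule solution_exists)
    fix u v assume u: "supp u \<subseteq> pos_depth k" and v: "ord_ge v (Q u)" "coeff (Q u) v \<noteq> 0"
    have u': "ord_gt 0 u" "supp u \<subseteq> depth k" using u by (auto simp: supp_pos_depth_iff)
    have "supp (Q u) \<subseteq> depth k"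
      unfolding Q_def using E E0 u' by (intro depth_plus depth_minus supp_comp_op)
    then have "v \<in> depth k" using v(2) by (auto simp: supp_def)
    have Q0: "Q 0 = E - E0" by (simp add: Q_def comp_op_0[OF E(1)] comp_op_id)
    \<comment> \<open>\<open>Q 0\<close> lies beyond \<open>ones k\<close> by \<open>EE0\<close>,
      and \<open>Q u - Q 0\<close> does because its order is at least some
      \<open>e + shift e\<close>. Together with the depth bound this puts the leading exponent of
      \<open>Q u\<close> in the range of the exponent map.\<close>
    have "ord_gt (ones k) (Q u)"
    proof (cases "u = 0")
      case False
      then obtain e where e: "ord_ge e u" "coeff u e \<noteq> 0" by (rule lead_exists)
      then have "0 < e" using u by (auto simp: pos_depth_def supp_def)
      have "ord_ge (e + shift e) (Q u - Q 0)" using Q_diff[of u 0 e] u e by simp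
      then have "ord_gt (ones k) (Q u - Q 0)" by (rule ord_ge_imp_ord_gt[OF _ ones_less_add_shift[OF \<open>0 < e\<close>]])
      then show ?thesis using ord_gt_add[OF _ EE0] Q0 by fastforce
    qed (simp add: Q0 EE0)
    then have "ones k < v" using v(2) by (auto simp: ord_gt_def supp_iff)
    then obtain e where "e \<in> depth k" "0 < e" "v = e + shift e" using depth_shift_surj[OF \<open>v \<in> depth k\<close>] by blast
    then show "v \<in> (\<lambda>e. e + shift e) ` pos_depth k" by (auto simp: pos_depth_def)
  qed
  then show ?thesis unfolding Q_iff[symmetric] using unique_solution by blast
qed

section \<open>Transseries as Hahn series\<close>

text \<open>The image consists exactly of the coefficient functions with well-ordered support.
  Operations on raw functions are compared with those on Hahn series on this image only.\<close>

definition tser_of :: "lexp hahn \<Rightarrow> tser" where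
  "tser_of f = (\<lambda>e. coeff f (Lexp e))"

definition hahn_of :: "tser \<Rightarrow> lexp hahn" where
  "hahn_of f = Hahn (\<lambda>x. f (expo_of x))"

lemma tser_of_apply: "tser_of f e = coeff f (Lexp e)"
  by (simp add: tser_of_def)

lemma tser_of_inject: "tser_of f = tser_of g \<longleftrightarrow> f = g"
proof
  assume "tser_of f = tser_of g"
  then have "coeff f (Lexp (expo_of x)) = coeff g (Lexp (expo_of x))" for x by (metis tser_of_apply)
  then show "f = g" by (intro hahn_eqI) simp
qed simp

lemma less_eq_Lexp: "Lexp a \<le> Lexp b \<longleftrightarrow> lex_le a b"
  by (simp add: less_eq_lexp_def)

lemma coeff_hahn_of:
  assumes "lex_well_ordered (ts_supp f)" shows "coeff (hahn_of f) x = f (expo_of x)"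
proof -
  have "well_ordered {x. f (expo_of x) \<noteq> 0}"
    unfolding well_ordered_def
  proof (intro allI impI)
    fix T assume T: "T \<subseteq> {x. f (expo_of x) \<noteq> 0}" "T \<noteq> {}"
    then have "expo_of ` T \<subseteq> ts_supp f" "expo_of ` T \<noteq> {}" by (auto simp: ts_supp_def)
    then obtain y where "y \<in> expo_of ` T" "\<forall>z\<in>expo_of ` T. lex_le y z"
      using assms unfolding lex_well_ordered_def by meson
    then show "\<exists>x\<in>T. \<forall>y\<in>T. x \<le> y" by (auto simp: less_eq_lexp_def)
  qed
  then show ?thesis unfolding hahn_of_def by (simp add: coeff_Hahn)
qed

lemma tser_of_hahn_of: "lex_well_ordered (ts_supp f) \<Longrightarrow> tser_of (hahn_of f) = f"
  by (simp add: fun_eq_iff tser_of_apply coeff_hahn_of)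

lemma ts_supp_tser_of: "e \<in> ts_supp (tser_of f) \<longleftrightarrow> Lexp e \<in> supp f"
  by (simp add: ts_supp_def tser_of_apply supp_iff)

lemma lex_well_ordered_tser_of: "lex_well_ordered (ts_supp (tser_of f))"
  unfolding lex_well_ordered_def
proof (intro allI impI)
  fix T assume T: "T \<subseteq> ts_supp (tser_of f)" "T \<noteq> {}"
  then have "Lexp ` T \<subseteq> supp f" "Lexp ` T \<noteq> {}" by (auto simp: ts_supp_tser_of)
  then have "\<exists>x\<in>Lexp ` T. \<forall>y\<in>Lexp ` T. x \<le> y" by (rule well_orderedD[OF well_ordered_supp])
  then show "\<exists>x\<in>T. \<forall>y\<in>T. lex_le x y" by (auto simp: less_eq_Lexp)
qed

lemma Lk_tser_of: "Lk k (tser_of f) \<longleftrightarrow> supp f \<subseteq> depth k \<and> (\<forall>e\<in>supp f. 0 \<le> zdeg e)"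
proof
  assume L: "Lk k (tser_of f)"
  have "0 \<le> zdeg e \<and> e \<in> depth k" if "e \<in> supp f" for e
  proof -
    have "expo_of e \<in> ts_supp (tser_of f)" using that by (simp add: ts_supp_tser_of)
    then show ?thesis using L by (auto simp: Lk_def depth_def zdeg_def ldeg_def)
  qed
  then show "supp f \<subseteq> depth k \<and> (\<forall>e\<in>supp f. 0 \<le> zdeg e)" by blast
next
  assume A: "supp f \<subseteq> depth k \<and> (\<forall>e\<in>supp f. 0 \<le> zdeg e)"
  have "fst e \<ge> 0 \<and> (\<forall>j\<ge>k. snd e j = 0)" if "e \<in> ts_supp (tser_of f)" for e
  proof -
    have "Lexp e \<in> supp f" using that by (simp add: ts_supp_tser_of)
    then have "Lexp e \<in> depth k" "0 \<le> zdeg (Lexp e)" using A by auto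
    then show ?thesis by (simp add: depth_def)
  qed
  then show "Lk k (tser_of f)" by (simp add: Lk_def lex_well_ordered_tser_of)
qed

lemma lead_lin_tser_of: "lead_lin c (tser_of f) \<longleftrightarrow> coeff f z_lexp = c \<and> ord_ge z_lexp f"
proof -
  have "(\<forall>e\<in>ts_supp (tser_of f). lex_le z_exp e) \<longleftrightarrow> ord_ge z_lexp f"
    unfolding ord_ge_def z_lexp_def
  proof (intro iffI ballI)
    fix x assume "\<forall>e\<in>ts_supp (tser_of f). lex_le z_exp e" "x \<in> supp f"
    then have "lex_le z_exp (expo_of x)" by (simp add: ts_supp_tser_of)
    then show "Lexp z_exp \<le> x" by (simp add: less_eq_lexp_def)
  next
    fix e assume "\<forall>x\<in>supp f. Lexp z_exp \<le> x" "e \<in> ts_supp (tser_of f)"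
    then have "Lexp z_exp \<le> Lexp e" by (simp add: ts_supp_tser_of)
    then show "lex_le z_exp e" by (simp only: less_eq_Lexp)
  qed
  then show ?thesis by (auto simp: lead_lin_def tser_of_apply z_lexp_def)
qed

lemma ts_mono_tser_of: "ts_mono c e = tser_of (hmono c (Lexp e))"
  by (auto simp: fun_eq_iff ts_mono_def tser_of_apply coeff_hmono Lexp_inject)

lemma ts_one_tser_of: "ts_one = tser_of 1"
  by (simp add: ts_one_def ts_mono_tser_of one_hahn_def zero_lexp_def)

lemma ts_z_tser_of: "ts_z = tser_of (hmono 1 z_lexp)"
  by (simp add: ts_z_def ts_mono_tser_of z_lexp_def)

lemma ts_add_tser_of: "ts_add (tser_of f) (tser_of g) = tser_of (f + g)"
  by (simp add: ts_add_def tser_of_def)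

lemma ts_scale_tser_of: "ts_scale c (tser_of f) = tser_of (hconst c * f)"
  by (simp add: ts_scale_def tser_of_def)

lemma ts_mult_tser_of: "ts_mult (tser_of f) (tser_of g) = tser_of (f * g)"
proof
  fix e
  let ?A = "{a. coeff f a * coeff g (Lexp e - a) \<noteq> 0}"
  let ?h = "\<lambda>a. (expo_of a, expo_of (Lexp e - a))"
  have plus: "Lexp (eadd a b) = Lexp a + Lexp b" for a b by (simp add: plus_lexp_def)
  have eq: "{(e1, e2). eadd e1 e2 = e \<and> tser_of f e1 \<noteq> 0 \<and> tser_of g e2 \<noteq> 0} = ?h ` ?A"
  proof (intro equalityI subsetI)
    fix p assume "p \<in> {(e1, e2). eadd e1 e2 = e \<and> tser_of f e1 \<noteq> 0 \<and> tser_of g e2 \<noteq> 0}"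
    then obtain e1 e2 where p: "p = (e1, e2)" "eadd e1 e2 = e" "tser_of f e1 \<noteq> 0" "tser_of g e2 \<noteq> 0" by blast
    have "Lexp e - Lexp e1 = Lexp e2" using plus[of e1 e2] p(2) by simp
    then have "Lexp e1 \<in> ?A" "p = ?h (Lexp e1)" using p by (auto simp: tser_of_apply)
    then show "p \<in> ?h ` ?A" by blast
  next
    fix p assume "p \<in> ?h ` ?A"
    then obtain a where a: "p = ?h a" "a \<in> ?A" by blast
    have "Lexp (eadd (expo_of a) (expo_of (Lexp e - a))) = Lexp e" by (simp add: plus)
    then show "p \<in> {(e1, e2). eadd e1 e2 = e \<and> tser_of f e1 \<noteq> 0 \<and> tser_of g e2 \<noteq> 0}"
      using a by (simp add: tser_of_apply Lexp_inject)
  qed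
  have "inj_on ?h ?A" by (auto simp: inj_on_def expo_of_inject)
  then have "ts_mult (tser_of f) (tser_of g) e = (\<Sum>a\<in>?A. coeff f a * coeff g (Lexp e - a))"
    unfolding ts_mult_def eq by (subst sum.reindex) (simp_all add: tser_of_apply)
  then show "ts_mult (tser_of f) (tser_of g) e = tser_of (f * g) e"
    by (simp add: tser_of_apply coeff_times Sum_any.expand_set)
qed

lemma ts_pow_tser_of: "ts_pow (tser_of f) n = tser_of (f ^ n)"
  by (induction n) (simp_all add: ts_one_tser_of ts_mult_tser_of)

lemma ts_sum_tser_of: "hsummable F \<Longrightarrow> ts_sum (\<lambda>i. tser_of (F i)) = tser_of (hsum F)"
  by (simp add: fun_eq_iff ts_sum_def tser_of_apply coeff_hsum Sum_any.expand_set)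

lemma ts_fin_prod_tser_of: "ts_fin_prod (\<lambda>i. tser_of (F i)) n = tser_of (\<Prod>i<n. F i)"
  by (induction n) (simp_all add: ts_one_tser_of ts_mult_tser_of mult.commute)

lemma ts_fps_eval_tser_of: "ord_gt 0 d \<Longrightarrow> ts_sum (\<lambda>j. ts_scale (fps_nth F j) (ts_pow (tser_of d) j)) = tser_of (fps_eval d F)"
  unfolding fps_eval_def by (simp add: ts_pow_tser_of ts_scale_tser_of ts_sum_tser_of fps_eval_summable)

lemma ts_binom_tser_of:
  assumes "ord_gt 0 d" shows "ts_binom a (tser_of d) = tser_of (hexp (hconst a * hln1 d))"
  using ts_fps_eval_tser_of[OF assms, of "fps_binomial a"] by (simp add: ts_binom_def fps_eval_binomial assms)

lemma ts_log1p_tser_of: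
  assumes "ord_gt 0 d" shows "ts_log1p (tser_of d) = tser_of (hln1 d)"
proof -
  have "(if j = 0 then ts_zero else ts_scale ((-1) ^ (j + 1) / real j) (ts_pow (tser_of d) j))
    = ts_scale (fps_nth (fps_ln 1) j) (ts_pow (tser_of d) j)" for j
    by (cases j) (auto simp: fps_ln_def ts_scale_def ts_zero_def)
  then show ?thesis using ts_fps_eval_tser_of[OF assms, of "fps_ln 1"] by (simp add: ts_log1p_def hln1_def)
qed

lemma ts_geo1_tser_of:
  assumes "ord_gt 0 d" shows "ts_geo1 (tser_of d) = tser_of (fps_eval d fps_geo1)"
proof -
  have "(if j = 0 then ts_zero else ts_pow (tser_of d) j) = ts_scale (fps_nth fps_geo1 j) (ts_pow (tser_of d) j)" for j
    by (auto simp: fps_geo1_def ts_scale_def ts_zero_def)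
  then show ?thesis using ts_fps_eval_tser_of[OF assms, of fps_geo1] by (simp add: ts_geo1_def)
qed

subsection \<open>Series with leading term a multiple of z\<close>

lemma coeff_lin_exp: "coeff (lin_exp c u) x = exp c * coeff (hexp u) (x - z_lexp)"
  by (simp add: lin_exp_def coeff_hmono_times)

lemma coeff_hexp_0: "ord_gt 0 u \<Longrightarrow> coeff (hexp u) 0 = 1"
  using ord_gtD[OF ord_gt_hexp, of u 0] by (simp add: coeff_one)

lemma lin_exp_lead: "ord_gt 0 u \<Longrightarrow> coeff (lin_exp c u) z_lexp = exp c \<and> ord_ge z_lexp (lin_exp c u)"
  using ord_ge_mult[OF ord_ge_hmono ord_ge_fps_eval, of u z_lexp "exp c" "fps_exp 1"]
  by (simp add: coeff_lin_exp coeff_hexp_0) (simp add: lin_exp_def hexp_def)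

lemma lin_exp_0: "lin_exp 0 0 = hmono 1 z_lexp"
  by (simp add: lin_exp_def)

lemma lin_exp_inj:
  assumes "ord_gt 0 u" "ord_gt 0 v" "lin_exp c u = lin_exp c v" shows "u = v"
proof -
  have "hmono (exp (- c)) (- z_lexp) * lin_exp c w = hexp w" for w
    by (simp add: lin_exp_def mult.assoc[symmetric] hmono_mult exp_add[symmetric] hmono_one_zero)
  then have "hexp u = hexp v" using assms(3) by metis
  then show ?thesis by (rule hexp_inj[OF assms(1,2)])
qed

lemma supp_lin_exp: "ord_gt 0 u \<Longrightarrow> supp u \<subseteq> depth k \<Longrightarrow> supp (lin_exp c u) \<subseteq> depth k"
  unfolding lin_exp_def hexp_def by (intro depth_times depth_hmono depth_z_lexp depth_fps_eval)

lemma lin_exp_exists: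
  assumes "ord_ge z_lexp h" "coeff h z_lexp = lam" "0 < lam" "supp h \<subseteq> depth k"
  shows "h = lin_exp (ln lam) (hln1 (hmono (1 / lam) (- z_lexp) * h - 1))"
    "ord_gt 0 (hmono (1 / lam) (- z_lexp) * h - 1)"
    "supp (hln1 (hmono (1 / lam) (- z_lexp) * h - 1)) \<subseteq> pos_depth k"
proof -
  let ?eps = "hmono (1 / lam) (- z_lexp) * h - 1"
  have "ord_ge (- z_lexp + z_lexp) (hmono (1 / lam) (- z_lexp) * h)" by (intro ord_ge_mult ord_ge_hmono assms)
  then have "ord_ge 0 ?eps" by (intro ord_ge_diff ord_ge_one) simp
  then show s: "ord_gt 0 ?eps" using assms(2,3) by (simp add: ord_gt_iff coeff_hmono_times coeff_one)
  have "lin_exp (ln lam) (hln1 ?eps) = hmono lam z_lexp * (hmono (1 / lam) (- z_lexp) * h)"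
    using hexp_hln1[OF s] assms(3) by (simp add: lin_exp_def)
  then show "h = lin_exp (ln lam) (hln1 ?eps)"
    using assms(3) by (simp add: mult.assoc[symmetric] hmono_mult hmono_one_zero)
  have "- z_lexp \<in> depth k" by (simp add: depth_def)
  then have "supp (hmono (1 / lam) (- z_lexp) * h) \<subseteq> depth k" by (intro depth_times depth_hmono assms(4))
  moreover have "supp 1 \<subseteq> depth k" by (simp add: supp_one depth_0)
  ultimately have "supp ?eps \<subseteq> depth k" by (rule depth_minus)
  then have "supp (hln1 ?eps) \<subseteq> depth k" unfolding hln1_def by (intro depth_fps_eval s)
  then show "supp (hln1 ?eps) \<subseteq> pos_depth k" by (simp add: supp_pos_depth_iff ord_gt_hln1 s)
qed

lemma Lk_lin_exp: "supp u \<subseteq> pos_depth k \<Longrightarrow> Lk k (tser_of (lin_exp c u))"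
proof -
  assume "supp u \<subseteq> pos_depth k"
  then have u: "ord_gt 0 u" "supp u \<subseteq> depth k" by (auto simp: supp_pos_depth_iff)
  have "0 \<le> zdeg e" if "e \<in> supp (lin_exp c u)" for e
  proof -
    have "z_lexp \<le> e" using lin_exp_lead[OF u(1), of c] that by (simp add: ord_ge_def)
    then show ?thesis by (auto simp: le_less less_lexp_iff)
  qed
  then show ?thesis by (simp add: Lk_tser_of supp_lin_exp u)
qed

lemma Lk0_iff_lin_exp: "Lk0 k phi \<longleftrightarrow> (\<exists>u. supp u \<subseteq> pos_depth k \<and> phi = tser_of (lin_exp 0 u))"
proof
  assume L: "Lk0 k phi"
  then have phi: "tser_of (hahn_of phi) = phi" by (intro tser_of_hahn_of) (simp add: Lk0_def Lk_def)
  then have "Lk k (tser_of (hahn_of phi))" "lead_lin 1 (tser_of (hahn_of phi))"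
    using L by (auto simp: Lk0_def parabolic_def)
  then have "ord_ge z_lexp (hahn_of phi)" "coeff (hahn_of phi) z_lexp = 1" "supp (hahn_of phi) \<subseteq> depth k"
    by (auto simp: Lk_tser_of lead_lin_tser_of)
  from lin_exp_exists[OF this(1,2) zero_less_one this(3)]
  show "\<exists>u. supp u \<subseteq> pos_depth k \<and> phi = tser_of (lin_exp 0 u)" using phi by (metis ln_one)
next
  assume "\<exists>u. supp u \<subseteq> pos_depth k \<and> phi = tser_of (lin_exp 0 u)"
  then obtain u where u: "supp u \<subseteq> pos_depth k" "phi = tser_of (lin_exp 0 u)" by blast
  then have "ord_gt 0 u" by (simp add: supp_pos_depth_iff)
  then show "Lk0 k phi" using Lk_lin_exp[OF u(1), of 0] lin_exp_lead[of u 0] u(2)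
    by (simp add: Lk0_def parabolic_def lead_lin_tser_of)
qed

lemma pos_depth_mono: "k \<le> l \<Longrightarrow> pos_depth k \<subseteq> pos_depth l"
  using depth_mono[of k l] by (auto simp: pos_depth_def)

subsection \<open>Composition\<close>

context
  fixes c :: real and u :: "lexp hahn"
  assumes u: "ord_gt 0 u"
begin

lemma ts_lam_lin_exp: "ts_lam (tser_of (lin_exp c u)) = exp c"
  using lin_exp_lead[OF u, of c] by (simp add: ts_lam_def tser_of_apply z_lexp_def)

lemma ts_eps_lin_exp: "ts_eps (tser_of (lin_exp c u)) = tser_of (hexp u - 1)"
proof
  fix e
  have "Lexp (fst e + 1, snd e) - z_lexp = Lexp e" by (rule lexp_eqI) simp_all
  moreover have "e = zero_exp \<longleftrightarrow> Lexp e = 0" by (simp add: zero_lexp_def Lexp_inject)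
  ultimately show "ts_eps (tser_of (lin_exp c u)) e = tser_of (hexp u - 1) e"
    using coeff_hexp_0[OF u] by (simp add: ts_eps_def ts_lam_lin_exp tser_of_apply coeff_lin_exp coeff_one)
qed

text \<open>\<open>1 + ts_delta (Suc j)\<close> is \<open>1 / (1 - x)\<close> with
  \<open>x = ell (Suc j) * log_ratio (hconst c + u) j\<close>, so its logarithm
  \<open>- hln1 (- x)\<close> is the next logarithmic ratio. The logarithm of \<open>ts_lam\<close>
  enters only at \<open>j = 0\<close>, where it supplies \<open>c\<close>.\<close>

lemma ts_log_delta:
  "ts_add (ts_mono (if j = 0 then ln (ts_lam (tser_of (lin_exp c u))) else 0) zero_exp) (ts_log1p (ts_delta (tser_of (lin_exp c u)) j))
     = tser_of (log_ratio (hconst c + u) j)"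
  "ts_delta (tser_of (lin_exp c u)) (Suc j) = tser_of (fps_eval (ell (Suc j) * log_ratio (hconst c + u) j) fps_geo1)"
proof -
  note w = ord_ge_hconst_plus[OF u, of c]
  have delta: "ts_delta (tser_of (lin_exp c u)) (Suc j) = tser_of (fps_eval (ell (Suc j) * log_ratio (hconst c + u) j) fps_geo1)"
    if "ts_add (ts_mono (if j = 0 then ln (ts_lam (tser_of (lin_exp c u))) else 0) zero_exp) (ts_log1p (ts_delta (tser_of (lin_exp c u)) j))
     = tser_of (log_ratio (hconst c + u) j)" for j
    unfolding ts_delta.simps that
    by (simp add: ts_mono_tser_of ts_mult_tser_of ell_lexp_def[symmetric] ts_geo1_tser_of ord_gt_ell_log_ratio[OF w])
  show *: "ts_add (ts_mono (if j = 0 then ln (ts_lam (tser_of (lin_exp c u))) else 0) zero_exp) (ts_log1p (ts_delta (tser_of (lin_exp c u)) j))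
     = tser_of (log_ratio (hconst c + u) j)" for j
  proof (induction j)
    case 0
    show ?case
      by (simp add: ts_eps_lin_exp ts_log1p_tser_of ord_gt_hexp u hln1_hexp ts_lam_lin_exp ts_mono_tser_of ts_add_tser_of hconst_def zero_lexp_def[symmetric])
  next
    case (Suc j)
    note s = ord_gt_ell_log_ratio[OF w, of j]
    show ?case
      unfolding delta[OF Suc]
      by (simp add: ts_log1p_tser_of fps_eval_geo1(2)[OF s] hln1_geo1[OF s] ts_mono_tser_of ts_add_tser_of)
  qed
  show "ts_delta (tser_of (lin_exp c u)) (Suc j) = tser_of (fps_eval (ell (Suc j) * log_ratio (hconst c + u) j) fps_geo1)" by (rule delta[OF *])
qed

lemma ts_binom_delta:
  "ts_binom a (ts_delta (tser_of (lin_exp c u)) 0) = tser_of (hexp (hconst a * u))"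
  "ts_binom a (ts_delta (tser_of (lin_exp c u)) (Suc j)) = tser_of (hexp (hconst a * log_ratio (hconst c + u) (Suc j)))"
proof -
  note s = ord_gt_ell_log_ratio[OF ord_ge_hconst_plus[OF u, of c], of j]
  show "ts_binom a (ts_delta (tser_of (lin_exp c u)) 0) = tser_of (hexp (hconst a * u))"
    by (simp add: ts_eps_lin_exp ts_binom_tser_of ord_gt_hexp u hln1_hexp)
  show "ts_binom a (ts_delta (tser_of (lin_exp c u)) (Suc j)) = tser_of (hexp (hconst a * log_ratio (hconst c + u) (Suc j)))"
    unfolding ts_log_delta(2) by (simp add: ts_binom_tser_of fps_eval_geo1(2)[OF s] hln1_geo1[OF s])
qed

lemma hexp_sum: "(\<And>i. i \<in> A \<Longrightarrow> ord_gt 0 (F i)) \<Longrightarrow> hexp (sum F A) = (\<Prod>i\<in>A. hexp (F i))"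
  by (induction A rule: infinite_finite_induct) (simp_all add: hexp_add ord_gt_sum)

lemma mono_comp_lin_exp:
  assumes "Lexp e \<in> depth k"
  shows "mono_comp (tser_of (lin_exp c u)) e = tser_of (msub (scale_factor c) (theta c u k) (Lexp e))"
proof -
  let ?b = "exp_bound e"
  have fin: "\<forall>j\<ge>k. snd e j = 0" using assms by (simp add: depth_def)
  have bk: "?b \<le> k" unfolding exp_bound_def by (rule Least_le) (rule fin)
  have b0: "\<forall>j\<ge>?b. snd e j = 0" unfolding exp_bound_def by (rule LeastI) (rule fin)
  have s: "ord_gt 0 (hconst (of_int (snd e i)) * log_ratio (hconst c + u) (Suc i))" for i
    by (intro ord_gt_hconst_times ord_gt_log_ratio ord_ge_hconst_plus u)
  have "ts_fin_prod (\<lambda>i. ts_binom (of_int (snd e i)) (ts_delta (tser_of (lin_exp c u)) (Suc i))) ?b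
    = tser_of (\<Prod>i<?b. hexp (hconst (of_int (snd e i)) * log_ratio (hconst c + u) (Suc i)))"
    unfolding ts_binom_delta by (rule ts_fin_prod_tser_of)
  also have "(\<Prod>i<?b. hexp (hconst (of_int (snd e i)) * log_ratio (hconst c + u) (Suc i)))
    = hexp (\<Sum>i<?b. hconst (of_int (snd e i)) * log_ratio (hconst c + u) (Suc i))"
    by (rule hexp_sum[symmetric]) (rule s)
  \<comment> \<open>The sum is extended from \<open>exp_bound e\<close> to the depth
    \<open>k\<close>; the added exponents are zero.\<close>
  also have "(\<Sum>i<?b. hconst (of_int (snd e i)) * log_ratio (hconst c + u) (Suc i))
    = (\<Sum>i<k. hconst (of_int (snd e i)) * log_ratio (hconst c + u) (Suc i))"
    by (rule sum.mono_neutral_left) (use bk b0 in auto)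
  finally have prod: "ts_fin_prod (\<lambda>i. ts_binom (of_int (snd e i)) (ts_delta (tser_of (lin_exp c u)) (Suc i))) ?b
    = tser_of (hexp (\<Sum>i<k. hconst (of_int (snd e i)) * log_ratio (hconst c + u) (Suc i)))" .
  have "hexp (theta c u k (Lexp e)) = hexp (hconst (fst e) * u) * hexp (\<Sum>i<k. hconst (of_int (snd e i)) * log_ratio (hconst c + u) (Suc i))"
    unfolding theta_def zdeg_ldeg_Lexp by (intro hexp_add ord_gt_hconst_times u ord_gt_sum s)
  moreover have "ts_lam (tser_of (lin_exp c u)) powr fst e = scale_factor c (Lexp e)"
    by (simp add: ts_lam_lin_exp scale_factor_def powr_def mult.commute)
  ultimately show ?thesis
    unfolding mono_comp_def prod unfolding ts_binom_delta by (simp add: ts_mono_tser_of ts_mult_tser_of msub_def)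
qed

lemma ts_comp_lin_exp:
  assumes "supp f \<subseteq> depth k"
  shows "ts_comp (tser_of f) (tser_of (lin_exp c u)) = tser_of (comp_op c u k f)"
proof -
  interpret substitution "scale_factor c" "theta c u k" "supp u \<union> (\<Union>i<k. supp (log_ratio (hconst c + u) (Suc i)))"
    by (rule substitution_theta[OF u])
  have "ts_scale (tser_of f e) (mono_comp (tser_of (lin_exp c u)) e) = tser_of (hconst (coeff f (Lexp e)) * m (Lexp e))" for e
  proof (cases "Lexp e \<in> supp f")
    case True
    then have "Lexp e \<in> depth k" using assms by blast
    then show ?thesis by (simp add: mono_comp_lin_exp tser_of_apply ts_scale_tser_of)
  next
    \<comment> \<open>Outside the support, where \<open>e\<close> may have any depth,
      \<open>mono_comp\<close> is not controlled, but it is multiplied by zero.\<close>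
    case False
    then show ?thesis by (simp add: tser_of_apply supp_iff ts_scale_def) (simp add: tser_of_def)
  qed
  then have eq: "ts_comp (tser_of f) (tser_of (lin_exp c u)) = ts_sum (\<lambda>e. tser_of (hconst (coeff f (Lexp e)) * m (Lexp e)))"
    by (simp add: ts_comp_def)
  have b: "bij_betw expo_of UNIV UNIV"
    by (rule bij_betw_byWitness[where f' = Lexp]) auto
  have s: "hsummable (\<lambda>e. hconst (coeff f (Lexp e)) * m (Lexp e))"
    "hsum (\<lambda>e. hconst (coeff f (Lexp e)) * m (Lexp e)) = C f"
    unfolding hsubst_def by (rule hsum_reindex[OF b _ _ _ C_summable[of f]]; simp)+
  show ?thesis unfolding eq ts_sum_tser_of[OF s(1)] s(2) comp_op_def ..
qed

end

lemma ts_comp_lin_exp_lin_exp: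
  assumes "supp u \<subseteq> pos_depth k" "supp v \<subseteq> pos_depth k"
  shows "ts_comp (tser_of (lin_exp c v)) (tser_of (lin_exp d u)) = tser_of (lin_exp (c + d) (u + comp_op d u k v))"
  using assms ts_comp_lin_exp[of u "lin_exp c v" k d] supp_lin_exp[of v k c] comp_op_lin_exp[of u v d k c]
  by (simp add: supp_pos_depth_iff)

lemma pos_depth_compose:
  assumes "supp u \<subseteq> pos_depth k" "supp v \<subseteq> pos_depth k"
  shows "supp (u + comp_op d u k v) \<subseteq> pos_depth k"
  using assms unfolding supp_pos_depth_iff
  by (intro conjI ord_gt_add ord_gt_comp_op depth_plus supp_comp_op) auto

text \<open>\<open>ts_inv\<close> ranges over all depths, so a second inverse of depth
  \<open>l\<close> is compared with \<open>v\<close> at depth \<open>max k l\<close>, where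
  composition with \<open>lin_exp 0 u\<close> is injective.\<close>

lemma ts_inv_lin_exp:
  assumes u: "supp u \<subseteq> pos_depth k" and v: "supp v \<subseteq> pos_depth k" and uv: "u + comp_op 0 u k v = 0"
  shows "ts_inv (tser_of (lin_exp 0 u)) = tser_of (lin_exp 0 v)"
  unfolding ts_inv_def
proof (rule the_equality)
  have vu: "v + comp_op 0 v k u = 0"
    using left_inverse_imp_right_inverse[of u k v] u v uv by (simp add: supp_pos_depth_iff)
  have "LL0 (tser_of (lin_exp 0 v))" using v Lk0_iff_lin_exp LL0_def by blast
  then show "LL0 (tser_of (lin_exp 0 v)) \<and> ts_comp (tser_of (lin_exp 0 u)) (tser_of (lin_exp 0 v)) = ts_z \<and>
      ts_comp (tser_of (lin_exp 0 v)) (tser_of (lin_exp 0 u)) = ts_z"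
    by (simp add: ts_comp_lin_exp_lin_exp[OF v u] ts_comp_lin_exp_lin_exp[OF u v] uv vu ts_z_tser_of lin_exp_0)
next
  fix psi assume psi: "LL0 psi \<and> ts_comp (tser_of (lin_exp 0 u)) psi = ts_z \<and> ts_comp psi (tser_of (lin_exp 0 u)) = ts_z"
  then obtain l w where w: "supp w \<subseteq> pos_depth l" "psi = tser_of (lin_exp 0 w)" using Lk0_iff_lin_exp LL0_def by metis
  define n where "n = max k l"
  have un: "supp u \<subseteq> pos_depth n" and vn: "supp v \<subseteq> pos_depth n" and wn: "supp w \<subseteq> pos_depth n"
    using u v w pos_depth_mono[of k n] pos_depth_mono[of l n] by (auto simp: n_def)
  have su: "ord_gt 0 u" "ord_gt 0 v" using un vn by (auto simp: supp_pos_depth_iff)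
  have "comp_op 0 u n v = comp_op 0 u k v"
    using v by (intro comp_op_depth) (auto simp: supp_pos_depth_iff n_def)
  then have uv': "u + comp_op 0 u n v = 0" using uv by simp
  have "tser_of (lin_exp 0 (u + comp_op 0 u n w)) = tser_of (lin_exp 0 0)"
    using psi ts_comp_lin_exp_lin_exp[OF un wn, of 0 0] by (simp add: w ts_z_tser_of lin_exp_0)
  then have "lin_exp 0 (u + comp_op 0 u n w) = lin_exp 0 0" by (simp only: tser_of_inject)
  then have "u + comp_op 0 u n w = 0"
    using pos_depth_compose[OF un wn, of 0] by (intro lin_exp_inj[of _ 0 0]) (simp_all add: supp_pos_depth_iff)
  then have "comp_op 0 u n w = comp_op 0 u n v" using uv' by (metis add_left_cancel)
  moreover have "v + comp_op 0 v n u = 0"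
    using left_inverse_imp_right_inverse[of u n v] un vn uv' by (simp add: supp_pos_depth_iff)
  then have "comp_op 0 v n (comp_op 0 u n x) = x" for x
    using comp_op_comp_op[OF su(2,1), of 0 n 0 x] by (simp add: comp_op_id)
  ultimately have "w = v" by metis
  then show "psi = tser_of (lin_exp 0 v)" using w by simp
qed

text \<open>Both sides have the form \<open>lin_exp c\<close>, so only their exponents need to be
  compared. Composing the exponents with \<open>lin_exp 0 u\<close> is injective and cancels the
  inverse.\<close>

lemma conjugate_iff:
  assumes u: "supp u \<subseteq> pos_depth k" and E: "supp E \<subseteq> pos_depth k" and E0: "supp E0 \<subseteq> pos_depth k"
  shows "ts_comp (tser_of (lin_exp 0 u)) (ts_comp (tser_of (lin_exp c E)) (ts_inv (tser_of (lin_exp 0 u)))) = tser_of (lin_exp c E0)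
    \<longleftrightarrow> E + comp_op c E k u = u + comp_op 0 u k E0"
proof -
  have su: "ord_gt 0 u" and sE: "ord_gt 0 E" and sE0: "ord_gt 0 E0"
    using u E E0 by (auto simp: supp_pos_depth_iff)
  obtain v where v: "supp v \<subseteq> pos_depth k" and uv: "u + comp_op 0 u k v = 0"
    using left_inverse_exists[of u k] u unfolding supp_pos_depth_iff by blast
  have sv: "ord_gt 0 v" using v by (simp add: supp_pos_depth_iff)
  have vu: "v + comp_op 0 v k u = 0"
    using left_inverse_imp_right_inverse[of u k v] u v uv by (simp add: supp_pos_depth_iff)
  have 1: "comp_op 0 u k (comp_op 0 v k x) = x" for x
    using comp_op_comp_op[OF su sv, of 0 k 0 x] uv by (simp add: comp_op_id)
  have 2: "comp_op 0 v k (comp_op 0 u k x) = x" for x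
    using comp_op_comp_op[OF sv su, of 0 k 0 x] vu by (simp add: comp_op_id)
  define W where "W = v + comp_op 0 v k E"
  have W: "supp W \<subseteq> pos_depth k" unfolding W_def by (rule pos_depth_compose[OF v E])
  have "ts_comp (tser_of (lin_exp 0 u)) (ts_comp (tser_of (lin_exp c E)) (ts_inv (tser_of (lin_exp 0 u)))) = tser_of (lin_exp c (W + comp_op c W k u))"
    using ts_comp_lin_exp_lin_exp[OF v E, of c 0] ts_comp_lin_exp_lin_exp[OF W u, of 0 c]
    by (simp add: ts_inv_lin_exp[OF u v uv] W_def)
  moreover have "comp_op c W k u = comp_op 0 v k (comp_op c E k u)"
    using comp_op_comp_op[OF sv sE, of 0 k c u] by (simp add: W_def)
  then have "W + comp_op c W k u = v + comp_op 0 v k (E + comp_op c E k u)"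
    by (simp add: W_def comp_op_add[OF sv] add.assoc)
  moreover have "ord_gt 0 (W + comp_op c W k u)" using pos_depth_compose[OF W u] by (simp add: supp_pos_depth_iff)
  ultimately have "ts_comp (tser_of (lin_exp 0 u)) (ts_comp (tser_of (lin_exp c E)) (ts_inv (tser_of (lin_exp 0 u)))) = tser_of (lin_exp c E0)
    \<longleftrightarrow> v + comp_op 0 v k (E + comp_op c E k u) = E0"
    using lin_exp_inj[OF _ sE0] by (auto simp: tser_of_inject)
  also have "\<dots> \<longleftrightarrow> comp_op 0 u k (v + comp_op 0 v k (E + comp_op c E k u)) = comp_op 0 u k E0"
    using 2 by metis
  also have "comp_op 0 u k (v + comp_op 0 v k (E + comp_op c E k u)) = (E + comp_op c E k u) - u"
    using uv by (simp add: comp_op_add[OF su] 1 eq_neg_iff_add_eq_0[symmetric] add.commute[of u])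
  also have "\<dots> = comp_op 0 u k E0 \<longleftrightarrow> E + comp_op c E k u = u + comp_op 0 u k E0"
    by (simp add: diff_eq_eq add.commute)
  finally show ?thesis .
qed

subsection \<open>The truncation\<close>

lemma trunc0_cases: "trunc0 k f e = f e \<or> trunc0 k f e = 0"
  by (simp add: trunc0_def)

lemma trunc0_z: "trunc0 k f z_exp = f z_exp"
proof -
  have "seq_le (\<lambda>_. 0) (ones_k k)"
  proof (cases k)
    case 0
    then show ?thesis by (simp add: seq_le_def ones_k_def)
  next
    case (Suc l)
    then show ?thesis by (auto simp: seq_le_def seq_less_def ones_k_def)
  qed
  then show ?thesis by (simp add: trunc0_def z_exp_def seq_le_def)
qed

lemma trunc0_lex_well_ordered: "lex_well_ordered (ts_supp f) \<Longrightarrow> lex_well_ordered (ts_supp (trunc0 k f))"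
proof -
  assume "lex_well_ordered (ts_supp f)"
  moreover have "ts_supp (trunc0 k f) \<subseteq> ts_supp f" by (auto simp: ts_supp_def trunc0_def)
  ultimately show ?thesis unfolding lex_well_ordered_def by (meson order_trans)
qed

text \<open>An exponent sequence of depth \<open>k\<close> above \<open>ones_k k\<close> exceeds it
  first at a position below \<open>k\<close>, where \<open>ones l\<close> still has the entry 1 for
  every \<open>l >= k\<close>. Having the bound for all these \<open>l\<close> permits comparison
  with a competitor of larger depth.\<close>

lemma trunc0_remainder:
  assumes "Lexp e \<in> depth k" "z_lexp \<le> Lexp e" "f e \<noteq> trunc0 k f e" "k \<le> l"
  shows "ones l < Lexp e - z_lexp"
proof (cases "1 < fst e")
  case True
  then show ?thesis by (simp add: less_lexp_iff)
next
  case False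
  then have zdeg: "fst e = 1" using assms(2) by (auto simp: le_less less_lexp_iff z_lexp_def z_exp_def Lexp_inject)
  have "lex_le z_exp e" using assms(2) by (simp add: z_lexp_def less_eq_Lexp)
  then have "seq_le (\<lambda>_. 0) (snd e)" using zdeg by (auto simp: lex_le_def lex_less_def seq_le_def z_exp_def)
  then have "\<not> seq_le (snd e) (ones_k k)" using assms(3) zdeg by (auto simp: trunc0_def)
  then have "seq_less (ones_k k) (snd e)" using seq_less_total[of "snd e" "ones_k k"] by (auto simp: seq_le_def)
  then obtain j where j: "ones_k k j < snd e j" "\<forall>i<j. ones_k k i = snd e i" by (auto simp: seq_less_def)
  have "j < k" using j(1) assms(1) by (cases "j < k") (auto simp: depth_def ones_k_def)
  then show ?thesis
    using zdeg assms(4) j by (intro less_lexpI[of _ _ j]) (auto simp: ones_k_def)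
qed

section \<open>Normalization of a hyperbolic transseries\<close>

theorem mainTheorem1:
  fixes k :: nat and f :: tser and lam :: real
  assumes "Lk k f"
    and "lead_lin lam f"
    and "0 < lam" and "lam < 1"
  shows "(\<exists>!phi. LL0 phi \<and> ts_comp phi (ts_comp f (ts_inv phi)) = trunc0 k f)
       \<and> (\<forall>phi. LL0 phi \<and> ts_comp phi (ts_comp f (ts_inv phi)) = trunc0 k f \<longrightarrow> Lk0 k phi)"
proof -
  have wf: "lex_well_ordered (ts_supp f)" using assms(1) by (simp add: Lk_def)
  define h where "h = hahn_of f"
  define h0 where "h0 = hahn_of (trunc0 k f)"
  have f: "f = tser_of h" and f0: "trunc0 k f = tser_of h0"
    using wf trunc0_lex_well_ordered[OF wf] by (simp_all add: h_def h0_def tser_of_hahn_of)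
  have h: "supp h \<subseteq> depth k" "ord_ge z_lexp h" "coeff h z_lexp = lam"
    using assms(1,2) by (auto simp: f Lk_tser_of lead_lin_tser_of)
  have h0_cases: "coeff h0 x = coeff h x \<or> coeff h0 x = 0" for x
    using trunc0_cases[of k f "expo_of x"] unfolding f0 by (simp add: f tser_of_apply)
  have supp_h0: "supp h0 \<subseteq> supp h"
  proof
    fix x assume "x \<in> supp h0"
    then show "x \<in> supp h" using h0_cases[of x] by (simp add: supp_iff)
  qed
  then have h0: "supp h0 \<subseteq> depth k" "ord_ge z_lexp h0" using h by (auto simp: ord_ge_def)
  have "coeff h0 z_lexp = lam" using trunc0_z[of k f] h(3) unfolding f0 by (simp add: f tser_of_apply z_lexp_def)
  note h0 = h0 this
  define c where "c = ln lam"
  define eps where "eps = hmono (1 / lam) (- z_lexp) * h - 1"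
  define eps0 where "eps0 = hmono (1 / lam) (- z_lexp) * h0 - 1"
  define E where "E = hln1 eps"
  define E0 where "E0 = hln1 eps0"
  have g: "h = lin_exp c E" "ord_gt 0 eps" "supp E \<subseteq> pos_depth k"
    using lin_exp_exists[OF h(2,3) assms(3) h(1)] by (auto simp: c_def E_def eps_def)
  have g0: "h0 = lin_exp c E0" "ord_gt 0 eps0" "supp E0 \<subseteq> pos_depth k"
    using lin_exp_exists[OF h0(2,3) assms(3) h0(1)] by (auto simp: c_def E0_def eps0_def)
  have "c < 0" using assms(3,4) by (simp add: c_def)
  \<comment> \<open>\<open>eps\<close> and \<open>eps0\<close> differ only in terms removed by
    \<open>trunc0\<close>, and the logarithm does not lower the order of a difference. The double
    negations below match the form of \<open>ord_ge_hln1_diff\<close>.\<close>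
  have rem: "ord_gt (ones l) (E - E0)" if kl: "k \<le> l" for l
  proof (cases "eps = eps0")
    case False
    then have "eps - eps0 \<noteq> 0" by simp
    then obtain e where e: "ord_ge e (eps - eps0)" "coeff (eps - eps0) e \<noteq> 0" by (rule lead_exists)
    have ne: "coeff h (e + z_lexp) \<noteq> coeff h0 (e + z_lexp)"
      using e(2) by (auto simp: eps_def eps0_def coeff_hmono_times)
    then have "e + z_lexp \<in> supp h" using h0_cases[of "e + z_lexp"] by (auto simp: supp_iff)
    then have "e + z_lexp \<in> depth k" "z_lexp \<le> e + z_lexp" using h by (auto simp: ord_ge_def)
    then have "ones l < Lexp (expo_of (e + z_lexp)) - z_lexp"
      by (intro trunc0_remainder[where f = f, OF _ _ _ kl]) (use ne f0 in \<open>auto simp: f tser_of_apply\<close>)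
    then have lt: "ones l < e" by simp
    have "ord_ge e (- (eps - eps0))" using e(1) by (simp only: ord_ge_uminus)
    then have "ord_ge e (- eps - - eps0)" by simp
    then have "ord_ge e (hln1 (- (- eps)) - hln1 (- (- eps0)))"
      by (intro ord_ge_hln1_diff) (simp_all add: g(2) g0(2))
    then show ?thesis using ord_ge_imp_ord_gt[OF _ lt] by (simp add: E_def E0_def)
  qed (simp add: E_def E0_def)
  have ex1: "\<exists>!u. supp u \<subseteq> pos_depth l \<and> E + comp_op c E l u = u + comp_op 0 u l E0" if "k \<le> l" for l
    using g(3) g0(3) depth_mono[OF that] rem[OF that] \<open>c < 0\<close>
    by (intro conjugacy_equation) (auto simp: supp_pos_depth_iff)
  obtain u where u: "supp u \<subseteq> pos_depth k" "E + comp_op c E k u = u + comp_op 0 u k E0"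
    using ex1[OF order_refl] by blast
  have sol: "LL0 (tser_of (lin_exp 0 u))" "ts_comp (tser_of (lin_exp 0 u)) (ts_comp f (ts_inv (tser_of (lin_exp 0 u)))) = trunc0 k f"
    and Lk0: "Lk0 k (tser_of (lin_exp 0 u))"
    using u conjugate_iff[OF u(1) g(3) g0(3), of c] Lk0_iff_lin_exp
    unfolding f0 g0(1) by (auto simp: f g(1) LL0_def)
  have uniq: "phi = tser_of (lin_exp 0 u)"
    if phi: "LL0 phi" "ts_comp phi (ts_comp f (ts_inv phi)) = trunc0 k f" for phi
  proof -
    obtain l v where v: "supp v \<subseteq> pos_depth l" "phi = tser_of (lin_exp 0 v)" using phi(1) Lk0_iff_lin_exp LL0_def by metis
    \<comment> \<open>At depth \<open>max k l\<close> both \<open>v\<close> and the solution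
      \<open>u\<close> of depth \<open>k\<close> satisfy an equation with a unique solution, so the
      competitor has depth \<open>k\<close> after all.\<close>
    define n where "n = max k l"
    have kn: "k \<le> n" and ln: "l \<le> n" by (auto simp: n_def)
    have sub: "supp u \<subseteq> pos_depth n" "supp v \<subseteq> pos_depth n" "supp E \<subseteq> pos_depth n" "supp E0 \<subseteq> pos_depth n"
      using u(1) v(1) g(3) g0(3) pos_depth_mono[OF kn] pos_depth_mono[OF ln] by auto
    have "E + comp_op c E n v = v + comp_op 0 v n E0"
      using phi(2) conjugate_iff[OF sub(2,3,4), of c] unfolding f0 g0(1) by (simp add: f g(1) v(2))
    moreover have "comp_op c E n u = comp_op c E k u" "comp_op 0 u n E0 = comp_op 0 u k E0"
      using u(1) g0(3) by (auto intro!: comp_op_depth kn simp: supp_pos_depth_iff)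
    then have "E + comp_op c E n u = u + comp_op 0 u n E0" using u(2) by simp
    ultimately have "v = u" using ex1[OF kn] sub by blast
    then show ?thesis using v(2) by simp
  qed
  show ?thesis using sol Lk0 uniq by blast
qed

end
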